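(* For any countable discrete space $X$, $\mathrm{TC}(!X^{\mathbf{PCoh}})$ and $(\mathcal G X)^{\mathbf{ICones}}$ are isomorphic in $\mathbf{ICones}$, and thus the total elements of $!X^{\mathbf{PCoh}}$ are exactly the continuous mixtures of promotions, i.e. the elements $\int_{r\in\mathcal G X}^{(!X^{\mathbf{PCoh}})^{\mathbf{ICones}}}(r^{\mathbf{PCoh}})^!\,\mu(dr)$ for $\mu$ a probability measure on $\mathcal G X$.
   Context: $\mathcal G$ is the Giry monad; $\mathbf{ICones}$ is Ehrhard–Geoffroy's category of integrable cones, into which standard Borel spaces (via finite measures) and probabilistic coherence spaces (PCS) embed, written $(\cdot)^{\mathbf{ICones}}$. $X^{\mathbf{PCoh}}$ is the PCS with web $X$ and elements the sub-probability distributions on $X$; it is a PCS with totality whose total elements are the probability distributions; for $r\in\mathcal G X$, $(r^{\mathbf{PCoh}})_x=r(x)$. $!X^{\mathbf{PCoh}}$ has web the finite multisets over $X$ and elements the bi-orthogonal closure of the promotions $z^!$, $z^!_{[a_1,\ldots,a_n]}=\prod_i z_{a_i}$. Strict orthogonality: for $U\subseteq P(A)$, $U^{\perp\!\!\!\perp}:=\{v\in P(A)^\perp\mid\forall x\in U,\ \sum_a x_av_a=1\}$; the total elements of the exponential are $T(!X^{\mathbf{PCoh}})=\{z^!\mid z\in T(X^{\mathbf{PCoh}})\}^{\perp\!\!\!\perp\perp\!\!\!\perp}$. $\mathrm{TC}(!X^{\mathbf{PCoh}})$ is the totality cone: the sub-integrable cone of $(!X^{\mathbf{PCoh}})^{\mathbf{ICones}}$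 with underlying set $\{\lambda u\mid\lambda\ge0, u\in T(!X^{\mathbf{PCoh}})\}$, inheriting the algebraic and measurability structures. *)

theory Defs
  imports "HOL-Probability.Probability" "HOL-Library.Multiset"
begin

section \<open>Cones\<close>

text \<open>A cone is given by a carrier inside an arbitrary type together with its operations.
  The scalars are the nonnegative reals: \<open>cscale r\<close> is only meaningful for \<open>r \<ge> 0\<close>.\<close>

record 'v cone_data =
  points :: "'v set"
  cplus :: "'v \<Rightarrow> 'v \<Rightarrow> 'v"
  czero :: 'v
  cscale :: "real \<Rightarrow> 'v \<Rightarrow> 'v"
  cnorm :: "'v \<Rightarrow> real"

definition cone_le :: "('v, 'e) cone_data_scheme \<Rightarrow> 'v \<Rightarrow> 'v \<Rightarrow> bool" where
  "cone_le P x y \<longleftrightarrow> x \<in> points P \<and> y \<in> points P \<and> (\<exists>z\<in>points P. y = cplus P x z)"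

definition cone_chain :: "('v, 'e) cone_data_scheme \<Rightarrow> (nat \<Rightarrow> 'v) \<Rightarrow> bool" where
  "cone_chain P S \<longleftrightarrow> (\<forall>n. S n \<in> points P) \<and> (\<forall>n. cone_le P (S n) (S (Suc n)))"

definition cone_lub :: "('v, 'e) cone_data_scheme \<Rightarrow> (nat \<Rightarrow> 'v) \<Rightarrow> 'v \<Rightarrow> bool" where
  "cone_lub P S x \<longleftrightarrow> x \<in> points P \<and> (\<forall>n. cone_le P (S n) x) \<and>
     (\<forall>y\<in>points P. (\<forall>n. cone_le P (S n) y) \<longrightarrow> cone_le P x y)"

locale precone =
  fixes P :: "('v, 'e) cone_data_scheme"
  assumes plus_closed: "\<lbrakk>x \<in> points P; y \<in> points P\<rbrakk> \<Longrightarrow> cplus P x y \<in> points P"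
    and zero_closed: "czero P \<in> points P"
    and scale_closed: "\<lbrakk>0 \<le> r; x \<in> points P\<rbrakk> \<Longrightarrow> cscale P r x \<in> points P"
    and plus_assoc: "\<lbrakk>x \<in> points P; y \<in> points P; z \<in> points P\<rbrakk> \<Longrightarrow>
          cplus P (cplus P x y) z = cplus P x (cplus P y z)"
    and plus_commute: "\<lbrakk>x \<in> points P; y \<in> points P\<rbrakk> \<Longrightarrow> cplus P x y = cplus P y x"
    and plus_zero: "x \<in> points P \<Longrightarrow> cplus P x (czero P) = x"
    and scale_plus: "\<lbrakk>0 \<le> r; x \<in> points P; y \<in> points P\<rbrakk> \<Longrightarrow>
          cscale P r (cplus P x y) = cplus P (cscale P r x) (cscale P r y)"
    and plus_scale: "\<lbrakk>0 \<le> r; 0 \<le> s; x \<in> points P\<rbrakk> \<Longrightarrow>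
          cscale P (r + s) x = cplus P (cscale P r x) (cscale P s x)"
    and scale_scale: "\<lbrakk>0 \<le> r; 0 \<le> s; x \<in> points P\<rbrakk> \<Longrightarrow>
          cscale P r (cscale P s x) = cscale P (r * s) x"
    and scale_one: "x \<in> points P \<Longrightarrow> cscale P 1 x = x"
    and zero_scale: "x \<in> points P \<Longrightarrow> cscale P 0 x = czero P"
    and scale_zero: "0 \<le> r \<Longrightarrow> cscale P r (czero P) = czero P"
    and cancel: "\<lbrakk>x \<in> points P; y \<in> points P; z \<in> points P; cplus P x z = cplus P y z\<rbrakk> \<Longrightarrow> x = y"
    and positive: "\<lbrakk>x \<in> points P; y \<in> points P; cplus P x y = czero P\<rbrakk> \<Longrightarrow> x = czero P"

locale cone = precone P for P :: "('v, 'e) cone_data_scheme" +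
  assumes norm_nonneg: "x \<in> points P \<Longrightarrow> 0 \<le> cnorm P x"
    and norm_scale: "\<lbrakk>0 \<le> r; x \<in> points P\<rbrakk> \<Longrightarrow> cnorm P (cscale P r x) = r * cnorm P x"
    and norm_eq_zero: "\<lbrakk>x \<in> points P; cnorm P x = 0\<rbrakk> \<Longrightarrow> x = czero P"
    and norm_triangle: "\<lbrakk>x \<in> points P; y \<in> points P\<rbrakk> \<Longrightarrow>
          cnorm P (cplus P x y) \<le> cnorm P x + cnorm P y"
    and norm_mono: "\<lbrakk>x \<in> points P; y \<in> points P\<rbrakk> \<Longrightarrow> cnorm P x \<le> cnorm P (cplus P x y)"
    and unit_ball_complete: "\<lbrakk>cone_chain P S; \<And>n. cnorm P (S n) \<le> 1\<rbrakk> \<Longrightarrow>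
          \<exists>x. cone_lub P S x \<and> cnorm P x \<le> 1"

text \<open>A chain with a least upper bound is bounded in norm, and a bounded chain in a cone has a
  least upper bound, so the last clause is Scott continuity along bounded chains.\<close>

definition linear_continuous ::
    "('v, 'e) cone_data_scheme \<Rightarrow> ('w, 'f) cone_data_scheme \<Rightarrow> ('v \<Rightarrow> 'w) \<Rightarrow> bool" where
  "linear_continuous P Q f \<longleftrightarrow>
     f \<in> points P \<rightarrow> points Q \<and>
     f (czero P) = czero Q \<and>
     (\<forall>x\<in>points P. \<forall>y\<in>points P. f (cplus P x y) = cplus Q (f x) (f y)) \<and>
     (\<forall>r\<ge>0. \<forall>x\<in>points P. f (cscale P r x) = cscale Q r (f x)) \<and>
     (\<forall>S x. cone_chain P S \<and> cone_lub P S x \<longrightarrow> cone_lub Q (\<lambda>n. f (S n)) (f x))"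

text \<open>Taken in \<open>ennreal\<close>, where the supremum always exists and that of the empty set is 0.\<close>

definition op_norm ::
    "('v, 'e) cone_data_scheme \<Rightarrow> ('w, 'f) cone_data_scheme \<Rightarrow> ('v \<Rightarrow> 'w) \<Rightarrow> ennreal" where
  "op_norm P Q f = (SUP x\<in>{x \<in> points P. cnorm P x \<le> 1}. ennreal (cnorm Q (f x)))"

definition nonneg_real_cone :: "real cone_data" where
  "nonneg_real_cone =
     \<lparr>points = {0..}, cplus = (+), czero = 0, cscale = (*), cnorm = (\<lambda>x. x)\<rparr>"


section \<open>Measurable and integrable cones\<close>

definition standard_borel :: "'x measure \<Rightarrow> bool" where
  "standard_borel M \<longleftrightarrow>
     (\<exists>T. completely_metrizable_space T \<and> second_countable T \<and>
          topspace T = space M \<and> sets M = sigma_sets (space M) {U. openin T U})"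

text \<open>Arity spaces are the standard Borel spaces. They are represented on subsets of \<open>real\<close>: every
  standard Borel space is isomorphic to a Borel subset of the real line, so up to equivalence
  this small category contains all of them. Only the space and the measurable sets
  of an arity matter, not its measure.\<close>

definition arity_spaces :: "real measure set" where
  "arity_spaces = {M. standard_borel M}"

definition one_arity :: "real measure" where
  "one_arity = count_space {0}"

text \<open>\<open>tests P Y\<close> is the set of measurability tests of arity \<open>Y\<close>; a test \<open>m\<close> maps each point of
  \<open>Y\<close> to a linear continuous functional on the cone.\<close>

record 'v mcone_data = "'v cone_data" +
  tests :: "real measure \<Rightarrow> (real \<Rightarrow> 'v \<Rightarrow> real) set"

text \<open>The tests of the one-point arity, as plain functionals.\<close>

definition point_tests :: "('v, 'e) mcone_data_scheme \<Rightarrow> ('v \<Rightarrow> real) set" where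
  "point_tests C = (\<lambda>m. m 0) ` tests C one_arity"

locale measurable_cone = cone C for C :: "('v, 'e) mcone_data_scheme" +
  assumes test_functional: "\<lbrakk>Y \<in> arity_spaces; m \<in> tests C Y; s \<in> space Y\<rbrakk> \<Longrightarrow>
          linear_continuous C nonneg_real_cone (m s)"
    and test_measurable: "\<lbrakk>Y \<in> arity_spaces; m \<in> tests C Y; x \<in> points C\<rbrakk> \<Longrightarrow>
          (\<lambda>s. m s x) \<in> borel_measurable Y"
    and test_comp: "\<lbrakk>Y \<in> arity_spaces; Z \<in> arity_spaces; m \<in> tests C Y; \<phi> \<in> measurable Z Y\<rbrakk> \<Longrightarrow>
          (\<lambda>s. m (\<phi> s)) \<in> tests C Z"
    and test_separating: "\<lbrakk>x \<in> points C; y \<in> points C; \<And>l. l \<in> point_tests C \<Longrightarrow> l x = l y\<rbrakk> \<Longrightarrow> x = y"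
    and test_norming: "x \<in> points C \<Longrightarrow>
          ennreal (cnorm C x) =
            (SUP l\<in>{l \<in> point_tests C. \<exists>y\<in>points C. l y \<noteq> 0}.
               ennreal (l x) / op_norm C nonneg_real_cone l)"

definition measurable_path :: "'x measure \<Rightarrow> ('v, 'e) mcone_data_scheme \<Rightarrow> ('x \<Rightarrow> 'v) \<Rightarrow> bool" where
  "measurable_path X C \<gamma> \<longleftrightarrow>
     \<gamma> \<in> space X \<rightarrow> points C \<and>
     (\<exists>B. \<forall>r\<in>space X. cnorm C (\<gamma> r) \<le> B) \<and>
     (\<forall>Y\<in>arity_spaces. \<forall>m\<in>tests C Y. (\<lambda>(s, r). m s (\<gamma> r)) \<in> borel_measurable (Y \<Otimes>\<^sub>M X))"

definition has_cone_integral ::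
    "('v, 'e) mcone_data_scheme \<Rightarrow> 'x measure \<Rightarrow> ('x \<Rightarrow> 'v) \<Rightarrow> 'v \<Rightarrow> bool" where
  "has_cone_integral C \<mu> \<gamma> x \<longleftrightarrow>
     x \<in> points C \<and> (\<forall>l\<in>point_tests C. ennreal (l x) = (\<integral>\<^sup>+r. ennreal (l (\<gamma> r)) \<partial>\<mu>))"

definition cone_integral ::
    "('v, 'e) mcone_data_scheme \<Rightarrow> 'x measure \<Rightarrow> ('x \<Rightarrow> 'v) \<Rightarrow> 'v" where
  "cone_integral C \<mu> \<gamma> = (THE x. has_cone_integral C \<mu> \<gamma> x)"

text \<open>Here \<open>\<mu>\<close> carries both the arity and the finite measure on it.\<close>

locale integrable_cone = measurable_cone C for C :: "('v, 'e) mcone_data_scheme" +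
  assumes path_integrable: "\<lbrakk>\<mu> \<in> arity_spaces; finite_measure \<mu>; measurable_path \<mu> C \<gamma>\<rbrakk> \<Longrightarrow>
          \<exists>x. has_cone_integral C \<mu> \<gamma> x"

definition icones_hom ::
    "('v, 'e) mcone_data_scheme \<Rightarrow> ('w, 'f) mcone_data_scheme \<Rightarrow> ('v \<Rightarrow> 'w) \<Rightarrow> bool" where
  "icones_hom C D f \<longleftrightarrow>
     linear_continuous C D f \<and>
     op_norm C D f \<le> 1 \<and>
     (\<forall>X\<in>arity_spaces. \<forall>\<gamma>. measurable_path X C \<gamma> \<longrightarrow> measurable_path X D (\<lambda>r. f (\<gamma> r))) \<and>
     (\<forall>\<mu>\<in>arity_spaces. \<forall>\<gamma>. finite_measure \<mu> \<and> measurable_path \<mu> C \<gamma> \<longrightarrow>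
        f (cone_integral C \<mu> \<gamma>) = cone_integral D \<mu> (\<lambda>r. f (\<gamma> r)))"

definition icones_isomorphic ::
    "('v, 'e) mcone_data_scheme \<Rightarrow> ('w, 'f) mcone_data_scheme \<Rightarrow> bool" where
  "icones_isomorphic C D \<longleftrightarrow>
     integrable_cone C \<and> integrable_cone D \<and>
     (\<exists>f g. icones_hom C D f \<and> icones_hom D C g \<and>
        (\<forall>x\<in>points C. g (f x) = x) \<and> (\<forall>y\<in>points D. f (g y) = y))"


section \<open>The integrable cone of finite measures on a measurable space\<close>

definition add_measure :: "'x measure \<Rightarrow> 'x measure \<Rightarrow> 'x measure" where
  "add_measure \<mu> \<nu> = measure_of (space \<mu>) (sets \<mu>) (\<lambda>A. emeasure \<mu> A + emeasure \<nu> A)"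

definition measures_icone :: "'x measure \<Rightarrow> 'x measure mcone_data" where
  "measures_icone S =
     \<lparr>points = {\<mu>. sets \<mu> = sets S \<and> finite_measure \<mu>},
      cplus = add_measure,
      czero = null_measure S,
      cscale = (\<lambda>r. scale_measure (ennreal r)),
      cnorm = (\<lambda>\<mu>. measure \<mu> (space S)),
      tests = (\<lambda>Y. {(\<lambda>s \<mu>. measure \<mu> U) |U. U \<in> sets S})\<rparr>"


section \<open>Probabilistic coherence spaces\<close>

text \<open>Vectors indexed by the web are functions on the whole type that vanish off the web.\<close>

record 'i pcs =
  web :: "'i set"
  elems :: "('i \<Rightarrow> real) set"

definition pairing :: "'i set \<Rightarrow> ('i \<Rightarrow> real) \<Rightarrow> ('i \<Rightarrow> real) \<Rightarrow> ennreal" where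
  "pairing W x y = (\<Sum>\<^sub>\<infinity>i\<in>W. ennreal (x i * y i))"

definition orthogonal_set :: "'i set \<Rightarrow> ('i \<Rightarrow> real) set \<Rightarrow> ('i \<Rightarrow> real) set" where
  "orthogonal_set W U =
     {v. (\<forall>i. 0 \<le> v i) \<and> (\<forall>i. i \<notin> W \<longrightarrow> v i = 0) \<and> (\<forall>x\<in>U. pairing W x v \<le> 1)}"

definition pcs_dual :: "'i pcs \<Rightarrow> 'i pcs" where
  "pcs_dual A = \<lparr>web = web A, elems = orthogonal_set (web A) (elems A)\<rparr>"

definition strict_orthogonal :: "'i pcs \<Rightarrow> ('i \<Rightarrow> real) set \<Rightarrow> ('i \<Rightarrow> real) set" where
  "strict_orthogonal A U = {v \<in> elems (pcs_dual A). \<forall>x\<in>U. pairing (web A) x v = 1}"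

definition promotion :: "('i \<Rightarrow> real) \<Rightarrow> 'i multiset \<Rightarrow> real" where
  "promotion z m = (\<Prod>i\<in>#m. z i)"

definition bang :: "'i pcs \<Rightarrow> 'i multiset pcs" where
  "bang A = (let W = {m. set_mset m \<subseteq> web A} in
     \<lparr>web = W, elems = orthogonal_set W (orthogonal_set W (promotion ` elems A))\<rparr>)"

text \<open>Total elements of \<open>bang A\<close>, when \<open>T\<close> is the set of total elements of \<open>A\<close>. The outer
  strict orthogonal is taken in the dual of \<open>bang A\<close>, whose dual is \<open>bang A\<close> itself.\<close>

definition bang_total :: "'i pcs \<Rightarrow> ('i \<Rightarrow> real) set \<Rightarrow> ('i multiset \<Rightarrow> real) set" where
  "bang_total A T =
     strict_orthogonal (pcs_dual (bang A)) (strict_orthogonal (bang A) (promotion ` T))"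

definition discrete_pcs :: "'a set \<Rightarrow> 'a pcs" where
  "discrete_pcs X =
     \<lparr>web = X,
      elems = {x. (\<forall>a. 0 \<le> x a) \<and> (\<forall>a. a \<notin> X \<longrightarrow> x a = 0) \<and> (\<Sum>\<^sub>\<infinity>a\<in>X. ennreal (x a)) \<le> 1}\<rparr>"

definition discrete_total :: "'a set \<Rightarrow> ('a \<Rightarrow> real) set" where
  "discrete_total X =
     {x. (\<forall>a. 0 \<le> x a) \<and> (\<forall>a. a \<notin> X \<longrightarrow> x a = 0) \<and> (\<Sum>\<^sub>\<infinity>a\<in>X. ennreal (x a)) = 1}"

text \<open>The element of \<open>discrete_pcs X\<close> given by a measure on \<open>count_space X\<close>; it vanishes off
  \<open>X\<close> because non-measurable sets have measure 0.\<close>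

definition density_vector :: "'a measure \<Rightarrow> 'a \<Rightarrow> real" where
  "density_vector r x = measure r {x}"

definition pcs_icone :: "'i pcs \<Rightarrow> ('i \<Rightarrow> real) mcone_data" where
  "pcs_icone A =
     \<lparr>points = {(\<lambda>i. r * u i) |r u. 0 \<le> r \<and> u \<in> elems A},
      cplus = (\<lambda>x y i. x i + y i),
      czero = (\<lambda>i. 0),
      cscale = (\<lambda>r x i. r * x i),
      cnorm = (\<lambda>x. Inf {r. 0 < r \<and> (\<exists>u\<in>elems A. x = (\<lambda>i. r * u i))}),
      tests = (\<lambda>Y. {(\<lambda>s x. enn2real (pairing (web A) x v)) |v. v \<in> elems (pcs_dual A)})\<rparr>"

text \<open>The vector 0 is a multiple of any total element; adding it explicitly only matters when
  there are no total elements, where the totality cone is the zero cone.\<close>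

definition totality_cone :: "'i pcs \<Rightarrow> ('i \<Rightarrow> real) set \<Rightarrow> ('i \<Rightarrow> real) mcone_data" where
  "totality_cone A T =
     (pcs_icone A)\<lparr>points := insert (\<lambda>i. 0) {(\<lambda>i. r * u i) |r u. 0 \<le> r \<and> u \<in> T}\<rparr>"

end

theory Submission
  imports Defs
begin

text \<open>
  If a test vector takes the value 1 at every promotion of a probability vector, it still does after
  a unit of weight on a multiset \<open>m\<close> is spread over all the multisets \<open>m + {a}\<close>. Hence a total
  element \<open>u\<close> is 1 at the empty multiset and \<open>u m\<close> is the sum of the \<open>u (m + {a})\<close>: it
  is the law of an exchangeable sequence in \<open>X\<close>. As in de Finetti's theorem, the limiting frequencies
  of that sequence form a random probability distribution, and the moments of its law \<open>\<mu>\<close> are \<open>u\<close>.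
  Conversely, pairing commutes with integration, so mixtures of promotions are total.

  The moments determine \<open>\<mu>\<close>, and do so measurably in parameters, because indicators of boxes are
  pointwise limits of polynomials in the coordinates. In both cones the norm is additive and dominates all
  tests, so an additive bijection preserving the norm transports the whole structure.
\<close>

section \<open>Cones with an additive norm\<close>

text \<open>Total elements are given by two strict orthogonals, with no direct access to their
  coefficients. The access goes through test vectors, and a test has to stay nonnegative when a unit
  is taken away at \<open>m\<close>. So every \<open>m\<close> first needs a strict test of weight
  at least 1 there; it is obtained by pushing weight outwards from the empty multiset, one element
  at a time. For infinite \<open>X\<close> the limiting frequencies could lose mass: Fatou's lemma
  only bounds their sum by 1. Equality almost everywhere follows because the expected sum is exactly
  1. A bijection between the cones is not enough. Its inverse must send measurable paths to
  measurable paths, while the coefficient tests supply only the measurability of each single moment.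
  The determinacy argument is therefore run for a family of measures over an arbitrary measurable
  space, and injectivity of the moments is a special case. The two norms meet at the empty multiset:
  its coefficient is the total mass of the measure and also the gauge norm of the vector.\<close>

lemma cone_lub_nonneg_real:
  assumes "\<And>n. 0 \<le> S n" "incseq S" "S \<longlonglongrightarrow> x"
  shows "cone_lub nonneg_real_cone S x"
proof -
  have le: "cone_le nonneg_real_cone a b \<longleftrightarrow> 0 \<le> a \<and> a \<le> b" for a b
    by (auto simp: cone_le_def nonneg_real_cone_def intro!: bexI[of _ "b - a"])
  have "S n \<le> x" for n
    using assms(2,3) by (rule incseq_le)
  moreover from this have "0 \<le> x"
    using assms(1)[of 0] order_trans by blast
  moreover have "x \<le> y" if "\<And>n. S n \<le> y" for y
    using assms(3) that by (intro LIMSEQ_le_const2) auto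
  ultimately show ?thesis
    using assms(1) by (simp add: cone_lub_def le) (simp add: nonneg_real_cone_def)
qed

text \<open>An additive norm behaves like a functional, and \<open>norm_functional\<close> says that
  it is one of the tests: the total mass for measures, the coefficient at the empty multiset for
  total vectors. Continuity and norming of the tests then follow from their domination by the
  norm.\<close>

locale additive_cone = cone C for C :: "('v, 'e) mcone_data_scheme" +
  fixes L :: "('v \<Rightarrow> real) set"
  assumes norm_add: "\<lbrakk>x \<in> points C; y \<in> points C\<rbrakk> \<Longrightarrow> cnorm C (cplus C x y) = cnorm C x + cnorm C y"
    and norm_lub: "\<lbrakk>cone_chain C S; cone_lub C S x\<rbrakk> \<Longrightarrow> (\<lambda>n. cnorm C (S n)) \<longlonglongrightarrow> cnorm C x"
    and tests_const: "tests C = (\<lambda>Y. (\<lambda>l s. l) ` L)"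
    and functional_zero: "l \<in> L \<Longrightarrow> l (czero C) = 0"
    and functional_add: "\<lbrakk>l \<in> L; x \<in> points C; y \<in> points C\<rbrakk> \<Longrightarrow> l (cplus C x y) = l x + l y"
    and functional_scale: "\<lbrakk>l \<in> L; 0 \<le> r; x \<in> points C\<rbrakk> \<Longrightarrow> l (cscale C r x) = r * l x"
    and functional_nonneg: "\<lbrakk>l \<in> L; x \<in> points C\<rbrakk> \<Longrightarrow> 0 \<le> l x"
    and functional_le: "\<lbrakk>l \<in> L; x \<in> points C\<rbrakk> \<Longrightarrow> l x \<le> cnorm C x"
    and separating: "\<lbrakk>x \<in> points C; y \<in> points C; \<And>l. l \<in> L \<Longrightarrow> l x = l y\<rbrakk> \<Longrightarrow> x = y"
    and norm_functional: "\<exists>l\<in>L. \<forall>x\<in>points C. l x = cnorm C x"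
begin

lemma point_tests_eq: "point_tests C = L"
  by (auto simp: point_tests_def tests_const image_image)

lemma cone_leE:
  assumes "cone_le C x y"
  obtains z where "x \<in> points C" "y \<in> points C" "z \<in> points C" "y = cplus C x z"
  using assms by (auto simp: cone_le_def)

text \<open>The gap between a chain and its supremum is small in norm, hence small under any
  functional dominated by the norm.\<close>

lemma functional_continuous:
  assumes l: "l \<in> L"
  shows "linear_continuous C nonneg_real_cone l"
  unfolding linear_continuous_def
proof (intro conjI ballI allI impI)
  show "l \<in> points C \<rightarrow> points nonneg_real_cone"
    using functional_nonneg[OF l] by (auto simp: nonneg_real_cone_def)
  show "l (czero C) = czero nonneg_real_cone"
    using functional_zero[OF l] by (simp add: nonneg_real_cone_def)
  show "l (cplus C x y) = cplus nonneg_real_cone (l x) (l y)" if "x \<in> points C" "y \<in> points C" for x y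
    using functional_add[OF l] that by (simp add: nonneg_real_cone_def)
  show "l (cscale C r x) = cscale nonneg_real_cone r (l x)" if "0 \<le> r" "x \<in> points C" for r x
    using functional_scale[OF l] that by (simp add: nonneg_real_cone_def)
next
  fix S x assume S: "cone_chain C S \<and> cone_lub C S x"
  then have pts: "S n \<in> points C" for n by (simp add: cone_chain_def)
  have gap: "l (S n) \<le> l x \<and> l x - l (S n) \<le> cnorm C x - cnorm C (S n)" for n
  proof -
    from S have "cone_le C (S n) x" by (simp add: cone_lub_def)
    then obtain z where z: "z \<in> points C" "x = cplus C (S n) z" by (rule cone_leE)
    then show ?thesis
      using functional_add[OF l pts[of n] z(1)] norm_add[OF pts[of n] z(1)]
        functional_nonneg[OF l z(1)] functional_le[OF l z(1)] by simp
  qed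
  have "l (S n) \<le> l (S (Suc n))" for n
  proof -
    from S have "cone_le C (S n) (S (Suc n))" by (simp add: cone_chain_def)
    then obtain z where "z \<in> points C" "S (Suc n) = cplus C (S n) z" by (rule cone_leE)
    then show ?thesis
      using functional_add[OF l pts[of n]] functional_nonneg[OF l] by simp
  qed
  then have "incseq (\<lambda>n. l (S n))" by (rule incseq_SucI)
  moreover have "(\<lambda>n. l (S n)) \<longlonglongrightarrow> l x"
  proof -
    have "(\<lambda>n. cnorm C x - cnorm C (S n)) \<longlonglongrightarrow> cnorm C x - cnorm C x"
      using S by (intro tendsto_intros norm_lub) auto
    moreover have "\<forall>\<^sub>F n in sequentially. norm (l x - l (S n)) \<le> cnorm C x - cnorm C (S n)"
      using gap by simp
    ultimately have "(\<lambda>n. l x - l (S n)) \<longlonglongrightarrow> 0"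
      by (simp only: diff_self) (rule Lim_null_comparison)
    then have "(\<lambda>n. l x - (l x - l (S n))) \<longlonglongrightarrow> l x - 0"
      by (intro tendsto_intros)
    then show ?thesis by simp
  qed
  ultimately show "cone_lub nonneg_real_cone (\<lambda>n. l (S n)) (l x)"
    using functional_nonneg[OF l pts] by (intro cone_lub_nonneg_real)
qed

text \<open>Normalise \<open>x\<close> to the unit sphere. If its norm is 0, domination by the norm
  already forces \<open>l x\<close> to be 0.\<close>

lemma functional_le_op_norm:
  assumes l: "l \<in> L" and x: "x \<in> points C"
  shows "ennreal (l x) \<le> op_norm C nonneg_real_cone l * ennreal (cnorm C x)"
proof (cases "cnorm C x = 0")
  case True
  with functional_le[OF l x] functional_nonneg[OF l x] show ?thesis by simp
next
  case False
  with norm_nonneg[OF x] have pos: "0 < cnorm C x" by simp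
  let ?y = "cscale C (1 / cnorm C x) x"
  have y: "?y \<in> points C" "cnorm C ?y = 1" "l ?y = l x / cnorm C x"
    using pos x scale_closed norm_scale functional_scale[OF l] by auto
  have "ennreal (l x / cnorm C x) \<le> op_norm C nonneg_real_cone l"
    unfolding op_norm_def using y
    by (intro SUP_upper2[of ?y]) (auto simp: nonneg_real_cone_def)
  then have "ennreal (l x / cnorm C x) * ennreal (cnorm C x) \<le>
      op_norm C nonneg_real_cone l * ennreal (cnorm C x)"
    by (rule mult_right_mono) simp
  moreover have "ennreal (l x / cnorm C x) * ennreal (cnorm C x) = ennreal (l x)"
    using pos functional_nonneg[OF l x] by (simp flip: ennreal_mult)
  ultimately show ?thesis by simp
qed

lemma op_norm_le_one: "l \<in> L \<Longrightarrow> op_norm C nonneg_real_cone l \<le> 1"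
  unfolding op_norm_def
proof (rule SUP_least)
  fix x assume "l \<in> L" "x \<in> {x \<in> points C. cnorm C x \<le> 1}"
  then have "l x \<le> 1" using functional_le[of l x] by simp
  then show "ennreal (cnorm nonneg_real_cone (l x)) \<le> 1" by (simp add: nonneg_real_cone_def)
qed

text \<open>The supremum is reached at the test that equals the norm: its operator norm is at most
  1, so dividing by it cannot decrease the value. The other tests stay below by the definition of
  the operator norm; their divisors are neither 0 nor infinite.\<close>

lemma norming:
  assumes x: "x \<in> points C"
  shows "ennreal (cnorm C x) =
    (SUP l\<in>{l \<in> L. \<exists>y\<in>points C. l y \<noteq> 0}. ennreal (l x) / op_norm C nonneg_real_cone l)"
    (is "_ = (SUP l\<in>?N. ?q l)")
proof (rule antisym)
  obtain n where n: "n \<in> L" "\<And>x. x \<in> points C \<Longrightarrow> n x = cnorm C x"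
    using norm_functional by auto
  show "ennreal (cnorm C x) \<le> (SUP l\<in>?N. ?q l)"
  proof (cases "cnorm C x = 0")
    case False
    then have "n \<in> ?N" using n x by auto
    have "1 \<le> inverse (op_norm C nonneg_real_cone n)"
    proof (cases "op_norm C nonneg_real_cone n")
      case (real r)
      with op_norm_le_one[OF n(1)] have "r \<le> 1" by (simp add: ennreal_le_1)
      then show ?thesis using real by (cases "r = 0") (auto simp: inverse_ennreal one_le_inverse_iff)
    qed (use op_norm_le_one[OF n(1)] in \<open>simp add: top_unique\<close>)
    then have "ennreal (n x) * 1 \<le> ennreal (n x) * inverse (op_norm C nonneg_real_cone n)"
      by (rule mult_left_mono) simp
    then show ?thesis
      using \<open>n \<in> ?N\<close> n(2)[OF x] by (intro SUP_upper2[of n]) (auto simp: divide_ennreal_def)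
  qed simp
  show "(SUP l\<in>?N. ?q l) \<le> ennreal (cnorm C x)"
  proof (rule SUP_least)
    fix l assume "l \<in> ?N"
    then obtain y where l: "l \<in> L" and y: "y \<in> points C" "l y \<noteq> 0" by auto
    have "ennreal (l y) \<le> op_norm C nonneg_real_cone l * ennreal (cnorm C y)"
      using functional_le_op_norm[OF l y(1)] .
    moreover have "ennreal (l y) \<noteq> 0"
      using y functional_nonneg[OF l y(1)] by (simp add: ennreal_eq_0_iff)
    ultimately have "op_norm C nonneg_real_cone l \<noteq> 0" by auto
    moreover have "op_norm C nonneg_real_cone l \<noteq> \<top>"
      using op_norm_le_one[OF l] by (auto simp: top_unique)
    ultimately show "?q l \<le> ennreal (cnorm C x)"
      using functional_le_op_norm[OF l x]
      by (subst divide_le_posI_ennreal) (auto simp: zero_less_iff_neq_zero mult.commute)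
  qed
qed

lemma measurable_cone: "measurable_cone C"
proof (unfold_locales, goal_cases)
  case (1 Y m s)
  then show ?case by (auto simp: tests_const intro: functional_continuous)
next
  case (2 Y m x)
  then show ?case by (auto simp: tests_const)
next
  case (3 Y Z m \<phi>)
  then show ?case by (auto simp: tests_const)
next
  case (4 x y)
  then show ?case by (auto simp: point_tests_eq intro: separating)
next
  case (5 x)
  then show ?case unfolding point_tests_eq by (rule norming)
qed

text \<open>The tests do not depend on the point of the arity, so joint measurability is
  measurability in the path parameter. For the forward direction one arity has to be exhibited; the
  one-point space is standard Borel.\<close>

lemma measurable_path_iff:
  "measurable_path M C \<gamma> \<longleftrightarrow> \<gamma> \<in> space M \<rightarrow> points C \<and>
     (\<exists>B. \<forall>r\<in>space M. cnorm C (\<gamma> r) \<le> B) \<and> (\<forall>l\<in>L. (\<lambda>r. l (\<gamma> r)) \<in> borel_measurable M)"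
proof -
  have "sigma_sets {0::real} {U. openin (discrete_topology {0}) U} = Pow {0}"
    using sigma_algebra.sigma_sets_eq[OF sigma_algebra_Pow, of "{0::real}"] by (simp add: Pow_def)
  then have one: "one_arity \<in> arity_spaces"
    unfolding arity_spaces_def standard_borel_def one_arity_def
    by (intro CollectI exI[of _ "discrete_topology {0}"] conjI completely_metrizable_space_discrete_topology)
      (simp_all add: second_countable_discrete_topology del: openin_discrete_topology)
  have "(\<forall>Y\<in>arity_spaces. \<forall>m\<in>tests C Y. (\<lambda>(s, r). m s (\<gamma> r)) \<in> borel_measurable (Y \<Otimes>\<^sub>M M)) \<longleftrightarrow>
      (\<forall>l\<in>L. (\<lambda>r. l (\<gamma> r)) \<in> borel_measurable M)" (is "?lhs \<longleftrightarrow> ?rhs")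
  proof
    assume ?lhs
    show ?rhs
    proof
      fix l assume "l \<in> L"
      with \<open>?lhs\<close> one have "(\<lambda>(s, r). l (\<gamma> r)) \<in> borel_measurable (one_arity \<Otimes>\<^sub>M M)"
        by (simp add: tests_const)
      from measurable_compose[OF measurable_Pair1' this, of 0]
      show "(\<lambda>r. l (\<gamma> r)) \<in> borel_measurable M"
        by (simp add: one_arity_def)
    qed
  next
    assume rhs: ?rhs
    show ?lhs
    proof (intro ballI)
      fix Y m assume "m \<in> tests C Y"
      then obtain l where "l \<in> L" "m = (\<lambda>s. l)" by (auto simp: tests_const)
      with rhs measurable_compose[OF measurable_snd, of "\<lambda>r. l (\<gamma> r)" M borel Y]
      show "(\<lambda>(s, r). m s (\<gamma> r)) \<in> borel_measurable (Y \<Otimes>\<^sub>M M)"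
        by (simp add: split_beta')
    qed
  qed
  then show ?thesis
    unfolding measurable_path_def by simp
qed

text \<open>Tests separate points, so the integral is unique and the definite description picks any
  value that has been computed.\<close>

lemma cone_integral_eqI:
  assumes "has_cone_integral C \<mu> \<gamma> x"
  shows "cone_integral C \<mu> \<gamma> = x"
  unfolding cone_integral_def
proof (rule the_equality)
  show "has_cone_integral C \<mu> \<gamma> x" by fact
next
  fix y assume "has_cone_integral C \<mu> \<gamma> y"
  with assms have "x \<in> points C" "y \<in> points C" "\<And>l. l \<in> L \<Longrightarrow> ennreal (l y) = ennreal (l x)"
    by (auto simp: has_cone_integral_def point_tests_eq)
  then show "y = x"
    by (intro separating) (simp_all add: functional_nonneg)
qed

end

section \<open>Transport of cone structure along a norm-preserving additive bijection\<close>

locale cone_bijection = P: cone P for P :: "('v, 'e) cone_data_scheme" +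
  fixes Q :: "('w, 'f) cone_data_scheme" and f :: "'v \<Rightarrow> 'w"
  assumes bij: "bij_betw f (points P) (points Q)"
    and map_zero: "f (czero P) = czero Q"
    and map_plus: "\<lbrakk>x \<in> points P; y \<in> points P\<rbrakk> \<Longrightarrow> f (cplus P x y) = cplus Q (f x) (f y)"
    and map_scale: "\<lbrakk>0 \<le> r; x \<in> points P\<rbrakk> \<Longrightarrow> f (cscale P r x) = cscale Q r (f x)"
    and map_norm: "x \<in> points P \<Longrightarrow> cnorm Q (f x) = cnorm P x"
begin

abbreviation inv_map :: "'w \<Rightarrow> 'v" where "inv_map \<equiv> inv_into (points P) f"

lemma points_Q: "points Q = f ` points P"
  using bij by (simp add: bij_betw_def)

lemma map_in: "x \<in> points P \<Longrightarrow> f x \<in> points Q"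
  by (simp add: points_Q)

lemma map_eq: "\<lbrakk>x \<in> points P; y \<in> points P\<rbrakk> \<Longrightarrow> f x = f y \<longleftrightarrow> x = y"
  using bij by (auto simp: bij_betw_def inj_on_def)

lemma inverse_in: "y \<in> points Q \<Longrightarrow> inv_map y \<in> points P"
  by (simp add: points_Q inv_into_into)

lemma map_inverse: "y \<in> points Q \<Longrightarrow> f (inv_map y) = y"
  by (simp add: points_Q f_inv_into_f)

lemma inverse_map: "x \<in> points P \<Longrightarrow> inv_map (f x) = x"
  using bij by (simp add: bij_betw_def inv_into_f_f)

text \<open>The cone order is defined from addition alone, so it is transported in both directions;
  chains and least upper bounds follow it.\<close>

lemma map_le: "\<lbrakk>x \<in> points P; y \<in> points P\<rbrakk> \<Longrightarrow> cone_le Q (f x) (f y) \<longleftrightarrow> cone_le P x y"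
  unfolding cone_le_def points_Q
  by (auto simp: map_plus[symmetric] map_eq P.plus_closed)

lemma map_chain: "(\<And>n. S n \<in> points P) \<Longrightarrow> cone_chain Q (\<lambda>n. f (S n)) \<longleftrightarrow> cone_chain P S"
  by (simp add: cone_chain_def map_le map_in)

lemma map_lub:
  "(\<And>n. S n \<in> points P) \<Longrightarrow> x \<in> points P \<Longrightarrow> cone_lub Q (\<lambda>n. f (S n)) (f x) \<longleftrightarrow> cone_lub P S x"
  unfolding cone_lub_def points_Q by (auto simp: map_le)

text \<open>\<open>Q\<close> is not assumed to be a cone. This is how the totality cone gets its
  axioms, in particular closure under addition and completeness of the unit ball, which its
  definition does not make visible.\<close>

lemma cone_image: "cone Q"
proof (unfold_locales, goal_cases)
  case (1 x y) then show ?case by (auto simp: points_Q map_plus[symmetric] P.plus_closed)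
next
  case 2 then show ?case by (auto simp: points_Q map_zero[symmetric] P.zero_closed)
next
  case (3 r x) then show ?case by (auto simp: points_Q map_scale[symmetric] P.scale_closed)
next
  case (4 x y z) then show ?case
    by (auto simp: points_Q map_plus[symmetric] P.plus_closed P.plus_assoc)
next
  case (5 x y) then show ?case by (auto simp: points_Q map_plus[symmetric] P.plus_commute)
next
  case (6 x) then show ?case
    by (auto simp: points_Q map_plus[symmetric] map_zero[symmetric] P.zero_closed P.plus_zero)
next
  case (7 r x y) then show ?case
    by (auto simp: points_Q map_plus[symmetric] map_scale[symmetric] P.scale_plus P.plus_closed P.scale_closed)
next
  case (8 r s x) then show ?case
    by (auto simp: points_Q map_plus[symmetric] map_scale[symmetric] P.plus_scale P.plus_closed P.scale_closed)
next
  case (9 r s x) then show ?case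
    by (auto simp: points_Q map_scale[symmetric] P.scale_scale P.scale_closed)
next
  case (10 x) then show ?case by (auto simp: points_Q map_scale[symmetric] P.scale_one)
next
  case (11 x) then show ?case by (auto simp: points_Q map_scale[symmetric] map_zero P.zero_scale)
next
  case (12 r) then show ?case
    by (auto simp: map_scale[symmetric] map_zero[symmetric] P.scale_zero P.zero_closed)
next
  case (13 x y z) then show ?case
    by (clarsimp simp: points_Q map_plus[symmetric] map_eq P.plus_closed) (metis P.cancel)
next
  case (14 x y) then show ?case
    by (clarsimp simp: points_Q map_plus[symmetric] map_zero[symmetric] map_eq P.plus_closed P.zero_closed)
      (metis P.positive)
next
  case (15 x) then show ?case by (auto simp: points_Q map_norm P.norm_nonneg)
next
  case (16 r x) then show ?case
    by (auto simp: points_Q map_norm map_scale[symmetric] P.scale_closed P.norm_scale)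
next
  case (17 x) then show ?case by (clarsimp simp: points_Q map_norm map_zero[symmetric]) (metis P.norm_eq_zero)
next
  case (18 x y) then show ?case
    by (auto simp: points_Q map_norm map_plus[symmetric] P.plus_closed P.norm_triangle)
next
  case (19 x y) then show ?case
    by (auto simp: points_Q map_norm map_plus[symmetric] P.plus_closed P.norm_mono)
next
  case (20 S)
  define S' where "S' n = inv_map (S n)" for n
  have pts: "S n \<in> points Q" for n using 20(1) by (simp add: cone_chain_def)
  have S': "\<And>n. S' n \<in> points P" "S = (\<lambda>n. f (S' n))"
    by (auto simp: S'_def inverse_in map_inverse pts)
  have "cone_chain P S'" using 20(1) S' map_chain by metis
  moreover have "cnorm P (S' n) \<le> 1" for n using 20(2)[of n] S' map_norm by metis
  ultimately obtain x where x: "cone_lub P S' x" "cnorm P x \<le> 1" using P.unit_ball_complete by blast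
  then have "x \<in> points P" by (simp add: cone_lub_def)
  with x show ?case using map_lub[of S' x] S' map_norm by auto
qed

lemma map_linear_continuous: "linear_continuous P Q f"
  unfolding linear_continuous_def
proof (intro conjI ballI allI impI)
  fix S x assume "cone_chain P S \<and> cone_lub P S x"
  moreover from this have "\<And>n. S n \<in> points P" "x \<in> points P"
    by (auto simp: cone_chain_def cone_lub_def)
  ultimately show "cone_lub Q (\<lambda>n. f (S n)) (f x)" by (simp add: map_lub)
qed (auto simp: map_in map_zero map_plus map_scale)

lemma inverse_linear_continuous: "linear_continuous Q P inv_map"
  unfolding linear_continuous_def
proof (intro conjI ballI allI impI)
  show "inv_map \<in> points Q \<rightarrow> points P" by (auto simp: inverse_in)
  show "inv_map (czero Q) = czero P" by (simp add: map_zero[symmetric] inverse_map P.zero_closed)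
  show "inv_map (cplus Q x y) = cplus P (inv_map x) (inv_map y)" if "x \<in> points Q" "y \<in> points Q" for x y
    using that by (auto simp: points_Q map_plus[symmetric] inverse_map P.plus_closed)
  show "inv_map (cscale Q r x) = cscale P r (inv_map x)" if "0 \<le> r" "x \<in> points Q" for r x
    using that by (auto simp: points_Q map_scale[symmetric] inverse_map P.scale_closed)
  show "cone_lub P (\<lambda>n. inv_map (S n)) (inv_map x)" if "cone_chain Q S \<and> cone_lub Q S x" for S x
  proof -
    have "\<And>n. S n \<in> points Q" "x \<in> points Q" using that by (auto simp: cone_chain_def cone_lub_def)
    then show ?thesis
      using map_lub[of "\<lambda>n. inv_map (S n)" "inv_map x"] that by (simp add: inverse_in map_inverse)
  qed
qed

lemma map_op_norm: "op_norm P Q f \<le> 1"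
  unfolding op_norm_def by (rule SUP_least) (auto simp: map_norm)

lemma inverse_op_norm: "op_norm Q P inv_map \<le> 1"
  unfolding op_norm_def by (rule SUP_least) (auto simp: points_Q map_norm inverse_map)

end

section \<open>Finite measures\<close>

lemma space_add_measure [simp]: "space (add_measure \<mu> \<nu>) = space \<mu>"
  by (simp add: add_measure_def space_measure_of_conv)

lemma sets_add_measure [simp]: "sets (add_measure \<mu> \<nu>) = sets \<mu>"
  by (simp add: add_measure_def)

lemma emeasure_add_measure:
  assumes "sets \<mu> = sets \<nu>"
  shows "emeasure (add_measure \<mu> \<nu>) A = emeasure \<mu> A + emeasure \<nu> A"
proof (cases "A \<in> sets \<mu>")
  case True
  show ?thesis
    unfolding add_measure_def
  proof (rule emeasure_measure_of_sigma[OF _ _ _ True])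
    show "countably_additive (sets \<mu>) (\<lambda>A. emeasure \<mu> A + emeasure \<nu> A)"
      using assms by (auto simp: countably_additive_def suminf_emeasure suminf_add[symmetric])
  qed (auto simp: positive_def sets.sigma_algebra_axioms)
qed (use assms in \<open>simp add: emeasure_notin_sets\<close>)

lemma measure_add_measure:
  assumes "sets \<mu> = sets \<nu>" "finite_measure \<mu>" "finite_measure \<nu>"
  shows "measure (add_measure \<mu> \<nu>) A = measure \<mu> A + measure \<nu> A"
  using emeasure_add_measure[OF assms(1), of A] assms(2,3)[THEN finite_measure.emeasure_finite, of A]
  by (simp add: measure_def enn2real_plus less_top)

lemma finite_measure_add_measure:
  assumes "sets \<mu> = sets \<nu>" "finite_measure \<mu>" "finite_measure \<nu>"
  shows "finite_measure (add_measure \<mu> \<nu>)"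
  using assms(2,3)[THEN finite_measure.emeasure_finite]
  by (intro finite_measureI) (simp add: emeasure_add_measure[OF assms(1)])

lemma measures_icone_simps [simp]:
  "points (measures_icone S) = {\<mu>. sets \<mu> = sets S \<and> finite_measure \<mu>}"
  "cplus (measures_icone S) = add_measure"
  "czero (measures_icone S) = null_measure S"
  "cscale (measures_icone S) r = scale_measure (ennreal r)"
  "cnorm (measures_icone S) \<mu> = measure \<mu> (space S)"
  by (simp_all add: measures_icone_def)

lemma finite_measure_null_measure: "finite_measure (null_measure S)"
  by (rule finite_measureI) simp

lemma finite_measure_scale_measure:
  "finite_measure \<mu> \<Longrightarrow> finite_measure (scale_measure (ennreal r) \<mu>)"
  by (rule finite_measureI) (simp add: ennreal_mult_eq_top_iff finite_measure.emeasure_finite space_scale_measure)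

lemma precone_measures: "precone (measures_icone S)"
proof (unfold_locales, goal_cases)
  case (13 x y z)
  show ?case
  proof (rule measure_eqI)
    fix A assume "A \<in> sets x"
    have "emeasure x A + emeasure z A = emeasure y A + emeasure z A"
      using 13 by (simp flip: emeasure_add_measure)
    then show "emeasure x A = emeasure y A"
      using 13(3) by (simp add: finite_measure.emeasure_finite ennreal_add_left_cancel add.commute)
  qed (use 13 in simp)
next
  case (14 x y)
  show ?case
  proof (rule measure_eqI)
    fix A assume "A \<in> sets x"
    have "emeasure x A + emeasure y A = emeasure (czero (measures_icone S)) A"
      using 14 emeasure_add_measure[of x y A] by simp
    then show "emeasure x A = emeasure (czero (measures_icone S)) A" by simp
  qed (use 14 in simp)
next
  case (1 x y) then show ?case by (simp add: finite_measure_add_measure)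
next
  case 2 then show ?case by (simp add: finite_measure_null_measure)
next
  case (3 r x) then show ?case by (simp add: finite_measure_scale_measure)
next
  case (4 x y z) then show ?case by (intro measure_eqI) (auto simp: emeasure_add_measure add.assoc)
next
  case (5 x y) then show ?case by (intro measure_eqI) (auto simp: emeasure_add_measure add.commute)
next
  case (6 x) then show ?case by (intro measure_eqI) (auto simp: emeasure_add_measure)
next
  case (7 r x y) then show ?case by (intro measure_eqI) (auto simp: emeasure_add_measure distrib_left)
next
  case (8 r s x) then show ?case by (intro measure_eqI) (auto simp: emeasure_add_measure distrib_right)
next
  case (9 r s x) then show ?case by (intro measure_eqI) (auto simp: ennreal_mult mult.assoc)
next
  case (10 x) then show ?case by (intro measure_eqI) auto
next
  case (11 x) then show ?case by (intro measure_eqI) auto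
next
  case (12 r) then show ?case by (intro measure_eqI) auto
qed

text \<open>Setwise domination makes the difference of the two measures a finite measure, which is
  the summand that the cone order asks for.\<close>

lemma cone_le_measures:
  assumes "\<mu> \<in> points (measures_icone S)" "\<nu> \<in> points (measures_icone S)"
  shows "cone_le (measures_icone S) \<mu> \<nu> \<longleftrightarrow> (\<forall>A\<in>sets S. emeasure \<mu> A \<le> emeasure \<nu> A)"
proof
  assume "cone_le (measures_icone S) \<mu> \<nu>"
  then show "\<forall>A\<in>sets S. emeasure \<mu> A \<le> emeasure \<nu> A"
    using assms by (auto simp: cone_le_def emeasure_add_measure)
next
  assume le: "\<forall>A\<in>sets S. emeasure \<mu> A \<le> emeasure \<nu> A"
  let ?d = "diff_measure \<nu> \<mu>"
  have d: "emeasure ?d A = emeasure \<nu> A - emeasure \<mu> A" if "A \<in> sets S" for A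
    using assms le that by (intro emeasure_diff_measure) auto
  have eq: "\<nu> = add_measure \<mu> ?d"
  proof (rule measure_eqI)
    fix A assume "A \<in> sets \<nu>"
    then show "emeasure \<nu> A = emeasure (add_measure \<mu> ?d) A"
      using assms le d by (simp add: emeasure_add_measure add_diff_inverse_ennreal)
  qed (use assms in simp)
  have fin: "finite_measure ?d"
  proof (rule finite_measureI)
    have "space ?d = space S" using assms sets_eq_imp_space_eq[of \<nu> S] by simp
    then have "emeasure ?d (space ?d) \<le> emeasure \<nu> (space S)"
      using d[of "space S"] by (simp add: diff_le_self_ennreal)
    then show "emeasure ?d (space ?d) \<noteq> \<infinity>"
      using assms finite_measure.emeasure_finite[of \<nu> "space S"] by (auto simp: top_unique)
  qed
  have "\<exists>z\<in>points (measures_icone S). \<nu> = add_measure \<mu> z"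
    by (rule bexI[where P="\<lambda>z. \<nu> = add_measure \<mu> z", OF eq]) (use assms fin in simp)
  then show "cone_le (measures_icone S) \<mu> \<nu>"
    using assms by (simp add: cone_le_def)
qed

text \<open>Monotone suprema commute with countable sums, so the setwise supremum is again a
  measure. The bound \<open>B\<close> is left general because it is also instantiated with the mass
  of a given least upper bound.\<close>

lemma measures_chain_lub:
  fixes T :: "nat \<Rightarrow> 'x measure"
  assumes chain: "cone_chain (measures_icone S) T"
    and bound: "\<And>n. emeasure (T n) (space S) \<le> B" "B < \<top>"
  shows "\<exists>\<mu>. cone_lub (measures_icone S) T \<mu> \<and> (\<forall>A. emeasure \<mu> A = (SUP n. emeasure (T n) A))"
proof -
  have T: "sets (T n) = sets S" "T n \<in> points (measures_icone S)" for n
    using chain by (auto simp: cone_chain_def)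
  note [simp] = sets_eq_imp_space_eq[OF T(1)]
  have inc: "incseq (\<lambda>n. emeasure (T n) A)" for A
  proof (cases "A \<in> sets S")
    case True
    with chain T(2) show ?thesis
      by (auto simp: cone_chain_def cone_le_measures simp del: measures_icone_simps intro!: incseq_SucI)
  qed (simp add: T emeasure_notin_sets)
  define \<mu> where "\<mu> = measure_of (space S) (sets S) (\<lambda>A. SUP n. emeasure (T n) A)"
  have sets_\<mu>: "sets \<mu> = sets S" by (simp add: \<mu>_def)
  have em: "emeasure \<mu> A = (SUP n. emeasure (T n) A)" for A
  proof (cases "A \<in> sets S")
    case True
    show ?thesis
      unfolding \<mu>_def
    proof (rule emeasure_measure_of_sigma[OF _ _ _ True])
      show "countably_additive (sets S) (\<lambda>A. SUP n. emeasure (T n) A)"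
      proof (rule countably_additiveI)
        fix F :: "nat \<Rightarrow> _" assume "range F \<subseteq> sets S" "disjoint_family F"
        then show "(\<Sum>i. SUP n. emeasure (T n) (F i)) = (SUP n. emeasure (T n) (\<Union>i. F i))"
          using T by (subst ennreal_suminf_SUP_eq[OF inc]) (simp add: suminf_emeasure)
      qed
    qed (auto simp: positive_def sets.sigma_algebra_axioms)
  qed (simp add: emeasure_notin_sets T sets_\<mu>)
  have "space \<mu> = space S" by (simp add: \<mu>_def space_measure_of_conv)
  then have "emeasure \<mu> (space \<mu>) \<le> B"
    by (simp add: em SUP_le_iff bound)
  then have "finite_measure \<mu>"
    using bound(2) by (intro finite_measureI) (auto simp: top_unique)
  then have pt: "\<mu> \<in> points (measures_icone S)" by (simp add: sets_\<mu>)
  have "cone_lub (measures_icone S) T \<mu>"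
    unfolding cone_lub_def
  proof (intro conjI pt allI ballI impI)
    show "cone_le (measures_icone S) (T n) \<mu>" for n
      using cone_le_measures[OF T(2) pt] em SUP_upper[OF UNIV_I, of "\<lambda>n. emeasure (T n) _" n] by simp
    show "cone_le (measures_icone S) \<mu> \<nu>"
      if \<nu>: "\<nu> \<in> points (measures_icone S)" "\<forall>n. cone_le (measures_icone S) (T n) \<nu>" for \<nu>
      using cone_le_measures[OF T(2) \<nu>(1)] cone_le_measures[OF pt \<nu>(1)] \<nu>(2)
      by (simp add: em SUP_le_iff)
  qed
  then show ?thesis using em by blast
qed

text \<open>The cone order is antisymmetric: if \<open>y = x + z\<close> and
  \<open>x = y + w\<close>, cancellation gives \<open>z + w = 0\<close> and positivity gives
  \<open>z = 0\<close>.\<close>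

lemma cone_lub_unique:
  assumes "precone P" "cone_lub P S x" "cone_lub P S y"
  shows "x = y"
proof -
  interpret precone P by fact
  have "cone_le P x y" "cone_le P y x" using assms(2,3) by (auto simp: cone_lub_def)
  then obtain z w where *: "x \<in> points P" "y \<in> points P" "z \<in> points P" "w \<in> points P"
    "y = cplus P x z" "x = cplus P y w"
    unfolding cone_le_def by blast
  have "cplus P (cplus P z w) x = cplus P (cplus P x z) w"
    by (subst plus_commute) (simp_all add: *(1-4) plus_closed plus_assoc)
  also have "\<dots> = cplus P x (czero P)"
    by (simp only: *(5)[symmetric] *(6)[symmetric] plus_zero[OF *(1)])
  also have "\<dots> = cplus P (czero P) x" by (rule plus_commute) (simp_all add: *(1) zero_closed)
  finally have "cplus P z w = czero P"
    by (rule cancel[rotated -1]) (simp_all add: *(1,3,4) plus_closed zero_closed)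
  then have "z = czero P" using *(3,4) by (rule positive[rotated -1])
  then show ?thesis using *(1,5) by (simp add: plus_zero)
qed

lemma cone_measures: "cone (measures_icone S)"
proof -
  interpret precone "measures_icone S" by (rule precone_measures)
  show ?thesis
  proof (unfold_locales, goal_cases)
    case (1 x) then show ?case by simp
  next
    case (2 r x) then show ?case by (simp add: measure_def enn2real_mult)
  next
    case (3 x)
    then have "space x = space S" using sets_eq_imp_space_eq[of x S] by simp
    with 3 have "emeasure x (space x) = 0"
      by (simp add: finite_measure.emeasure_eq_measure)
    then have "emeasure x A = 0" for A
      using emeasure_mono[of A "space x" x] emeasure_notin_sets[of A x] sets.sets_into_space[of A x]
      by (cases "A \<in> sets x") auto
    then show ?case using 3 by (intro measure_eqI) auto
  next
    case (4 x y) then show ?case by (simp add: measure_add_measure)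
  next
    case (5 x y) then show ?case by (simp add: measure_add_measure)
  next
    case (6 T)
    have T: "finite_measure (T n)" for n using 6 by (auto simp: cone_chain_def)
    have "emeasure (T n) (space S) \<le> 1" for n
      using 6(2)[of n] finite_measure.emeasure_eq_measure[OF T[of n]] by (simp add: ennreal_le_1)
    with measures_chain_lub[OF 6(1) this] obtain \<mu> where \<mu>: "cone_lub (measures_icone S) T \<mu>"
      and "emeasure \<mu> (space S) \<le> 1"
      by (auto simp: SUP_le_iff)
    then have "cnorm (measures_icone S) \<mu> \<le> 1"
      by (simp add: measure_def enn2real_leI)
    with \<mu> show ?case by blast
  qed
qed

text \<open>An abstract least upper bound bounds the masses of its chain, so the setwise supremum
  exists as a finite measure and coincides with it by uniqueness.\<close>

lemma measures_lub_emeasure: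
  assumes chain: "cone_chain (measures_icone S) T" and lub: "cone_lub (measures_icone S) T \<mu>"
  shows "emeasure \<mu> A = (SUP n. emeasure (T n) A)"
proof -
  have pts: "\<mu> \<in> points (measures_icone S)" "T n \<in> points (measures_icone S)" for n
    using chain lub by (auto simp: cone_chain_def cone_lub_def)
  have "cone_le (measures_icone S) (T n) \<mu>" for n
    using lub by (simp add: cone_lub_def)
  then have "emeasure (T n) (space S) \<le> emeasure \<mu> (space S)" for n
    using cone_le_measures[OF pts(2,1)] by blast
  moreover have "emeasure \<mu> (space S) < \<top>"
    using pts(1) by (simp add: finite_measure.emeasure_finite less_top[symmetric])
  ultimately obtain \<nu> where "cone_lub (measures_icone S) T \<nu>" "\<And>A. emeasure \<nu> A = (SUP n. emeasure (T n) A)"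
    using measures_chain_lub[OF chain, of "emeasure \<mu> (space S)"] by blast
  moreover from this have "\<mu> = \<nu>"
    using cone_lub_unique[OF precone_measures lub] by blast
  ultimately show ?thesis by simp
qed

abbreviation measure_functionals :: "'x measure \<Rightarrow> ('x measure \<Rightarrow> real) set" where
  "measure_functionals S \<equiv> {\<lambda>\<mu>. measure \<mu> U |U. U \<in> sets S}"

lemma additive_cone_measures: "additive_cone (measures_icone S) (measure_functionals S)"
proof -
  interpret cone "measures_icone S" by (rule cone_measures)
  show ?thesis
  proof (unfold_locales, goal_cases)
    case (1 x y) then show ?case by (simp add: measure_add_measure)
  next
    case (2 T \<mu>)
    let ?e = "\<lambda>n. emeasure (T n) (space S)"
    have T: "T n \<in> points (measures_icone S)" "\<mu> \<in> points (measures_icone S)" for n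
      using 2 by (auto simp: cone_chain_def cone_lub_def)
    have "incseq ?e"
    proof (rule incseq_SucI)
      fix n
      have "cone_le (measures_icone S) (T n) (T (Suc n))" using 2(1) by (simp add: cone_chain_def)
      then show "?e n \<le> ?e (Suc n)" using cone_le_measures[OF T(1) T(1)] by blast
    qed
    then have "?e \<longlonglongrightarrow> emeasure \<mu> (space S)"
      unfolding measures_lub_emeasure[OF 2] by (rule LIMSEQ_SUP)
    moreover have "emeasure \<mu> (space S) < \<top>"
      using T(2) by (simp add: finite_measure.emeasure_finite less_top[symmetric])
    ultimately have "(\<lambda>n. enn2real (?e n)) \<longlonglongrightarrow> enn2real (emeasure \<mu> (space S))"
      by (intro tendsto_enn2real) simp_all
    then show ?case by (simp add: measure_def)
  next
    case 3 show ?case by (auto simp: measures_icone_def)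
  next
    case (4 l) then show ?case by auto
  next
    case (5 l x y) then show ?case by (auto simp: measure_add_measure)
  next
    case (6 l r x) then show ?case by (auto simp: measure_def enn2real_mult)
  next
    case (7 l x) then show ?case by auto
  next
    case (8 l x)
    then show ?case
      using finite_measure.finite_measure_mono[of x _ "space S"] sets.sets_into_space[of _ S] by auto
  next
    case (9 x y)
    show ?case
    proof (rule measure_eqI)
      fix A assume "A \<in> sets x"
      with 9(1) have "(\<lambda>\<mu>. measure \<mu> A) \<in> measure_functionals S" by auto
      from 9(3)[OF this] show "emeasure x A = emeasure y A"
        using 9(1,2) by (simp add: finite_measure.emeasure_eq_measure)
    qed (use 9 in simp)
  next
    case 10 show ?case by (rule bexI[of _ "\<lambda>\<mu>. measure \<mu> (space S)"]) auto
  qed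
qed

section \<open>Mixtures of finite kernels\<close>

definition mixture :: "'x measure \<Rightarrow> 'y measure \<Rightarrow> ('y \<Rightarrow> 'x measure) \<Rightarrow> 'x measure" where
  "mixture S M \<kappa> = measure_of (space S) (sets S) (\<lambda>A. \<integral>\<^sup>+r. emeasure (\<kappa> r) A \<partial>M)"

lemma sets_mixture [simp]: "sets (mixture S M \<kappa>) = sets S"
  by (simp add: mixture_def)

lemma space_mixture [simp]: "space (mixture S M \<kappa>) = space S"
  by (simp add: mixture_def space_measure_of_conv)

locale finite_kernel =
  fixes S :: "'x measure" and M :: "'y measure" and \<kappa> :: "'y \<Rightarrow> 'x measure"
  assumes sets_kernel: "r \<in> space M \<Longrightarrow> sets (\<kappa> r) = sets S"
    and finite_kernel: "r \<in> space M \<Longrightarrow> finite_measure (\<kappa> r)"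
    and kernel_measurable: "A \<in> sets S \<Longrightarrow> (\<lambda>r. measure (\<kappa> r) A) \<in> borel_measurable M"
begin

lemma emeasure_kernel_measurable: "A \<in> sets S \<Longrightarrow> (\<lambda>r. emeasure (\<kappa> r) A) \<in> borel_measurable M"
  using measurable_compose[OF kernel_measurable measurable_ennreal]
  by (subst measurable_cong[where g="\<lambda>r. ennreal (measure (\<kappa> r) A)"])
    (auto simp: finite_kernel finite_measure.emeasure_eq_measure)

lemma emeasure_mixture:
  assumes "A \<in> sets S"
  shows "emeasure (mixture S M \<kappa>) A = (\<integral>\<^sup>+r. emeasure (\<kappa> r) A \<partial>M)"
  unfolding mixture_def
proof (rule emeasure_measure_of_sigma[OF _ _ _ assms])
  show "countably_additive (sets S) (\<lambda>A. \<integral>\<^sup>+r. emeasure (\<kappa> r) A \<partial>M)"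
  proof (rule countably_additiveI)
    fix F :: "nat \<Rightarrow> _" assume F: "range F \<subseteq> sets S" "disjoint_family F"
    then have "(\<Sum>i. \<integral>\<^sup>+r. emeasure (\<kappa> r) (F i) \<partial>M) = (\<integral>\<^sup>+r. (\<Sum>i. emeasure (\<kappa> r) (F i)) \<partial>M)"
      by (intro nn_integral_suminf[symmetric] emeasure_kernel_measurable) auto
    also have "\<dots> = (\<integral>\<^sup>+r. emeasure (\<kappa> r) (\<Union>i. F i) \<partial>M)"
      using F by (intro nn_integral_cong suminf_emeasure) (auto simp: sets_kernel)
    finally show "(\<Sum>i. \<integral>\<^sup>+r. emeasure (\<kappa> r) (F i) \<partial>M) = (\<integral>\<^sup>+r. emeasure (\<kappa> r) (\<Union>i. F i) \<partial>M)" .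
  qed
qed (auto simp: positive_def sets.sigma_algebra_axioms)

text \<open>Measurability of the inner integral and the iterated-integral formula are proved in one
  induction: the steps for sums and monotone limits of the formula need the measurability of the
  inner integrals of the pieces.\<close>

lemma nn_integral_kernel:
  assumes "h \<in> borel_measurable S"
  shows "(\<lambda>r. \<integral>\<^sup>+x. h x \<partial>\<kappa> r) \<in> borel_measurable M \<and>
    (\<integral>\<^sup>+x. h x \<partial>mixture S M \<kappa>) = (\<integral>\<^sup>+r. (\<integral>\<^sup>+x. h x \<partial>\<kappa> r) \<partial>M)"
    (is "?M h \<and> ?E h")
  using assms
proof (induction rule: borel_measurable_induct)
  case (cong f g)
  have "(\<integral>\<^sup>+x. f x \<partial>\<kappa> r) = (\<integral>\<^sup>+x. g x \<partial>\<kappa> r)" if "r \<in> space M" for r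
    using cong(3) sets_eq_imp_space_eq[OF sets_kernel[OF that]] by (intro nn_integral_cong) auto
  moreover have "(\<integral>\<^sup>+x. f x \<partial>mixture S M \<kappa>) = (\<integral>\<^sup>+x. g x \<partial>mixture S M \<kappa>)"
    using cong(3) by (intro nn_integral_cong) auto
  ultimately show ?case
    using cong(4) by (simp cong: measurable_cong nn_integral_cong_simp)
next
  case (set A)
  have "(\<integral>\<^sup>+x. indicator A x \<partial>\<kappa> r) = emeasure (\<kappa> r) A" if "r \<in> space M" for r
    using set sets_kernel[OF that] by simp
  then show ?case
    using set emeasure_kernel_measurable[OF set] emeasure_mixture[OF set]
    by (simp cong: measurable_cong nn_integral_cong_simp)
next
  case (mult u c)
  have "(\<integral>\<^sup>+x. c * u x \<partial>\<kappa> r) = c * (\<integral>\<^sup>+x. u x \<partial>\<kappa> r)" if "r \<in> space M" for r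
    using mult(2) sets_kernel[OF that] by (intro nn_integral_cmult) (simp cong: measurable_cong_sets)
  moreover have "(\<integral>\<^sup>+x. c * u x \<partial>mixture S M \<kappa>) = c * (\<integral>\<^sup>+x. u x \<partial>mixture S M \<kappa>)"
    using mult(2) by (intro nn_integral_cmult) (simp cong: measurable_cong_sets)
  ultimately show ?case
    using mult(4)
    by (simp add: nn_integral_cmult borel_measurable_times_ennreal cong: measurable_cong nn_integral_cong_simp)
next
  case (add u v)
  have "(\<integral>\<^sup>+x. v x + u x \<partial>\<kappa> r) = (\<integral>\<^sup>+x. v x \<partial>\<kappa> r) + (\<integral>\<^sup>+x. u x \<partial>\<kappa> r)" if "r \<in> space M" for r
    using add(1,3) sets_kernel[OF that] by (intro nn_integral_add) (simp_all cong: measurable_cong_sets)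
  moreover have "(\<integral>\<^sup>+x. v x + u x \<partial>mixture S M \<kappa>) = (\<integral>\<^sup>+x. v x \<partial>mixture S M \<kappa>) + (\<integral>\<^sup>+x. u x \<partial>mixture S M \<kappa>)"
    using add(1,3) by (intro nn_integral_add) (simp_all cong: measurable_cong_sets)
  ultimately show ?case
    using add by (simp add: nn_integral_add borel_measurable_add cong: measurable_cong nn_integral_cong_simp)
next
  case (seq U)
  have "(\<integral>\<^sup>+x. (SUP i. U i) x \<partial>\<kappa> r) = (SUP i. \<integral>\<^sup>+x. U i x \<partial>\<kappa> r)" if "r \<in> space M" for r
    using seq(1,3) sets_kernel[OF that]
    unfolding SUP_apply by (intro nn_integral_monotone_convergence_SUP) (simp_all cong: measurable_cong_sets)
  moreover have "(\<integral>\<^sup>+x. (SUP i. U i) x \<partial>mixture S M \<kappa>) = (SUP i. \<integral>\<^sup>+x. U i x \<partial>mixture S M \<kappa>)"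
    using seq(1,3)
    unfolding SUP_apply by (intro nn_integral_monotone_convergence_SUP) (simp_all cong: measurable_cong_sets)
  moreover have "(\<integral>\<^sup>+r. (SUP i. \<integral>\<^sup>+x. U i x \<partial>\<kappa> r) \<partial>M) = (SUP i. \<integral>\<^sup>+r. (\<integral>\<^sup>+x. U i x \<partial>\<kappa> r) \<partial>M)"
    using seq(3,5)
    by (intro nn_integral_monotone_convergence_SUP) (auto simp: incseq_def le_fun_def intro!: nn_integral_mono)
  ultimately show ?case
    using seq(5) by (simp add: borel_measurable_SUP cong: measurable_cong nn_integral_cong_simp)
qed

lemma finite_measure_mixture:
  assumes M: "finite_measure M" and B: "\<And>r. r \<in> space M \<Longrightarrow> measure (\<kappa> r) (space S) \<le> B"
  shows "finite_measure (mixture S M \<kappa>)"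
proof (rule finite_measureI)
  have "(\<integral>\<^sup>+r. emeasure (\<kappa> r) (space S) \<partial>M) \<le> (\<integral>\<^sup>+r. ennreal B \<partial>M)"
    using B finite_kernel by (intro nn_integral_mono) (simp add: finite_measure.emeasure_eq_measure ennreal_leI)
  also have "\<dots> < \<top>"
    using finite_measure.emeasure_finite[OF M] by (simp add: ennreal_mult_less_top less_top)
  finally show "emeasure (mixture S M \<kappa>) (space (mixture S M \<kappa>)) \<noteq> \<infinity>"
    by (simp add: emeasure_mixture)
qed

end

text \<open>A sum of two measures is a mixture over a two-point space.\<close>

lemma nn_integral_add_measure:
  assumes "\<mu> \<in> points (measures_icone S)" "\<nu> \<in> points (measures_icone S)" "h \<in> borel_measurable S"
  shows "(\<integral>\<^sup>+x. h x \<partial>add_measure \<mu> \<nu>) = (\<integral>\<^sup>+x. h x \<partial>\<mu>) + (\<integral>\<^sup>+x. h x \<partial>\<nu>)"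
proof -
  define \<kappa> where "\<kappa> b = (if b then \<mu> else \<nu>)" for b
  let ?B = "count_space {True, False}"
  have two: "(\<integral>\<^sup>+b. f b \<partial>?B) = f True + f False" for f :: "bool \<Rightarrow> ennreal"
    by (simp add: nn_integral_count_space_finite)
  interpret finite_kernel S ?B \<kappa>
    using assms(1,2) by (intro finite_kernel.intro) (simp_all add: \<kappa>_def)
  have "add_measure \<mu> \<nu> = mixture S ?B \<kappa>"
  proof (rule measure_eqI)
    fix A assume "A \<in> sets (add_measure \<mu> \<nu>)"
    then show "emeasure (add_measure \<mu> \<nu>) A = emeasure (mixture S ?B \<kappa>) A"
      using assms by (simp add: emeasure_mixture emeasure_add_measure two \<kappa>_def)
  qed (use assms in simp)
  then show ?thesis
    using nn_integral_kernel[OF assms(3)] by (simp add: two \<kappa>_def)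
qed

lemma measures_path_iff:
  "measurable_path M (measures_icone S) \<kappa> \<longleftrightarrow>
    finite_kernel S M \<kappa> \<and> (\<exists>B. \<forall>r\<in>space M. measure (\<kappa> r) (space S) \<le> B)"
  unfolding additive_cone.measurable_path_iff[OF additive_cone_measures] finite_kernel_def Pi_iff
  by auto

lemma measures_has_cone_integral_mixture:
  assumes M: "finite_measure M" and path: "measurable_path M (measures_icone S) \<kappa>"
  shows "has_cone_integral (measures_icone S) M \<kappa> (mixture S M \<kappa>)"
proof -
  obtain B where "finite_kernel S M \<kappa>" and B: "\<And>r. r \<in> space M \<Longrightarrow> measure (\<kappa> r) (space S) \<le> B"
    using path by (auto simp: measures_path_iff)
  then interpret finite_kernel S M \<kappa> by simp
  interpret mix: finite_measure "mixture S M \<kappa>" by (rule finite_measure_mixture[OF M B])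
  have "ennreal (measure (mixture S M \<kappa>) U) = (\<integral>\<^sup>+r. ennreal (measure (\<kappa> r) U) \<partial>M)"
    if "U \<in> sets S" for U
    using that emeasure_mixture[OF that] finite_kernel
    by (simp add: mix.emeasure_eq_measure finite_measure.emeasure_eq_measure cong: nn_integral_cong_simp)
  then show ?thesis
    unfolding has_cone_integral_def additive_cone.point_tests_eq[OF additive_cone_measures]
    using mix.finite_measure_axioms by auto
qed

lemma integrable_cone_measures: "integrable_cone (measures_icone S)"
  unfolding integrable_cone_def integrable_cone_axioms_def
  using additive_cone.measurable_cone[OF additive_cone_measures] measures_has_cone_integral_mixture
  by blast

section \<open>Moments of measures on the Giry monad\<close>

lemma joint_measurable_count:
  fixes f :: "'i \<Rightarrow> 'x \<Rightarrow> ennreal"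
  assumes "countable I" "\<And>i. i \<in> I \<Longrightarrow> f i \<in> borel_measurable M"
  shows "(\<lambda>(x, i). f i x) \<in> borel_measurable (M \<Otimes>\<^sub>M count_space I)"
proof -
  have "(\<lambda>(i, x). f i x) \<in> borel_measurable (count_space I \<Otimes>\<^sub>M M)"
    using assms by (intro measurable_pair_measure_countable1) auto
  then show ?thesis
    by (subst measurable_pair_swap_iff) (simp add: split_beta')
qed

lemma measurable_nn_integral_count:
  fixes f :: "'i \<Rightarrow> 'x \<Rightarrow> ennreal"
  assumes "countable I" "\<And>i. i \<in> I \<Longrightarrow> f i \<in> borel_measurable M"
  shows "(\<lambda>x. \<integral>\<^sup>+i. f i x \<partial>count_space I) \<in> borel_measurable M"
  by (rule sigma_finite_measure.borel_measurable_nn_integral[OF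
        sigma_finite_measure_count_space_countable[OF assms(1)] joint_measurable_count[OF assms]])

lemma nn_integral_count_swap:
  fixes f :: "'i \<Rightarrow> 'x \<Rightarrow> ennreal"
  assumes "countable I" "\<And>i. i \<in> I \<Longrightarrow> f i \<in> borel_measurable M" "sigma_finite_measure M"
  shows "(\<integral>\<^sup>+x. (\<integral>\<^sup>+i. f i x \<partial>count_space I) \<partial>M) = (\<integral>\<^sup>+i. (\<integral>\<^sup>+x. f i x \<partial>M) \<partial>count_space I)"
proof -
  interpret pair_sigma_finite M "count_space I"
    by (intro pair_sigma_finite.intro assms(3) sigma_finite_measure_count_space_countable[OF assms(1)])
  show ?thesis using Fubini'[OF joint_measurable_count[OF assms(1,2)]] by simp
qed

text \<open>Pairings are defined as unordered sums. As integrals against counting measure they can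
  be exchanged with other integrals by Fubini.\<close>

lemma infsum_eq_nn_integral:
  fixes f :: "'i \<Rightarrow> ennreal"
  assumes "countable I"
  shows "(\<Sum>\<^sub>\<infinity>i\<in>I. f i) = (\<integral>\<^sup>+i. f i \<partial>count_space I)"
proof (cases "finite I")
  case True
  then show ?thesis by (simp add: nn_integral_count_space_finite)
next
  case False
  let ?e = "from_nat_into I"
  have bij: "bij_betw ?e UNIV I" by (rule bij_betw_from_nat_into[OF assms False])
  have "(\<Sum>\<^sub>\<infinity>i\<in>I. f i) = (\<Sum>\<^sub>\<infinity>n. f (?e n))"
    by (rule infsum_reindex_bij_betw[OF bij, symmetric])
  also have "\<dots> = (\<Sum>n. f (?e n))"
    by (intro sums_unique has_sum_imp_sums has_sum_infsum nonneg_summable_on_complete) simp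
  also have "\<dots> = (\<integral>\<^sup>+n. f (?e n) \<partial>count_space UNIV)" by (rule nn_integral_count_space_nat[symmetric])
  also have "\<dots> = (\<integral>\<^sup>+i. f i \<partial>count_space I)" by (rule nn_integral_bij_count_space[OF bij])
  finally show ?thesis .
qed

lemma promotion_empty [simp]: "promotion z {#} = 1"
  by (simp add: promotion_def)

lemma promotion_add_mset [simp]: "promotion z (add_mset a m) = z a * promotion z m"
  by (simp add: promotion_def)

lemma promotion_bounds:
  assumes "\<And>a. 0 \<le> z a" "\<And>a. z a \<le> 1"
  shows "0 \<le> promotion z m \<and> promotion z m \<le> 1"
  using assms by (induction m) (auto intro: mult_le_one)

text \<open>The mixed moments of the coordinates of a random distribution, or equivalently the
  coefficients of the mixture of promotions with law \<open>\<mu>\<close>. As a map in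
  \<open>\<mu>\<close> this is the isomorphism.\<close>

definition moments :: "'a measure measure \<Rightarrow> 'a multiset \<Rightarrow> real" where
  "moments \<mu> m = (\<integral>r. promotion (density_vector r) m \<partial>\<mu>)"

locale countable_discrete =
  fixes X :: "'a set"
  assumes countable: "countable X"
begin

abbreviation G :: "'a measure measure" where "G \<equiv> prob_algebra (count_space X)"

lemma measurable_density_vector [measurable]: "(\<lambda>r. density_vector r a) \<in> borel_measurable G"
proof (cases "a \<in> X")
  case True
  then show ?thesis by (simp add: density_vector_def)
next
  case False
  then have "density_vector r a = 0" if "r \<in> space G" for r
    using that by (simp add: density_vector_def space_prob_algebra measure_notin_sets)
  then show ?thesis by (simp cong: measurable_cong)
qed

lemma measurable_promotion [measurable]:
  "(\<lambda>r. promotion (density_vector r) m) \<in> borel_measurable G"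
  by (induction m) simp_all

lemma density_vector_bounds:
  assumes "r \<in> space G"
  shows "0 \<le> density_vector r a" "density_vector r a \<le> 1"
proof -
  interpret prob_space r using assms by (simp add: space_prob_algebra)
  show "0 \<le> density_vector r a" "density_vector r a \<le> 1" by (simp_all add: density_vector_def)
qed

lemma promotion_density_bounds:
  assumes "r \<in> space G"
  shows "0 \<le> promotion (density_vector r) m" "promotion (density_vector r) m \<le> 1"
  using promotion_bounds[of "density_vector r"] density_vector_bounds[OF assms] by auto

lemma emeasure_eq_density:
  assumes "r \<in> space G" "A \<subseteq> X"
  shows "emeasure r A = (\<integral>\<^sup>+a. ennreal (density_vector r a) \<partial>count_space A)"
proof -
  interpret prob_space r using assms by (simp add: space_prob_algebra)
  have "emeasure r A = (\<integral>\<^sup>+a. emeasure r {a} \<partial>count_space A)"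
    using assms countable_subset[OF assms(2) countable]
    by (intro emeasure_countable_singleton) (auto simp: space_prob_algebra)
  then show ?thesis by (simp add: density_vector_def emeasure_eq_measure)
qed

text \<open>The mass of a subset of \<open>X\<close> is a countable sum of densities, so
  measurability into \<open>G\<close> can be checked coordinatewise.\<close>

lemma measurable_into_G:
  assumes sp: "\<And>w. w \<in> space M \<Longrightarrow> h w \<in> space G"
    and dv: "\<And>a. a \<in> X \<Longrightarrow> (\<lambda>w. density_vector (h w) a) \<in> borel_measurable M"
  shows "h \<in> measurable M G"
proof (intro measurable_prob_algebraI measurable_subprob_algebra)
  fix w assume "w \<in> space M"
  from sp[OF this] show "prob_space (h w)" "subprob_space (h w)" "sets (h w) = sets (count_space X)"
    by (auto simp: space_prob_algebra intro: prob_space_imp_subprob_space)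
next
  fix A assume "A \<in> sets (count_space X)"
  then have A: "A \<subseteq> X" "countable A" using countable countable_subset by auto
  have "(\<lambda>w. \<integral>\<^sup>+a. ennreal (density_vector (h w) a) \<partial>count_space A) \<in> borel_measurable M"
    using A dv by (intro measurable_nn_integral_count) auto
  then show "(\<lambda>w. emeasure (h w) A) \<in> borel_measurable M"
    using sp A by (simp add: emeasure_eq_density cong: measurable_cong)
qed

text \<open>Strict lower bounds on finitely many coordinates: an intersection-stable generator whose
  indicators are products of one-coordinate indicators.\<close>

definition density_boxes :: "'a measure set set" where
  "density_boxes = {{r \<in> space G. \<forall>a\<in>A. t a < density_vector r a} |A (t :: 'a \<Rightarrow> real). finite A \<and> A \<subseteq> X}"

lemma Int_stable_density_boxes: "Int_stable density_boxes"
proof (rule Int_stableI)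
  fix U V assume "U \<in> density_boxes" "V \<in> density_boxes"
  then obtain A B and t s :: "'a \<Rightarrow> real" where *: "finite A" "A \<subseteq> X" "finite B" "B \<subseteq> X"
    "U = {r \<in> space G. \<forall>a\<in>A. t a < density_vector r a}"
    "V = {r \<in> space G. \<forall>a\<in>B. s a < density_vector r a}"
    by (auto simp: density_boxes_def)
  \<comment> \<open>The default -1 lies strictly below every density, so a coordinate that one of
    the two boxes leaves free gets no constraint from it.\<close>
  define u where "u a = max (if a \<in> A then t a else -1) (if a \<in> B then s a else -1)" for a
  have neg: "-1 < density_vector r a" if "r \<in> space G" for r a
    using density_vector_bounds(1)[OF that, of a] by linarith
  have "U \<inter> V = {r \<in> space G. \<forall>a\<in>A \<union> B. u a < density_vector r a}"
    unfolding *(5,6) u_def using neg by (auto split: if_splits)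
  moreover have "finite (A \<union> B)" "A \<union> B \<subseteq> X" using * by auto
  ultimately show "U \<inter> V \<in> density_boxes" unfolding density_boxes_def by blast
qed

lemma density_boxes_subset: "density_boxes \<subseteq> Pow (space G)"
  by (auto simp: density_boxes_def)

lemma density_boxes_measurable: "density_boxes \<subseteq> sets G"
proof
  fix U assume "U \<in> density_boxes"
  then obtain A and t :: "'a \<Rightarrow> real" where "finite A" "U = {r \<in> space G. \<forall>a\<in>A. t a < density_vector r a}"
    by (auto simp: density_boxes_def)
  then show "U \<in> sets G" by simp
qed

text \<open>For the nontrivial inclusion, the identity is measurable from the \<sigma>-algebra of
  the boxes into \<open>G\<close>, since every density is measurable there.\<close>

lemma sets_G: "sets G = sigma_sets (space G) density_boxes"
proof (rule antisym)
  let ?S = "sigma (space G) density_boxes"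
  have spS: "space ?S = space G" by (simp add: space_measure_of_conv)
  have "(\<lambda>r. r) \<in> measurable ?S G"
  proof (rule measurable_into_G)
    fix a assume a: "a \<in> X"
    show "(\<lambda>r. density_vector r a) \<in> borel_measurable ?S"
      unfolding borel_measurable_iff_greater
    proof
      fix t
      have "{r \<in> space G. \<forall>b\<in>{a}. t < density_vector r b} \<in> density_boxes"
        unfolding density_boxes_def using a by (intro CollectI exI[of _ "{a}"] exI[of _ "\<lambda>_. t"]) auto
      then show "{r \<in> space ?S. t < density_vector r a} \<in> sets ?S"
        using density_boxes_subset by (simp add: spS)
    qed
  qed (simp add: spS)
  then have "A \<in> sets ?S" if "A \<in> sets G" for A
    using measurable_sets[of "\<lambda>r. r" ?S G A] that sets.sets_into_space[OF that] by (simp add: spS Int_absorb2)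
  then show "sets G \<subseteq> sigma_sets (space G) density_boxes"
    using density_boxes_subset by auto
  show "sigma_sets (space G) density_boxes \<subseteq> sets G"
    using density_boxes_measurable by (rule sets.sigma_sets_subset)
qed

end

section \<open>Measurability of a family of measures from that of its moments\<close>

locale moment_measurable = countable_discrete X for X :: "'a set" +
  fixes M :: "'y measure" and \<kappa> :: "'y \<Rightarrow> 'a measure measure"
  assumes sets_\<kappa>: "w \<in> space M \<Longrightarrow> sets (\<kappa> w) = sets G"
    and finite_\<kappa>: "w \<in> space M \<Longrightarrow> finite_measure (\<kappa> w)"
    and moments_measurable: "(\<lambda>w. moments (\<kappa> w) m) \<in> borel_measurable M"
begin

text \<open>Integrating against every monomial, and not only against 1, makes the class of good
  functions closed under multiplication by coordinates.\<close>

definition good :: "('a measure \<Rightarrow> real) \<Rightarrow> bool" where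
  "good f \<longleftrightarrow> f \<in> borel_measurable G \<and> (\<exists>B. \<forall>r\<in>space G. \<bar>f r\<bar> \<le> B) \<and>
     (\<forall>m. (\<lambda>w. \<integral>r. f r * promotion (density_vector r) m \<partial>\<kappa> w) \<in> borel_measurable M)"

lemma goodD:
  assumes "good f"
  shows "f \<in> borel_measurable G"
    and "(\<lambda>w. \<integral>r. f r * promotion (density_vector r) m \<partial>\<kappa> w) \<in> borel_measurable M"
  using assms by (simp_all add: good_def)

lemma space_\<kappa>: "w \<in> space M \<Longrightarrow> space (\<kappa> w) = space G"
  using sets_\<kappa> by (rule sets_eq_imp_space_eq)

lemma measurable_\<kappa>: "w \<in> space M \<Longrightarrow> measurable (\<kappa> w) N = measurable G N"
  using sets_\<kappa> by (simp cong: measurable_cong_sets)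

lemma integrable_good:
  assumes "good f" "w \<in> space M"
  shows "integrable (\<kappa> w) (\<lambda>r. f r * promotion (density_vector r) m)"
proof -
  interpret finite_measure "\<kappa> w" using assms finite_\<kappa> by simp
  obtain B where B: "\<And>r. r \<in> space G \<Longrightarrow> \<bar>f r\<bar> \<le> B" and f: "f \<in> borel_measurable G"
    using assms by (auto simp: good_def)
  have "\<bar>f r\<bar> * promotion (density_vector r) m \<le> B" if "r \<in> space G" for r
    using mult_mono[OF B[OF that] promotion_density_bounds(2)[OF that]] B[OF that]
      promotion_density_bounds(1)[OF that] by auto
  then show ?thesis
    using f promotion_density_bounds
    by (intro integrable_const_bound[where B=B]) (auto simp: abs_mult space_\<kappa> measurable_\<kappa> assms)
qed

lemma good_one: "good (\<lambda>_. 1)"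
  using moments_measurable by (auto simp: good_def moments_def intro: exI[of _ 1])

text \<open>The new factor is absorbed by the monomial: integrating against \<open>m\<close> becomes
  integrating \<open>f\<close> against \<open>add_mset a m\<close>.\<close>

lemma good_coordinate:
  assumes "good f"
  shows "good (\<lambda>r. f r * density_vector r a)"
  unfolding good_def
proof (intro conjI allI)
  obtain B where B: "\<And>r. r \<in> space G \<Longrightarrow> \<bar>f r\<bar> \<le> B"
    using assms by (auto simp: good_def)
  have "\<bar>f r * density_vector r a\<bar> \<le> B" if "r \<in> space G" for r
    using mult_mono[OF B[OF that] density_vector_bounds(2)[OF that]] B[OF that]
      density_vector_bounds(1)[OF that] by (auto simp: abs_mult)
  then show "\<exists>B. \<forall>r\<in>space G. \<bar>f r * density_vector r a\<bar> \<le> B" by blast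
  show "(\<lambda>w. \<integral>r. f r * density_vector r a * promotion (density_vector r) m \<partial>\<kappa> w) \<in> borel_measurable M" for m
    using assms[unfolded good_def, THEN conjunct2, THEN conjunct2, rule_format, of "add_mset a m"]
    by (simp add: mult.assoc)
  show "(\<lambda>r. f r * density_vector r a) \<in> borel_measurable G"
    using assms by (intro borel_measurable_times measurable_density_vector) (simp add: good_def)
qed

lemma good_add:
  assumes "good f" "good g"
  shows "good (\<lambda>r. f r + g r)"
  unfolding good_def
proof (intro conjI allI)
  obtain B where "\<And>r. r \<in> space G \<Longrightarrow> \<bar>f r\<bar> \<le> B" using assms(1) by (auto simp: good_def)
  moreover obtain C where "\<And>r. r \<in> space G \<Longrightarrow> \<bar>g r\<bar> \<le> C" using assms(2) by (auto simp: good_def)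
  ultimately show "\<exists>B. \<forall>r\<in>space G. \<bar>f r + g r\<bar> \<le> B"
    by (intro exI[of _ "B + C"]) (smt (verit))
  show "(\<lambda>w. \<integral>r. (f r + g r) * promotion (density_vector r) m \<partial>\<kappa> w) \<in> borel_measurable M" for m
    using integrable_good[OF assms(1)] integrable_good[OF assms(2)]
    by (simp add: distrib_right borel_measurable_add goodD(2)[OF assms(1)] goodD(2)[OF assms(2)]
        cong: measurable_cong)
qed (intro borel_measurable_add assms[THEN goodD(1)])

lemma good_scale:
  assumes "good f"
  shows "good (\<lambda>r. f r * c)"
  unfolding good_def
proof (intro conjI allI)
  obtain B where "\<And>r. r \<in> space G \<Longrightarrow> \<bar>f r\<bar> \<le> B" using assms by (auto simp: good_def)
  then show "\<exists>B. \<forall>r\<in>space G. \<bar>f r * c\<bar> \<le> B"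
    by (intro exI[of _ "B * \<bar>c\<bar>"]) (auto simp: abs_mult intro: mult_right_mono)
  have "(\<lambda>w. \<integral>r. c * (f r * promotion (density_vector r) m) \<partial>\<kappa> w) \<in> borel_measurable M" for m
    unfolding integral_mult_right_zero
    by (intro borel_measurable_times borel_measurable_const goodD(2)[OF assms])
  then show "(\<lambda>w. \<integral>r. f r * c * promotion (density_vector r) m \<partial>\<kappa> w) \<in> borel_measurable M" for m
    by (simp only: ac_simps)
qed (intro borel_measurable_times borel_measurable_const goodD(1)[OF assms])

text \<open>Dominated convergence holds under each finite measure \<open>\<kappa> w\<close>
  separately; the integrals are then a pointwise limit of measurable functions of
  \<open>w\<close>.\<close>

lemma good_limit:
  assumes g: "\<And>j. good (g j)" and B: "\<And>j r. r \<in> space G \<Longrightarrow> \<bar>g j r\<bar> \<le> B"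
    and lim: "\<And>r. r \<in> space G \<Longrightarrow> (\<lambda>j. g j r) \<longlonglongrightarrow> f r"
  shows "good f"
  unfolding good_def
proof (intro conjI allI)
  have [measurable]: "g j \<in> borel_measurable G" for j using g by (simp add: good_def)
  show f[measurable]: "f \<in> borel_measurable G"
    by (rule borel_measurable_LIMSEQ_real[OF lim]) simp_all
  have "\<bar>f r\<bar> \<le> B" if "r \<in> space G" for r
    by (rule LIMSEQ_le_const2[OF tendsto_rabs[OF lim[OF that]]]) (use B that in auto)
  then show "\<exists>B. \<forall>r\<in>space G. \<bar>f r\<bar> \<le> B" by blast
  fix m
  show "(\<lambda>w. \<integral>r. f r * promotion (density_vector r) m \<partial>\<kappa> w) \<in> borel_measurable M"
  proof (rule borel_measurable_LIMSEQ_real)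
    fix w assume w: "w \<in> space M"
    interpret finite_measure "\<kappa> w" using finite_\<kappa>[OF w] .
    show "(\<lambda>j. \<integral>r. g j r * promotion (density_vector r) m \<partial>\<kappa> w) \<longlonglongrightarrow>
        (\<integral>r. f r * promotion (density_vector r) m \<partial>\<kappa> w)"
    proof (rule integral_dominated_convergence[where w="\<lambda>_. B"])
      show "AE r in \<kappa> w. norm (g j r * promotion (density_vector r) m) \<le> B" for j
      proof (rule AE_I2)
        fix r assume "r \<in> space (\<kappa> w)"
        then have r: "r \<in> space G" by (simp add: space_\<kappa> w)
        show "norm (g j r * promotion (density_vector r) m) \<le> B"
          using mult_mono[OF B[OF r, of j] promotion_density_bounds(2)[OF r, of m]] B[OF r, of j]
            promotion_density_bounds(1)[OF r, of m] by (simp add: abs_mult)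
      qed
      show "AE r in \<kappa> w. (\<lambda>j. g j r * promotion (density_vector r) m) \<longlonglongrightarrow> f r * promotion (density_vector r) m"
        by (intro AE_I2 tendsto_mult_right lim) (simp add: space_\<kappa> w)
    qed (simp_all add: measurable_\<kappa> w)
  next
    show "(\<lambda>w. \<integral>r. g j r * promotion (density_vector r) m \<partial>\<kappa> w) \<in> borel_measurable M" for j
      using g by (simp add: good_def)
  qed
qed

lemma good_polynomial:
  assumes "good f"
  shows "good (\<lambda>r. f r * (\<Sum>i\<le>n. c i * density_vector r a ^ i))"
proof -
  have pow: "good (\<lambda>r. f r * density_vector r a ^ i)" for i
  proof (induction i)
    case (Suc i)
    from good_coordinate[OF this, of a] show ?case by (simp add: ac_simps)
  qed (use assms in simp)
  show ?thesis
  proof (induction n)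
    case 0
    from good_scale[OF pow, of 0 "c 0"] show ?case by simp
  next
    case (Suc n)
    from good_add[OF this good_scale[OF pow, of "Suc n" "c (Suc n)"]] show ?case
      by (simp add: distrib_left ac_simps)
  qed
qed

text \<open>Densities lie in the compact unit interval, so Weierstrass approximation gives uniformly
  close polynomials. The approximation errors are at most 1, which yields the common bound
  \<open>C + 1\<close>.\<close>

lemma good_continuous:
  assumes f: "good f" and h: "continuous_on {0..1} h"
  shows "good (\<lambda>r. f r * h (density_vector r a))"
proof -
  obtain B where B: "\<And>r. r \<in> space G \<Longrightarrow> \<bar>f r\<bar> \<le> B" using f by (auto simp: good_def)
  have "compact (h ` {0..1})" using h by (intro compact_continuous_image) auto
  then have "bounded (h ` {0..1})" by (rule compact_imp_bounded)
  then obtain C where "\<forall>y\<in>h ` {0..1}. norm y \<le> C" unfolding bounded_iff by blast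
  then have C: "\<And>x. x \<in> {0..1} \<Longrightarrow> \<bar>h x\<bar> \<le> C" by simp
  have "\<exists>p. real_polynomial_function p \<and> (\<forall>x\<in>{0..1}. \<bar>h x - p x\<bar> < 1 / Suc j)" for j
    using Stone_Weierstrass_real_polynomial_function[OF compact_Icc h, of "1 / Suc j"] by (metis of_nat_0_less_iff zero_less_Suc zero_less_divide_1_iff)
  then obtain p where poly: "\<And>j. real_polynomial_function (p j)"
    and close: "\<And>j x. x \<in> {0..1} \<Longrightarrow> \<bar>h x - p j x\<bar> < 1 / Suc j"
    by metis
  have unit: "density_vector r a \<in> {0..1}" if "r \<in> space G" for r
    using density_vector_bounds[OF that] by simp
  show ?thesis
  proof (rule good_limit)
    show "good (\<lambda>r. f r * p j (density_vector r a))" for j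
    proof -
      obtain c n where "p j = (\<lambda>x. \<Sum>i\<le>n. c i * x ^ i)"
        using real_polynomial_function_imp_sum[OF poly] by blast
      then show ?thesis using good_polynomial[OF f] by simp
    qed
    show "\<bar>f r * p j (density_vector r a)\<bar> \<le> B * (C + 1)" if "r \<in> space G" for j r
    proof -
      have "\<bar>p j (density_vector r a)\<bar> \<le> C + 1 / Suc j"
        using close[OF unit[OF that], of j] C[OF unit[OF that]] by linarith
      moreover have "1 / real (Suc j) \<le> 1" by simp
      ultimately have "\<bar>p j (density_vector r a)\<bar> \<le> C + 1" by linarith
      with B[OF that] show ?thesis unfolding abs_mult by (intro mult_mono) auto
    qed
    show "(\<lambda>j. f r * p j (density_vector r a)) \<longlonglongrightarrow> f r * h (density_vector r a)" if "r \<in> space G" for r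
    proof (intro tendsto_mult_left)
      show "(\<lambda>j. p j (density_vector r a)) \<longlonglongrightarrow> h (density_vector r a)"
        unfolding tendsto_iff dist_real_def
      proof (intro allI impI)
        fix e :: real assume "0 < e"
        then have "\<forall>\<^sub>F j in sequentially. 1 / real (Suc j) < e"
          using LIMSEQ_inverse_real_of_nat order_tendstoD(2) by (fastforce simp: inverse_eq_divide)
        then show "\<forall>\<^sub>F j in sequentially. \<bar>p j (density_vector r a) - h (density_vector r a)\<bar> < e"
          by eventually_elim (use close[OF unit[OF that]] in \<open>smt (verit)\<close>)
      qed
    qed
  qed
qed

lemma good_indicator:
  assumes f: "good f"
  shows "good (\<lambda>r. f r * indicator {t<..} (density_vector r a))"
proof -
  obtain B where B: "\<And>r. r \<in> space G \<Longrightarrow> \<bar>f r\<bar> \<le> B" using f by (auto simp: good_def)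
  \<comment> \<open>A ramp that is 0 up to \<open>t\<close> and, for positive \<open>j\<close>,
    reaches 1 at \<open>t + 1 / j\<close>. Since it vanishes at \<open>t\<close> itself, the
    pointwise limit is the indicator of the open half-line, matching the strict inequalities of the
    boxes.\<close>
  define h where "h j x = min 1 (max 0 (real j * (x - t)))" for j x
  have h01: "0 \<le> h j x" "h j x \<le> 1" for j x by (auto simp: h_def)
  show ?thesis
  proof (rule good_limit)
    show "good (\<lambda>r. f r * h j (density_vector r a))" for j
      using f unfolding h_def by (intro good_continuous continuous_intros)
    show "\<bar>f r * h j (density_vector r a)\<bar> \<le> B" if "r \<in> space G" for j r
      using mult_mono[OF B[OF that] h01(2), of j "density_vector r a"] B[OF that]
        h01(1)[of j "density_vector r a"] by (auto simp: abs_mult)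
    fix r
    let ?x = "density_vector r a"
    have "(\<lambda>j. h j ?x) \<longlonglongrightarrow> indicator {t<..} ?x"
    proof (cases "t < ?x")
      case True
      obtain N :: nat where N: "1 / (?x - t) \<le> real N" using real_arch_simple by blast
      have "h j ?x = 1" if "N \<le> j" for j
      proof -
        have "1 / (?x - t) \<le> real j" using N that by linarith
        then have "1 \<le> real j * (?x - t)" using True by (simp add: field_simps)
        then show ?thesis by (simp add: h_def)
      qed
      then have "\<forall>\<^sub>F j in sequentially. h j ?x = 1" by (auto simp: eventually_sequentially)
      then show ?thesis using True by (simp add: tendsto_eventually)
    next
      case False
      then have "h j ?x = 0" for j by (simp add: h_def mult_nonneg_nonpos)
      then show ?thesis using False by simp
    qed
    then show "(\<lambda>j. f r * h j ?x) \<longlonglongrightarrow> f r * indicator {t<..} ?x"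
      by (intro tendsto_mult_left)
  qed
qed

lemma good_box: "finite A \<Longrightarrow> good (\<lambda>r. \<Prod>a\<in>A. indicator {t a<..} (density_vector r a))"
proof (induction rule: finite_induct)
  case (insert b A)
  from good_indicator[OF insert(3), of "t b" b] show ?case
    using insert(1,2) by (simp add: mult.commute)
qed (simp add: good_one)

text \<open>An induction over the \<sigma>-algebra from its intersection-stable generator: on a box
  the measure is the integral of a good function against the empty monomial.\<close>

theorem finite_kernel_of_moments: "finite_kernel G M \<kappa>"
proof (rule finite_kernel.intro)
  fix U assume "U \<in> sets G"
  then have "U \<in> sigma_sets (space G) density_boxes" by (simp add: sets_G)
  with Int_stable_density_boxes density_boxes_subset
  show "(\<lambda>w. measure (\<kappa> w) U) \<in> borel_measurable M"
  proof (induction rule: sigma_sets_induct_disjoint)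
    case (basic U)
    then have U: "U \<in> sets G" using density_boxes_measurable by blast
    from basic obtain A and t :: "'a \<Rightarrow> real" where "finite A"
      and U_eq: "U = {r \<in> space G. \<forall>a\<in>A. t a < density_vector r a}"
      by (auto simp: density_boxes_def)
    have ind: "(\<Prod>a\<in>A. indicator {t a<..} (density_vector r a)) = (indicator U r :: real)" if "r \<in> space G" for r
      using that \<open>finite A\<close> by (auto simp: U_eq indicator_def prod_zero_iff)
    have "(\<integral>r. (\<Prod>a\<in>A. indicator {t a<..} (density_vector r a)) * promotion (density_vector r) {#} \<partial>\<kappa> w) =
        measure (\<kappa> w) U" if w: "w \<in> space M" for w
    proof -
      have "(\<integral>r. (\<Prod>a\<in>A. indicator {t a<..} (density_vector r a)) * promotion (density_vector r) {#} \<partial>\<kappa> w) =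
          (\<integral>r. indicator U r \<partial>\<kappa> w)"
        by (intro Bochner_Integration.integral_cong) (simp_all add: ind space_\<kappa> w)
      also have "\<dots> = measure (\<kappa> w) U"
        using U sets.sets_into_space[OF U] by (simp add: space_\<kappa> sets_\<kappa> w Int_absorb2)
      finally show ?thesis .
    qed
    moreover have "(\<lambda>w. \<integral>r. (\<Prod>a\<in>A. indicator {t a<..} (density_vector r a)) *
        promotion (density_vector r) {#} \<partial>\<kappa> w) \<in> borel_measurable M"
      using good_box[OF \<open>finite A\<close>] unfolding good_def by blast
    ultimately show ?case by (simp cong: measurable_cong)
  next
    case empty
    show ?case by simp
  next
    case (compl U)
    \<comment> \<open>The total mass varies with \<open>w\<close>, so complements need its
      measurability as well; it is the moment at the empty multiset.\<close>
    have "measure (\<kappa> w) (space G - U) = moments (\<kappa> w) {#} - measure (\<kappa> w) U" if w: "w \<in> space M" for w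
    proof -
      interpret finite_measure "\<kappa> w" by (rule finite_\<kappa>[OF w])
      show ?thesis
        using finite_measure_compl[of U] compl(1) by (simp add: sets_\<kappa> space_\<kappa> w sets_G moments_def)
    qed
    then show ?case
      using borel_measurable_diff[OF moments_measurable compl(2)] by (simp cong: measurable_cong)
  next
    case (union U)
    have U: "range U \<subseteq> sets G" using union(2) by (auto simp: sets_G)
    show ?case
    proof (rule borel_measurable_LIMSEQ_real)
      fix w assume w: "w \<in> space M"
      interpret finite_measure "\<kappa> w" by (rule finite_\<kappa>[OF w])
      have "(\<lambda>i. measure (\<kappa> w) (U i)) sums measure (\<kappa> w) (\<Union>i. U i)"
        using U union(1) by (intro finite_measure_UNION) (simp_all add: sets_\<kappa> w)
      then show "(\<lambda>n. \<Sum>i<n. measure (\<kappa> w) (U i)) \<longlonglongrightarrow> measure (\<kappa> w) (\<Union>i. U i)"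
        by (simp add: sums_def)
    qed (intro borel_measurable_sum union(3))
  qed
qed (simp_all add: sets_\<kappa> finite_\<kappa>)

end

context countable_discrete begin

text \<open>Apply the previous theorem to the family \<open>{\<mu>, \<nu>}\<close> over the trivial \<open>\<sigma>\<close>-algebra on two points,
  whose measurable functions are constant.\<close>

lemma moments_inject:
  assumes "sets \<mu> = sets G" "finite_measure \<mu>" "sets \<nu> = sets G" "finite_measure \<nu>"
    and eq: "moments \<mu> = moments \<nu>"
  shows "\<mu> = \<nu>"
proof -
  define \<kappa> where "\<kappa> b = (if b then \<mu> else \<nu>)" for b
  let ?T = "sigma (UNIV :: bool set) {}"
  have eq': "moments (\<kappa> b) = moments \<mu>" for b by (simp add: \<kappa>_def eq)
  interpret moment_measurable X ?T \<kappa>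
    by (intro moment_measurable.intro countable_discrete_axioms moment_measurable_axioms.intro)
      (simp_all only: eq' borel_measurable_const, simp_all add: \<kappa>_def assms)
  interpret finite_kernel G ?T \<kappa> by (rule finite_kernel_of_moments)
  show ?thesis
  proof (rule measure_eqI)
    fix U assume "U \<in> sets \<mu>"
    then have "(\<lambda>b. measure (\<kappa> b) U) \<in> borel_measurable ?T"
      using assms by (intro kernel_measurable) simp
    then have "(\<lambda>b. measure (\<kappa> b) U) -` {measure \<mu> U} \<inter> space ?T \<in> sets ?T"
      by (rule measurable_sets) simp
    then have "(\<lambda>b. measure (\<kappa> b) U) -` {measure \<mu> U} \<in> {{}, UNIV}"
      by (simp add: sigma_sets_empty_eq space_measure_of_conv)
    moreover have "True \<in> (\<lambda>b. measure (\<kappa> b) U) -` {measure \<mu> U}" by (simp add: \<kappa>_def)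
    ultimately have "False \<in> (\<lambda>b. measure (\<kappa> b) U) -` {measure \<mu> U}" by blast
    then show "emeasure \<mu> U = emeasure \<nu> U"
      using assms(2,4) by (simp add: \<kappa>_def finite_measure.emeasure_eq_measure)
  qed (use assms in simp)
qed

end

section \<open>Exchangeable sequences\<close>

text \<open>\<open>u m\<close> is the probability of one fixed word with content \<open>m\<close>,
  so it carries no multinomial factor. Exchangeability is built in because it depends on the
  multiset only, and \<open>u_consistent\<close> is the compatibility under dropping a
  letter.\<close>

locale exchangeable_moments = countable_discrete X for X :: "'a set" +
  fixes u :: "'a multiset \<Rightarrow> real"
  assumes u_nonneg: "0 \<le> u m"
    and u_empty: "u {#} = 1"
    and u_consistent: "set_mset m \<subseteq> X \<Longrightarrow> (\<integral>\<^sup>+a. ennreal (u (add_mset a m)) \<partial>count_space X) = ennreal (u m)"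
begin

lemma u_add_le:
  assumes "set_mset m \<subseteq> X" "a \<in> X"
  shows "u (add_mset a m) \<le> u m"
proof -
  have "ennreal (u (add_mset a m)) \<le> ennreal (u m)"
    unfolding u_consistent[OF assms(1), symmetric]
    using nn_integral_ge_point[OF assms(2), of "\<lambda>a. ennreal (u (add_mset a m))"] by simp
  then show ?thesis using u_nonneg by (simp add: ennreal_le_iff)
qed

lemma X_nonempty: "X \<noteq> {}"
  using u_consistent[of "{#}"] u_empty by (auto simp: nn_integral_empty)

definition bag :: "(nat \<Rightarrow> 'a) \<Rightarrow> nat set \<Rightarrow> 'a multiset" where
  "bag \<omega> J = image_mset \<omega> (mset_set J)"

lemma bag_cong: "(\<And>i. i \<in> J \<Longrightarrow> \<omega> i = \<omega>' i) \<Longrightarrow> bag \<omega> J = bag \<omega>' J"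
  unfolding bag_def by (cases "finite J") (auto intro: image_mset_cong)

lemma set_bag: "finite J \<Longrightarrow> set_mset (bag \<omega> J) = \<omega> ` J"
  by (simp add: bag_def)

lemma bag_insert: "finite J \<Longrightarrow> i \<notin> J \<Longrightarrow> bag \<omega> (insert i J) = add_mset (\<omega> i) (bag \<omega> J)"
  by (simp add: bag_def)

text \<open>Where a prefix has weight 0 the quotient is junk, and the choice of the next
  law is irrelevant.\<close>

definition next_law :: "nat \<Rightarrow> (nat \<Rightarrow> 'a) \<Rightarrow> 'a measure" where
  "next_law n \<omega> = (let m = bag \<omega> {0..<n} in
     if u m = 0 then return (count_space X) (SOME a. a \<in> X)
     else density (count_space X) (\<lambda>a. ennreal (u (add_mset a m) / u m)))"

lemma next_law_prob:
  assumes "\<omega> \<in> {0..<n} \<rightarrow> X"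
  shows "prob_space (next_law n \<omega>)" "sets (next_law n \<omega>) = sets (count_space X)"
proof -
  let ?m = "bag \<omega> {0..<n}"
  have m: "set_mset ?m \<subseteq> X" using assms by (auto simp: set_bag)
  show "sets (next_law n \<omega>) = sets (count_space X)" by (simp add: next_law_def Let_def)
  show "prob_space (next_law n \<omega>)"
  proof (cases "u ?m = 0")
    case True
    have "(SOME a. a \<in> X) \<in> X" using X_nonempty by (simp add: some_in_eq)
    with True show ?thesis by (auto simp: next_law_def Let_def intro: prob_space_return)
  next
    case False
    have "(\<integral>\<^sup>+a. ennreal (u (add_mset a ?m) / u ?m) \<partial>count_space X) =
        (\<integral>\<^sup>+a. ennreal (u (add_mset a ?m)) * ennreal (1 / u ?m) \<partial>count_space X)"
      using u_nonneg by (intro nn_integral_cong) (simp flip: ennreal_mult)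
    also have "\<dots> = ennreal (u ?m) * ennreal (1 / u ?m)"
      by (simp add: nn_integral_multc u_consistent[OF m])
    also have "\<dots> = 1" using False u_nonneg by (simp flip: ennreal_mult)
    finally show ?thesis
      using False by (auto simp: next_law_def Let_def emeasure_density intro!: prob_spaceI
          cong: nn_integral_cong_simp)
  qed
qed

text \<open>The chain rule, in product form so that it also holds at prefixes of weight 0: their
  extensions have weight 0 too.\<close>

lemma emeasure_next_law:
  assumes "\<omega> \<in> {0..<n} \<rightarrow> X" "a \<in> X"
  shows "ennreal (u (bag \<omega> {0..<n})) * emeasure (next_law n \<omega>) {a} = ennreal (u (add_mset a (bag \<omega> {0..<n})))"
proof (cases "u (bag \<omega> {0..<n}) = 0")
  case True
  have "u (add_mset a (bag \<omega> {0..<n})) \<le> 0"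
    using u_add_le[of "bag \<omega> {0..<n}" a] assms True by (auto simp: set_bag)
  then show ?thesis using u_nonneg True by (simp add: ennreal_neg)
next
  case False
  let ?m = "bag \<omega> {0..<n}"
  have "emeasure (next_law n \<omega>) {a} =
      (\<integral>\<^sup>+b. ennreal (u (add_mset b ?m) / u ?m) * indicator {a} b \<partial>count_space X)"
    using False assms by (simp add: next_law_def Let_def emeasure_density)
  also have "\<dots> = ennreal (u (add_mset a ?m) / u ?m)"
    using assms(2) by (subst nn_integral_indicator_singleton) auto
  finally show ?thesis using False u_nonneg by (simp flip: ennreal_mult)
qed

section \<open>The exchangeable sequence by the Ionescu-Tulcea construction\<close>

sublocale IT: Ionescu_Tulcea next_law "\<lambda>_. count_space X"
proof (rule Ionescu_Tulcea.intro)
  fix n :: nat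
  \<comment> \<open>Finite powers of a countable discrete space are discrete, so every choice of
    next laws is a measurable kernel.\<close>
  have "PiM {0..<n} (\<lambda>_. count_space X) = count_space (PiE {0..<n} (\<lambda>_. X))"
    using countable by (intro count_space_PiM_finite) auto
  then show "next_law n \<in> PiM {0..<n} (\<lambda>_. count_space X) \<rightarrow>\<^sub>M subprob_algebra (count_space X)"
    using next_law_prob
    by (auto simp: space_subprob_algebra PiE_def intro: prob_space_imp_subprob_space)
next
  fix n and \<omega> :: "nat \<Rightarrow> 'a"
  assume "\<omega> \<in> space (PiM {0..<n} (\<lambda>_. count_space X))"
  then show "prob_space (next_law n \<omega>)"
    using next_law_prob by (auto simp: space_PiM PiE_def)
qed

abbreviation prefixes :: "nat \<Rightarrow> (nat \<Rightarrow> 'a) set" where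
  "prefixes n \<equiv> PiE {0..<n} (\<lambda>_. X)"

lemma prefix_sets: "sets (PiM {0..<n} (\<lambda>_. count_space X)) = Pow (prefixes n)"
  using count_space_PiM_finite[of "{0..<n}" "\<lambda>_. X"] countable by simp

text \<open>By the chain rule the conditional quotients telescope to the value of \<open>u\<close>
  at the content of the prefix.\<close>

lemma emeasure_prefix:
  "\<omega> \<in> prefixes n \<Longrightarrow> emeasure (IT.C 0 n (\<lambda>_. undefined)) {\<omega>} = ennreal (u (bag \<omega> {0..<n}))"
proof (induction n arbitrary: \<omega>)
  case 0
  then show ?case by (simp add: bag_def u_empty PiM_empty emeasure_return)
next
  case (Suc n)
  let ?x = "\<lambda>_. undefined" and ?\<omega> = "restrict \<omega> {0..<n}" and ?P = "PiM {0..<n} (\<lambda>_. count_space X)"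
  have x: "?x \<in> space (PiM {0..<0::nat} (\<lambda>_. count_space X))" by (simp add: space_PiM)
  have pre: "?\<omega> \<in> prefixes n" and last: "\<omega> n \<in> X" using Suc.prems by (auto simp: PiE_iff)
  have C: "sets (IT.C 0 n ?x) = Pow (prefixes n)" "space (IT.C 0 n ?x) = prefixes n"
    using IT.sets_C[OF x, of n] IT.space_C[OF x, of n] by (simp_all add: prefix_sets space_PiM)
  \<comment> \<open>A one-step extension keeps the earlier entries, so \<open>\<omega>\<close> can
    only be reached from its own restriction.\<close>
  have eP: "emeasure (IT.eP n \<omega>') {\<omega>} = emeasure (next_law n ?\<omega>) {\<omega> n} * indicator {?\<omega>} \<omega>'"
    if "\<omega>' \<in> prefixes n" for \<omega>'
  proof -
    have "emeasure (IT.eP n \<omega>') {\<omega>} = emeasure (next_law n \<omega>') ((\<lambda>x. \<omega>'(n := x)) -` {\<omega>} \<inter> X)"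
    proof -
      have "\<omega>' \<in> space ?P" using that by (simp add: space_PiM)
      moreover have "{\<omega>} \<in> sets (PiM {0..<Suc n} (\<lambda>_. count_space X))"
        using Suc.prems by (simp add: prefix_sets)
      ultimately show ?thesis by (simp add: IT.emeasure_eP)
    qed
    moreover have "(\<lambda>x. \<omega>'(n := x)) -` {\<omega>} \<inter> X = (if \<omega>' = ?\<omega> then {\<omega> n} else {})"
    proof -
      have iff: "\<omega>'(n := x) = \<omega> \<longleftrightarrow> \<omega>' = ?\<omega> \<and> x = \<omega> n" for x
        using that Suc.prems
        by (auto simp: fun_eq_iff PiE_iff extensional_def restrict_def) (metis less_antisym)+
      have "x \<in> (\<lambda>x. \<omega>'(n := x)) -` {\<omega>} \<inter> X \<longleftrightarrow> (\<omega>' = ?\<omega> \<and> x = \<omega> n) \<and> x \<in> X" for x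
        by (simp only: Int_iff vimage_eq singleton_iff iff)
      also have "((\<omega>' = ?\<omega> \<and> x = \<omega> n) \<and> x \<in> X) = (x \<in> (if \<omega>' = ?\<omega> then {\<omega> n} else {}))" for x
        using last by (simp only: split: if_split) blast
      finally show ?thesis by (rule set_eqI)
    qed
    ultimately show ?thesis by (auto simp: indicator_def)
  qed
  have "emeasure (IT.C 0 (Suc n) ?x) {\<omega>} = (\<integral>\<^sup>+\<omega>'. emeasure (IT.eP n \<omega>') {\<omega>} \<partial>IT.C 0 n ?x)"
  proof -
    have "IT.eP n \<in> IT.C 0 n ?x \<rightarrow>\<^sub>M subprob_algebra (PiM {0..<Suc n} (\<lambda>_. count_space X))"
      using IT.measurable_eP[of n] IT.sets_C[OF x, of n] by (simp cong: measurable_cong_sets)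
    moreover have "space (IT.C 0 n ?x) \<noteq> {}" using pre C by blast
    moreover have "{\<omega>} \<in> sets (PiM {0..<Suc n} (\<lambda>_. count_space X))"
      using Suc.prems by (simp add: prefix_sets)
    ultimately show ?thesis
      unfolding IT.C.simps add_0 by (intro emeasure_bind)
  qed
  also have "\<dots> = (\<integral>\<^sup>+\<omega>'. emeasure (next_law n ?\<omega>) {\<omega> n} * indicator {?\<omega>} \<omega>' \<partial>IT.C 0 n ?x)"
    by (intro nn_integral_cong eP) (simp add: C)
  also have "\<dots> = emeasure (next_law n ?\<omega>) {\<omega> n} * emeasure (IT.C 0 n ?x) {?\<omega>}"
    using pre by (subst nn_integral_cmult_indicator) (auto simp: C)
  also have "\<dots> = ennreal (u (bag ?\<omega> {0..<n})) * emeasure (next_law n ?\<omega>) {\<omega> n}"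
    unfolding Suc.IH[OF pre] by (rule mult.commute)
  also have "\<dots> = ennreal (u (add_mset (\<omega> n) (bag ?\<omega> {0..<n})))"
    using pre last by (intro emeasure_next_law) auto
  also have "bag ?\<omega> {0..<n} = bag \<omega> {0..<n}" by (rule bag_cong) simp
  also have "add_mset (\<omega> n) (bag \<omega> {0..<n}) = bag \<omega> {0..<Suc n}"
    by (simp add: bag_insert atLeast0_lessThan_Suc)
  finally show ?case .
qed

abbreviation \<Omega> :: "(nat \<Rightarrow> 'a) measure" where "\<Omega> \<equiv> IT.PF.lim"

lemma measurable_coordinate: "(\<lambda>\<omega>. \<omega> i) \<in> \<Omega> \<rightarrow>\<^sub>M count_space X"
  using measurable_component_singleton[of i UNIV "\<lambda>_. count_space X"]
  by (simp only: measurable_cong_sets[OF IT.PF.sets_lim refl] UNIV_I)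

lemma cylinder_prefix:
  assumes "b \<in> UNIV \<rightarrow> X"
  shows "emeasure \<Omega> {\<omega> \<in> space \<Omega>. \<forall>i\<in>{0..<n}. \<omega> i = b i} = ennreal (u (bag b {0..<n}))"
proof -
  let ?b = "restrict b {0..<n}"
  have b: "?b \<in> prefixes n" using assms by auto
  then have set: "{?b} \<in> sets (PiM {0..<n} (\<lambda>_. count_space X))" by (simp add: prefix_sets)
  have "{\<omega> \<in> space \<Omega>. \<forall>i\<in>{0..<n}. \<omega> i = b i} = IT.PF.emb UNIV {0..<n} {?b}"
  proof -
    have "restrict \<omega> {0..<n} = ?b \<longleftrightarrow> (\<forall>i\<in>{0..<n}. \<omega> i = b i)" for \<omega>
      by (metis restrict_apply' restrict_ext)
    then show ?thesis
      unfolding IT.PF.space_lim prod_emb_def space_PiM vimage_def singleton_iff by auto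
  qed
  then have "emeasure \<Omega> {\<omega> \<in> space \<Omega>. \<forall>i\<in>{0..<n}. \<omega> i = b i} = emeasure (IT.CI {0..<n}) {?b}"
    using IT.lim[OF _ set] by simp
  also have "\<dots> = emeasure (IT.C 0 n (\<lambda>_. undefined)) (IT.PF.emb {0..<n} {0..<n} {?b})"
    by (rule IT.emeasure_CI[OF order_refl set])
  also have "IT.PF.emb {0..<n} {0..<n} {?b} = {?b}"
    using b by (intro prod_emb_id) auto
  also have "emeasure (IT.C 0 n (\<lambda>_. undefined)) {?b} = ennreal (u (bag ?b {0..<n}))"
    by (rule emeasure_prefix[OF b])
  also have "bag ?b {0..<n} = bag b {0..<n}" by (rule bag_cong) simp
  finally show ?thesis .
qed

sublocale \<Omega>: prob_space \<Omega>
proof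
  obtain b where "b \<in> X" using X_nonempty by blast
  then show "emeasure \<Omega> (space \<Omega>) = 1"
    using cylinder_prefix[of "\<lambda>_. b" 0] by (simp add: bag_def u_empty)
qed

lemma cylinder_measurable: "finite J \<Longrightarrow> {\<omega> \<in> space \<Omega>. \<forall>i\<in>J. \<omega> i = b i} \<in> sets \<Omega>"
proof (rule sets.sets_Collect_finite_All)
  fix i
  have "(\<lambda>\<omega>. \<omega> i) -` ({b i} \<inter> X) \<inter> space \<Omega> \<in> sets \<Omega>"
    by (rule measurable_sets[OF measurable_coordinate]) simp
  also have "(\<lambda>\<omega>. \<omega> i) -` ({b i} \<inter> X) \<inter> space \<Omega> = {\<omega> \<in> space \<Omega>. \<omega> i = b i}"
    by (auto simp: space_PiM PiE_UNIV_domain)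
  finally show "{\<omega> \<in> space \<Omega>. \<omega> i = b i} \<in> sets \<Omega>" .
qed

text \<open>Induction on the number of unconstrained positions below \<open>n\<close>. Splitting
  over the value at one of them adds it to \<open>J\<close>, and \<open>u_consistent\<close> sums
  the pieces. From here on positions no longer matter, only the prescribed contents.\<close>

lemma cylinder:
  assumes b: "b \<in> UNIV \<rightarrow> X" and J: "J \<subseteq> {0..<n}"
  shows "emeasure \<Omega> {\<omega> \<in> space \<Omega>. \<forall>i\<in>J. \<omega> i = b i} = ennreal (u (bag b J))"
  using assms
proof (induction "card ({0..<n} - J)" arbitrary: J b)
  case 0
  then have "J = {0..<n}" by auto
  with cylinder_prefix[OF 0(2)] show ?case by simp
next
  case (Suc k)
  have "{0..<n} - J \<noteq> {}" using Suc(2) by (metis card.empty nat.distinct(1))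
  then obtain i where "i \<in> {0..<n} - J" by blast
  then have i: "i < n" "i \<notin> J" by simp_all
  have J: "finite J" using finite_subset[OF Suc(4)] by simp
  have card: "k = card ({0..<n} - insert i J)"
  proof -
    have "{0..<n} - insert i J = ({0..<n} - J) - {i}" by blast
    with Suc(2) i show ?thesis by (simp add: card_Diff_singleton)
  qed
  let ?E = "\<lambda>b J. {\<omega> \<in> space \<Omega>. \<forall>i\<in>J. \<omega> i = b i}"
  have E: "?E (b(i := a)) (insert i J) = {\<omega> \<in> ?E b J. \<omega> i = a}" for a
  proof -
    have "(b(i := a)) j = b j" if "j \<in> J" for j using i(2) that by auto
    then have "(\<forall>j\<in>insert i J. \<omega> j = (b(i := a)) j) \<longleftrightarrow> (\<forall>j\<in>J. \<omega> j = b j) \<and> \<omega> i = a" for \<omega>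
      by (simp cong: ball_cong_simp) blast
    then show ?thesis by (simp only: mem_Collect_eq conj_assoc)
  qed
  have U: "?E b J = (\<Union>a\<in>X. ?E (b(i := a)) (insert i J))"
    unfolding E by (auto simp: space_PiM PiE_UNIV_domain)
  have "emeasure \<Omega> (?E b J) = (\<integral>\<^sup>+a. emeasure \<Omega> (?E (b(i := a)) (insert i J)) \<partial>count_space X)"
    unfolding U
  proof (rule emeasure_UN_countable)
    show "?E (b(i := a)) (insert i J) \<in> sets \<Omega>" for a using J by (intro cylinder_measurable) simp
    show "disjoint_family_on (\<lambda>a. ?E (b(i := a)) (insert i J)) X"
      unfolding E disjoint_family_on_def by blast
  qed (rule countable)
  also have "\<dots> = (\<integral>\<^sup>+a. ennreal (u (bag (b(i := a)) (insert i J))) \<partial>count_space X)"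
  proof (rule nn_integral_cong)
    fix a assume "a \<in> space (count_space X)"
    then show "emeasure \<Omega> (?E (b(i := a)) (insert i J)) = ennreal (u (bag (b(i := a)) (insert i J)))"
      using i Suc(3,4) by (intro Suc(1)[OF card]) auto
  qed
  also have "\<dots> = (\<integral>\<^sup>+a. ennreal (u (add_mset a (bag b J))) \<partial>count_space X)"
  proof (intro nn_integral_cong)
    fix a
    have "bag (b(i := a)) J = bag b J" using i by (intro bag_cong) auto
    then show "ennreal (u (bag (b(i := a)) (insert i J))) = ennreal (u (add_mset a (bag b J)))"
      using i J by (simp add: bag_insert)
  qed
  also have "\<dots> = ennreal (u (bag b J))"
    using Suc(3) J by (intro u_consistent) (auto simp: set_bag)
  finally show ?case .
qed

lemma joint_law:
  assumes "finite J" "b \<in> J \<rightarrow> X"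
  shows "\<Omega>.prob {\<omega> \<in> space \<Omega>. \<forall>i\<in>J. \<omega> i = b i} = u (bag b J)"
proof -
  obtain a where "a \<in> X" using X_nonempty by blast
  \<comment> \<open>\<open>b\<close> is controlled on \<open>J\<close> only, while the cylinder
    formula wants values in \<open>X\<close> everywhere; any fixed point of \<open>X\<close> fills
    the rest.\<close>
  define b' where "b' i = (if i \<in> J then b i else a)" for i
  have b': "b' \<in> UNIV \<rightarrow> X" using assms(2) \<open>a \<in> X\<close> by (auto simp: b'_def)
  obtain n where "J \<subseteq> {0..<n}" using finite_nat_set_iff_bounded assms(1) by (metis atLeast0LessThan lessThan_iff subsetI)
  from cylinder[OF b' this] have "\<Omega>.prob {\<omega> \<in> space \<Omega>. \<forall>i\<in>J. \<omega> i = b' i} = u (bag b' J)"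
    using u_nonneg by (simp add: measure_def)
  moreover have "bag b' J = bag b J" by (rule bag_cong) (simp add: b'_def)
  ultimately show ?thesis by (simp add: b'_def)
qed

end

section \<open>Limiting frequencies\<close>

context exchangeable_moments begin

definition hit :: "'a \<Rightarrow> nat \<Rightarrow> (nat \<Rightarrow> 'a) \<Rightarrow> real" where
  "hit a i \<omega> = (if \<omega> i = a then 1 else 0)"

definition freq :: "'a \<Rightarrow> nat \<Rightarrow> (nat \<Rightarrow> 'a) \<Rightarrow> real" where
  "freq a n \<omega> = (\<Sum>i<n. hit a i \<omega>) / real n"

lemma hit_bounds [simp]: "0 \<le> hit a i \<omega>" "hit a i \<omega> \<le> 1" "\<bar>hit a i \<omega>\<bar> \<le> 1"
  by (simp_all add: hit_def)

lemma measurable_hit [measurable]: "hit a i \<in> borel_measurable \<Omega>"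
proof -
  have "(\<lambda>x. if x = a then 1 else 0 :: real) \<in> count_space X \<rightarrow>\<^sub>M borel" by simp
  from measurable_compose[OF measurable_coordinate this] show ?thesis
    by (simp add: hit_def[abs_def])
qed

lemma measurable_freq [measurable]: "freq a n \<in> borel_measurable \<Omega>"
  unfolding freq_def[abs_def] by measurable

lemma freq_bounds: "0 \<le> freq a n \<omega>" "freq a n \<omega> \<le> 1"
proof -
  show "0 \<le> freq a n \<omega>" by (simp add: freq_def sum_nonneg)
  have "(\<Sum>i<n. hit a i \<omega>) \<le> (\<Sum>i<n. 1)" by (intro sum_mono) simp
  then show "freq a n \<omega> \<le> 1" by (cases "n = 0") (simp_all add: freq_def)
qed

lemma expectation_hits:
  assumes "finite J" "b \<in> J \<rightarrow> X"
  shows "\<Omega>.expectation (\<lambda>\<omega>. \<Prod>i\<in>J. hit (b i) i \<omega>) = u (bag b J)"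
proof -
  have "(\<Prod>i\<in>J. hit (b i) i \<omega>) = indicator {\<omega> \<in> space \<Omega>. \<forall>i\<in>J. \<omega> i = b i} \<omega>" if "\<omega> \<in> space \<Omega>" for \<omega>
    using that assms(1) by (auto simp: hit_def indicator_def prod_zero_iff)
  then have "\<Omega>.expectation (\<lambda>\<omega>. \<Prod>i\<in>J. hit (b i) i \<omega>) =
      \<Omega>.expectation (indicator {\<omega> \<in> space \<Omega>. \<forall>i\<in>J. \<omega> i = b i})"
    by (intro Bochner_Integration.integral_cong) auto
  also have "\<dots> = \<Omega>.prob {\<omega> \<in> space \<Omega>. \<forall>i\<in>J. \<omega> i = b i}"
    using cylinder_measurable[OF assms(1), of b] by (simp add: Int_absorb2)
  finally show ?thesis using joint_law[OF assms] by simp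
qed

lemma integrable_bounded:
  fixes f :: "(nat \<Rightarrow> 'a) \<Rightarrow> real"
  assumes "f \<in> borel_measurable \<Omega>" "\<And>\<omega>. \<bar>f \<omega>\<bar> \<le> 1"
  shows "integrable \<Omega> f"
  using assms by (intro \<Omega>.integrable_const_bound[where B=1]) auto

lemma expectation_hit_hit:
  assumes "a \<in> X"
  shows "\<Omega>.expectation (\<lambda>\<omega>. hit a i \<omega> * hit a j \<omega>) = (if i = j then u {#a#} else u {#a, a#})"
proof (cases "i = j")
  case True
  have "(\<lambda>\<omega>. hit a i \<omega> * hit a i \<omega>) = (\<lambda>\<omega>. \<Prod>k\<in>{i}. hit a k \<omega>)" by (simp add: hit_def fun_eq_iff)
  with True show ?thesis
    using expectation_hits[of "{i}" "\<lambda>_. a"] assms by (simp only: if_True, simp add: bag_def)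
next
  case False
  then have "hit a i \<omega> * hit a j \<omega> = (\<Prod>k\<in>{i, j}. hit a k \<omega>)" for \<omega> by simp
  then show ?thesis
    using expectation_hits[of "{i, j}" "\<lambda>_. a"] assms False by (simp add: bag_def)
qed

lemma expectation_freq_freq:
  assumes a: "a \<in> X" and n: "0 < n" "n \<le> m"
  shows "\<Omega>.expectation (\<lambda>\<omega>. freq a m \<omega> * freq a n \<omega>) = u {#a, a#} + (u {#a#} - u {#a, a#}) / real m"
proof -
  let ?p = "u {#a#}" and ?q = "u {#a, a#}"
  have int: "integrable \<Omega> (\<lambda>\<omega>. hit a i \<omega> * hit a j \<omega>)" for i j
    by (rule integrable_bounded, measurable) (simp add: hit_def)
  have "\<Omega>.expectation (\<lambda>\<omega>. freq a m \<omega> * freq a n \<omega>) =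
      \<Omega>.expectation (\<lambda>\<omega>. (\<Sum>j<n. \<Sum>i<m. hit a i \<omega> * hit a j \<omega>) / (real m * real n))"
    by (simp add: freq_def sum_product sum.swap[of _ "{..<n}"])
  also have "\<dots> = (\<Sum>j<n. \<Sum>i<m. \<Omega>.expectation (\<lambda>\<omega>. hit a i \<omega> * hit a j \<omega>)) / (real m * real n)"
    using int by (simp add: Bochner_Integration.integral_sum)
  also have "(\<Sum>j<n. \<Sum>i<m. \<Omega>.expectation (\<lambda>\<omega>. hit a i \<omega> * hit a j \<omega>)) = (\<Sum>j<n. (?p - ?q) + real m * ?q)"
  proof (rule sum.cong[OF refl])
    fix j assume "j \<in> {..<n}"
    then have j: "j < m" using n by simp
    \<comment> \<open>Since \<open>j < n \<le> m\<close>, exactly one index \<open>i\<close> meets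
      \<open>j\<close>; that diagonal term is \<open>?p\<close>, all the others are
      \<open>?q\<close>.\<close>
    have "(\<Sum>i<m. \<Omega>.expectation (\<lambda>\<omega>. hit a i \<omega> * hit a j \<omega>)) = (\<Sum>i<m. (if i = j then ?p - ?q else 0) + ?q)"
      by (rule sum.cong) (simp_all add: expectation_hit_hit[OF a])
    also have "\<dots> = (?p - ?q) + real m * ?q" using j by (simp add: sum.distrib)
    finally show "(\<Sum>i<m. \<Omega>.expectation (\<lambda>\<omega>. hit a i \<omega> * hit a j \<omega>)) = (?p - ?q) + real m * ?q" .
  qed
  also have "(\<Sum>j<n. (?p - ?q) + real m * ?q) / (real m * real n) = ?q + (?p - ?q) / real m"
    using n by (simp add: field_simps)
  finally show ?thesis .
qed

text \<open>The mean of the cross term equals that of the square at the larger size, as for a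
  reverse martingale. All that remains is \<open>(?p - ?q) * (1 / n - 1 / m)\<close>.\<close>

lemma freq_L2_distance:
  assumes a: "a \<in> X" and n: "0 < n" "n \<le> m"
  shows "\<Omega>.expectation (\<lambda>\<omega>. (freq a m \<omega> - freq a n \<omega>)\<^sup>2) \<le> 1 / real n"
proof -
  let ?p = "u {#a#}" and ?q = "u {#a, a#}"
  have int: "integrable \<Omega> (\<lambda>\<omega>. freq a k \<omega> * freq a l \<omega>)" for k l
    by (rule integrable_bounded) (auto simp: abs_mult freq_bounds intro!: mult_le_one)
  have "(\<lambda>\<omega>. (freq a m \<omega> - freq a n \<omega>)\<^sup>2) =
      (\<lambda>\<omega>. freq a m \<omega> * freq a m \<omega> - 2 * (freq a m \<omega> * freq a n \<omega>) + freq a n \<omega> * freq a n \<omega>)"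
    by (simp add: power2_eq_square algebra_simps)
  then have "\<Omega>.expectation (\<lambda>\<omega>. (freq a m \<omega> - freq a n \<omega>)\<^sup>2) =
      (?q + (?p - ?q) / m) - 2 * (?q + (?p - ?q) / m) + (?q + (?p - ?q) / n)"
    using int n a by (simp add: expectation_freq_freq)
  also have "\<dots> = (?p - ?q) / n - (?p - ?q) / m" by simp
  also have "\<dots> \<le> 1 / n"
  proof -
    have "?q \<le> ?p" "?p \<le> 1" using u_add_le[of "{#a#}" a] u_add_le[of "{#}" a] a u_empty by auto
    moreover have "0 \<le> ?q" by (rule u_nonneg)
    ultimately have "(?p - ?q) / n \<le> 1 / n" "0 \<le> (?p - ?q) / m" by (auto intro: divide_right_mono)
    then show ?thesis by linarith
  qed
  finally show ?thesis .
qed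

text \<open>Along the sizes \<open>4 ^ k\<close> the increments are summable in mean: \<open>2\<bar>D\<bar> \<le> 2 ^ k * D\<^sup>2 + 2 ^ -k\<close> and the
  second moment of the \<open>k\<close>-th increment is at most \<open>4 ^ -k\<close>.\<close>

lemma freq_increment_mean:
  assumes "a \<in> X"
  shows "(\<integral>\<^sup>+\<omega>. ennreal \<bar>freq a (4 ^ Suc k) \<omega> - freq a (4 ^ k) \<omega>\<bar> \<partial>\<Omega>) \<le> ennreal ((1/2) ^ k)"
proof -
  let ?D = "\<lambda>\<omega>. freq a (4 ^ Suc k) \<omega> - freq a (4 ^ k) \<omega>"
  have D1: "\<bar>?D \<omega>\<bar> \<le> 1" for \<omega>
    using freq_bounds[of a "4 ^ Suc k" \<omega>] freq_bounds[of a "4 ^ k" \<omega>] by linarith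
  have int: "integrable \<Omega> (\<lambda>\<omega>. \<bar>?D \<omega>\<bar>)" "integrable \<Omega> (\<lambda>\<omega>. (?D \<omega>)\<^sup>2)"
    using D1 by (auto intro!: integrable_bounded simp: abs_square_le_1)
  have amgm: "2 * \<bar>d\<bar> \<le> 2 ^ k * d\<^sup>2 + (1/2) ^ k" for d :: real
  proof -
    have "0 \<le> (2 ^ k * \<bar>d\<bar> - 1)\<^sup>2 * (1/2) ^ k" by simp
    also have "\<dots> = 2 ^ k * d\<^sup>2 + (1/2) ^ k - 2 * \<bar>d\<bar>"
      by (simp add: power2_eq_square field_simps power_one_over)
    finally show ?thesis by simp
  qed
  have "2 * \<Omega>.expectation (\<lambda>\<omega>. \<bar>?D \<omega>\<bar>) = \<Omega>.expectation (\<lambda>\<omega>. 2 * \<bar>?D \<omega>\<bar>)" by simp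
  also have "\<dots> \<le> \<Omega>.expectation (\<lambda>\<omega>. 2 ^ k * (?D \<omega>)\<^sup>2 + (1/2) ^ k)"
    using int by (intro integral_mono amgm) auto
  also have "\<dots> = 2 ^ k * \<Omega>.expectation (\<lambda>\<omega>. (?D \<omega>)\<^sup>2) + (1/2) ^ k"
    using int by (simp add: \<Omega>.prob_space[unfolded IT.PF.space_lim])
  also have "\<dots> \<le> 2 ^ k * (1 / real (4 ^ k)) + (1/2) ^ k"
    using freq_L2_distance[OF assms, of "4 ^ k" "4 ^ Suc k"] by (intro add_mono mult_left_mono) auto
  also have "2 ^ k * (1 / real (4 ^ k)) = (1/2 :: real) ^ k"
    by (simp add: power_divide[symmetric] flip: power_mult_distrib)
  finally have "\<Omega>.expectation (\<lambda>\<omega>. \<bar>?D \<omega>\<bar>) \<le> (1/2) ^ k" by simp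
  then show ?thesis
    using int(1) by (simp add: nn_integral_eq_integral ennreal_leI)
qed

text \<open>The summed absolute increments have finite mean, hence are finite almost everywhere, and
  an absolutely summable series of increments telescopes to a convergent sequence.\<close>

lemma freq_converges:
  assumes "a \<in> X"
  shows "AE \<omega> in \<Omega>. convergent (\<lambda>k. freq a (4 ^ k) \<omega>)"
proof -
  let ?D = "\<lambda>k \<omega>. freq a (4 ^ Suc k) \<omega> - freq a (4 ^ k) \<omega>"
  have "(\<integral>\<^sup>+\<omega>. (\<Sum>k. ennreal \<bar>?D k \<omega>\<bar>) \<partial>\<Omega>) = (\<Sum>k. \<integral>\<^sup>+\<omega>. ennreal \<bar>?D k \<omega>\<bar> \<partial>\<Omega>)"
    by (rule nn_integral_suminf) simp
  also have "\<dots> \<le> (\<Sum>k. ennreal ((1/2) ^ k))"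
    by (intro suminf_le freq_increment_mean[OF assms]) auto
  also have "\<dots> = ennreal (\<Sum>k. (1/2) ^ k)"
    by (intro suminf_ennreal2) (auto intro: summable_geometric)
  also have "\<dots> < \<infinity>" by simp
  finally have "(\<integral>\<^sup>+\<omega>. (\<Sum>k. ennreal \<bar>?D k \<omega>\<bar>) \<partial>\<Omega>) \<noteq> \<infinity>" by simp
  then have "AE \<omega> in \<Omega>. (\<Sum>k. ennreal \<bar>?D k \<omega>\<bar>) \<noteq> \<infinity>"
    by (intro nn_integral_PInf_AE) simp_all
  then show ?thesis
  proof eventually_elim
    case (elim \<omega>)
    then have "summable (\<lambda>k. \<bar>?D k \<omega>\<bar>)"
      by (intro summable_suminf_not_top) auto
    then have "summable (\<lambda>k. ?D k \<omega>)" by (rule summable_rabs_cancel)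
    then have "convergent (\<lambda>n. \<Sum>k<n. ?D k \<omega>)" by (simp add: summable_iff_convergent)
    then have "convergent (\<lambda>n. freq a (4 ^ n) \<omega> - freq a (4 ^ 0) \<omega>)"
      by (simp only: sum_lessThan_telescope[of "\<lambda>k. freq a (4 ^ k) \<omega>"])
    then show ?case
      by (simp add: convergent_diff_const_right_iff)
  qed
qed

text \<open>Clipping makes the limiting frequency lie in the unit interval everywhere, also
  where \<open>lim\<close> is junk.\<close>

definition limit_freq :: "(nat \<Rightarrow> 'a) \<Rightarrow> 'a \<Rightarrow> real" where
  "limit_freq \<omega> a = max 0 (min 1 (lim (\<lambda>k. freq a (4 ^ k) \<omega>)))"

lemma limit_freq_bounds: "0 \<le> limit_freq \<omega> a" "limit_freq \<omega> a \<le> 1"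
  by (simp_all add: limit_freq_def)

lemma measurable_limit_freq [measurable]: "(\<lambda>\<omega>. limit_freq \<omega> a) \<in> borel_measurable \<Omega>"
  unfolding limit_freq_def by measurable

lemma measurable_promotion_limit_freq [measurable]:
  "(\<lambda>\<omega>. promotion (limit_freq \<omega>) m) \<in> borel_measurable \<Omega>"
  by (induction m) simp_all

lemma freq_tendsto:
  assumes "a \<in> X"
  shows "AE \<omega> in \<Omega>. (\<lambda>k. freq a (4 ^ k) \<omega>) \<longlonglongrightarrow> limit_freq \<omega> a"
  using freq_converges[OF assms]
proof eventually_elim
  case (elim \<omega>)
  then have lim: "(\<lambda>k. freq a (4 ^ k) \<omega>) \<longlonglongrightarrow> lim (\<lambda>k. freq a (4 ^ k) \<omega>)"
    by (simp add: convergent_LIMSEQ_iff)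
  have "0 \<le> lim (\<lambda>k. freq a (4 ^ k) \<omega>)" "lim (\<lambda>k. freq a (4 ^ k) \<omega>) \<le> 1"
    by (rule LIMSEQ_le_const[OF lim], simp add: freq_bounds)
      (rule LIMSEQ_le_const2[OF lim], simp add: freq_bounds)
  with lim show ?case by (simp add: limit_freq_def)
qed

text \<open>The exceptional indices contribute a total deviation of at most a constant
  \<open>K\<close>, which the division by \<open>n\<close> removes.\<close>

lemma average_tendsto:
  fixes c :: "nat \<Rightarrow> real"
  assumes "finite J" "\<And>i. i \<notin> J \<Longrightarrow> c i = l"
  shows "(\<lambda>n. (\<Sum>i<n. c i) / real n) \<longlonglongrightarrow> l"
proof (rule LIMSEQ_I)
  fix r :: real assume r: "0 < r"
  define K where "K = (\<Sum>i\<in>J. \<bar>c i - l\<bar>)"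
  have bound: "norm ((\<Sum>i<n. c i) / real n - l) \<le> K / real n" if "0 < n" for n
  proof -
    have "(\<Sum>i<n. c i) / real n - l = (\<Sum>i<n. c i - l) / real n"
      using that by (simp add: sum_subtractf field_simps)
    moreover have "\<bar>\<Sum>i<n. c i - l\<bar> \<le> K"
    proof -
      have "\<bar>\<Sum>i<n. c i - l\<bar> \<le> (\<Sum>i<n. \<bar>c i - l\<bar>)" by (rule sum_abs)
      also have "\<dots> = (\<Sum>i\<in>{..<n} \<inter> J. \<bar>c i - l\<bar>)"
        by (rule sum.mono_neutral_right) (auto simp: assms(2))
      also have "\<dots> \<le> K" unfolding K_def using assms(1) by (intro sum_mono2) auto
      finally show ?thesis .
    qed
    ultimately show ?thesis by (simp add: abs_divide divide_right_mono)
  qed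
  obtain N :: nat where N: "K / r < real N" using reals_Archimedean2 by blast
  have "norm ((\<Sum>i<n. c i) / real n - l) < r" if "Suc N \<le> n" for n
  proof -
    have "K / r < real n" using N that by linarith
    then have "K / real n < r" using r that by (simp add: field_simps)
    with bound[of n] that show ?thesis by linarith
  qed
  then show "\<exists>N. \<forall>n\<ge>N. norm ((\<Sum>i<n. c i) / real n - l) < r" by blast
qed

text \<open>Replacing a limiting frequency by the average of the hits at a fresh index is exact,
  and only finitely many indices are not fresh.\<close>

lemma expectation_mixed:
  assumes "set_mset m \<subseteq> X" "finite J" "b \<in> J \<rightarrow> X"
  shows "\<Omega>.expectation (\<lambda>\<omega>. promotion (limit_freq \<omega>) m * (\<Prod>i\<in>J. hit (b i) i \<omega>)) = u (m + bag b J)"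
  using assms
proof (induction m arbitrary: J b)
  case empty
  then show ?case by (simp add: expectation_hits)
next
  case (add a m)
  let ?Z = "\<lambda>\<omega>. promotion (limit_freq \<omega>) m * (\<Prod>i\<in>J. hit (b i) i \<omega>)"
  have Zm[measurable]: "?Z \<in> borel_measurable \<Omega>" by simp
  have Z: "\<bar>?Z \<omega>\<bar> \<le> 1" for \<omega>
  proof -
    have "\<bar>promotion (limit_freq \<omega>) m\<bar> \<le> 1"
      using promotion_bounds[of "limit_freq \<omega>" m] limit_freq_bounds by simp
    moreover have "\<bar>\<Prod>i\<in>J. hit (b i) i \<omega>\<bar> \<le> 1"
      unfolding abs_prod by (intro prod_le_1) simp
    ultimately show ?thesis unfolding abs_mult by (intro mult_le_one) simp_all
  qed
  have a: "a \<in> X" using add.prems by simp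
  define c where "c i = \<Omega>.expectation (\<lambda>\<omega>. hit a i \<omega> * ?Z \<omega>)" for i
  \<comment> \<open>A fresh index adds one prescribed hit, so the induction hypothesis applies to
    \<open>insert i J\<close>. This is why \<open>J\<close> and \<open>b\<close> are arbitrary in
    the induction.\<close>
  have c: "c i = u (add_mset a m + bag b J)" if "i \<notin> J" for i
  proof -
    have "(\<Prod>j\<in>insert i J. hit ((b(i := a)) j) j \<omega>) = hit a i \<omega> * (\<Prod>j\<in>J. hit (b j) j \<omega>)" for \<omega>
    proof -
      have "(\<Prod>j\<in>J. hit ((b(i := a)) j) j \<omega>) = (\<Prod>j\<in>J. hit (b j) j \<omega>)"
        by (rule prod.cong) (use that in auto)
      then show ?thesis using add.prems(2) that by simp
    qed
    then have "c i = \<Omega>.expectation (\<lambda>\<omega>. promotion (limit_freq \<omega>) m * (\<Prod>j\<in>insert i J. hit ((b(i := a)) j) j \<omega>))"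
      unfolding c_def by (simp only: ac_simps)
    also have "\<dots> = u (m + bag (b(i := a)) (insert i J))"
      using add.prems a by (intro add.IH) auto
    also have "bag (b(i := a)) (insert i J) = add_mset a (bag b J)"
    proof -
      have "bag (b(i := a)) J = bag b J" by (rule bag_cong) (use that in auto)
      then show ?thesis using add.prems(2) that by (simp add: bag_insert)
    qed
    finally show ?thesis by simp
  qed
  \<comment> \<open>The limit of these expectations is found twice: by dominated convergence here,
    and below as the limit of the averages of \<open>c\<close>.\<close>
  have "(\<lambda>k. \<Omega>.expectation (\<lambda>\<omega>. freq a (4 ^ k) \<omega> * ?Z \<omega>)) \<longlonglongrightarrow>
      \<Omega>.expectation (\<lambda>\<omega>. limit_freq \<omega> a * ?Z \<omega>)"
  proof (rule integral_dominated_convergence[where w="\<lambda>_. 1"])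
    show "AE \<omega> in \<Omega>. (\<lambda>k. freq a (4 ^ k) \<omega> * ?Z \<omega>) \<longlonglongrightarrow> limit_freq \<omega> a * ?Z \<omega>"
      using freq_tendsto[OF a] by eventually_elim (rule tendsto_mult_right)
    show "AE \<omega> in \<Omega>. norm (freq a (4 ^ k) \<omega> * ?Z \<omega>) \<le> 1" for k
    proof (rule AE_I2)
      fix \<omega>
      have "\<bar>freq a (4 ^ k) \<omega>\<bar> \<le> 1" using freq_bounds[of a "4 ^ k" \<omega>] by simp
      then show "norm (freq a (4 ^ k) \<omega> * ?Z \<omega>) \<le> 1"
        using Z unfolding real_norm_def abs_mult[of "freq a (4 ^ k) \<omega>"] by (intro mult_le_one) simp_all
    qed
  qed simp_all
  moreover have "\<Omega>.expectation (\<lambda>\<omega>. freq a n \<omega> * ?Z \<omega>) = (\<Sum>i<n. c i) / real n" for n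
  proof -
    have "integrable \<Omega> (\<lambda>\<omega>. hit a i \<omega> * ?Z \<omega>)" for i
    proof (rule integrable_bounded)
      show "\<bar>hit a i \<omega> * ?Z \<omega>\<bar> \<le> 1" for \<omega>
        using Z unfolding abs_mult[of "hit a i \<omega>"] by (intro mult_le_one) simp_all
    qed simp
    then have "(\<Sum>i<n. c i) = \<Omega>.expectation (\<lambda>\<omega>. \<Sum>i<n. hit a i \<omega> * ?Z \<omega>)"
      unfolding c_def by (simp only: Bochner_Integration.integral_sum)
    also have "\<dots> / real n = \<Omega>.expectation (\<lambda>\<omega>. (\<Sum>i<n. hit a i \<omega> * ?Z \<omega>) / real n)"
      by (simp only: integral_divide_zero)
    also have "\<dots> = \<Omega>.expectation (\<lambda>\<omega>. freq a n \<omega> * ?Z \<omega>)"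
      by (simp only: freq_def sum_distrib_right times_divide_eq_left)
    finally show ?thesis by simp
  qed
  moreover have "(\<lambda>k. (\<Sum>i<4 ^ k. c i) / real (4 ^ k)) \<longlonglongrightarrow> u (add_mset a m + bag b J)"
  proof -
    have "filterlim (\<lambda>k. 4 ^ k :: nat) sequentially sequentially"
      by (rule filterlim_subseq) (simp add: strict_mono_def)
    with average_tendsto[OF add.prems(2) c] show ?thesis
      by (rule filterlim_compose)
  qed
  ultimately have "\<Omega>.expectation (\<lambda>\<omega>. limit_freq \<omega> a * ?Z \<omega>) = u (add_mset a m + bag b J)"
    using LIMSEQ_unique by simp
  then show ?case by (simp only: promotion_add_mset mult.assoc)
qed

lemma expectation_limit_freq:
  assumes "set_mset m \<subseteq> X"
  shows "\<Omega>.expectation (\<lambda>\<omega>. promotion (limit_freq \<omega>) m) = u m"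
  using expectation_mixed[OF assms, of "{}" undefined] by (simp add: bag_def)

text \<open>Each empirical distribution has mass 1, so Fatou bounds the limiting mass by 1 almost
  everywhere. Its mean is the sum of all \<open>u {#a#}\<close>, which is 1, so the nonnegative
  defect has integral 0 and vanishes almost everywhere.\<close>

lemma limit_freq_total: "AE \<omega> in \<Omega>. (\<integral>\<^sup>+a. ennreal (limit_freq \<omega> a) \<partial>count_space X) = 1"
proof -
  let ?S = "\<lambda>\<omega>. \<integral>\<^sup>+a. ennreal (limit_freq \<omega> a) \<partial>count_space X"
  have [measurable]: "?S \<in> borel_measurable \<Omega>"
    using countable by (intro measurable_nn_integral_count) simp_all
  have "(\<integral>\<^sup>+\<omega>. ?S \<omega> \<partial>\<Omega>) = (\<integral>\<^sup>+a. (\<integral>\<^sup>+\<omega>. ennreal (limit_freq \<omega> a) \<partial>\<Omega>) \<partial>count_space X)"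
    using countable \<Omega>.sigma_finite_measure_axioms by (intro nn_integral_count_swap) simp_all
  also have "\<dots> = (\<integral>\<^sup>+a. ennreal (u (add_mset a {#})) \<partial>count_space X)"
  proof (rule nn_integral_cong)
    fix a assume "a \<in> space (count_space X)"
    then have "\<Omega>.expectation (\<lambda>\<omega>. limit_freq \<omega> a) = u {#a#}"
      using expectation_limit_freq[of "{#a#}"] by simp
    moreover have "integrable \<Omega> (\<lambda>\<omega>. limit_freq \<omega> a)"
      by (rule integrable_bounded) (simp_all add: limit_freq_bounds)
    ultimately show "(\<integral>\<^sup>+\<omega>. ennreal (limit_freq \<omega> a) \<partial>\<Omega>) = ennreal (u (add_mset a {#}))"
      by (simp add: nn_integral_eq_integral limit_freq_bounds)
  qed
  also have "\<dots> = 1" using u_consistent[of "{#}"] u_empty by simp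
  finally have mean: "(\<integral>\<^sup>+\<omega>. ?S \<omega> \<partial>\<Omega>) = 1" .
  \<comment> \<open>Countability of \<open>X\<close> gives a single null set outside which all
    coordinates converge.\<close>
  have "AE \<omega> in \<Omega>. \<forall>a\<in>X. (\<lambda>k. freq a (4 ^ k) \<omega>) \<longlonglongrightarrow> limit_freq \<omega> a"
    using countable freq_tendsto by (simp add: AE_ball_countable)
  then have le: "AE \<omega> in \<Omega>. ?S \<omega> \<le> 1"
  proof (rule AE_mp, intro AE_I2 impI)
    fix \<omega> assume \<omega>: "\<omega> \<in> space \<Omega>" and lim: "\<forall>a\<in>X. (\<lambda>k. freq a (4 ^ k) \<omega>) \<longlonglongrightarrow> limit_freq \<omega> a"
    have in_X: "\<omega> i \<in> X" for i using \<omega> by (auto simp: space_PiM PiE_UNIV_domain)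
    have total: "(\<integral>\<^sup>+a. ennreal (freq a n \<omega>) \<partial>count_space X) = 1" if "0 < n" for n
    proof -
      have "(\<integral>\<^sup>+a. ennreal (freq a n \<omega>) \<partial>count_space X) =
          (\<integral>\<^sup>+a. (\<Sum>i<n. ennreal (hit a i \<omega>)) * ennreal (1 / real n) \<partial>count_space X)"
        using that by (intro nn_integral_cong) (simp add: freq_def sum_nonneg flip: ennreal_mult)
      also have "\<dots> = (\<Sum>i<n. \<integral>\<^sup>+a. ennreal (hit a i \<omega>) \<partial>count_space X) * ennreal (1 / real n)"
        by (subst nn_integral_multc, simp, subst nn_integral_sum, simp_all del: sum_ennreal)
      also have "(\<Sum>i<n. \<integral>\<^sup>+a. ennreal (hit a i \<omega>) \<partial>count_space X) = (\<Sum>i<n. 1)"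
      proof (rule sum.cong[OF refl])
        fix i
        have "(\<integral>\<^sup>+a. ennreal (hit a i \<omega>) \<partial>count_space X) = (\<integral>\<^sup>+a. indicator {\<omega> i} a \<partial>count_space X)"
          by (intro nn_integral_cong) (auto simp: hit_def)
        also have "\<dots> = 1" using in_X[of i] by simp
        finally show "(\<integral>\<^sup>+a. ennreal (hit a i \<omega>) \<partial>count_space X) = 1" .
      qed
      also have "(\<Sum>i<n. 1) * ennreal (1 / real n) = 1"
        using that by (simp add: ennreal_of_nat_eq_real_of_nat flip: ennreal_mult)
      finally show ?thesis .
    qed
    have "?S \<omega> = (\<integral>\<^sup>+a. liminf (\<lambda>k. ennreal (freq a (4 ^ k) \<omega>)) \<partial>count_space X)"
    proof (rule nn_integral_cong)
      fix a assume "a \<in> space (count_space X)"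
      then have "(\<lambda>k. ennreal (freq a (4 ^ k) \<omega>)) \<longlonglongrightarrow> ennreal (limit_freq \<omega> a)"
        using lim by (intro tendsto_ennrealI) simp
      then show "ennreal (limit_freq \<omega> a) = liminf (\<lambda>k. ennreal (freq a (4 ^ k) \<omega>))"
        by (rule lim_imp_Liminf[OF sequentially_bot, symmetric])
    qed
    also have "\<dots> \<le> liminf (\<lambda>k. \<integral>\<^sup>+a. ennreal (freq a (4 ^ k) \<omega>) \<partial>count_space X)"
      by (rule nn_integral_liminf) simp
    also have "\<dots> = 1" by (simp add: total Liminf_const)
    finally show "?S \<omega> \<le> 1" .
  qed
  have "(\<integral>\<^sup>+\<omega>. 1 - ?S \<omega> \<partial>\<Omega>) = (\<integral>\<^sup>+\<omega>. 1 \<partial>\<Omega>) - (\<integral>\<^sup>+\<omega>. ?S \<omega> \<partial>\<Omega>)"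
    using le mean by (intro nn_integral_diff) simp_all
  also have "\<dots> = 0" using mean by (simp add: \<Omega>.emeasure_space_1[unfolded IT.PF.space_lim])
  finally have "AE \<omega> in \<Omega>. 1 - ?S \<omega> = 0"
    by (subst (asm) nn_integral_0_iff_AE) simp_all
  with le show ?thesis
  proof eventually_elim
    case (elim \<omega>)
    then show ?case by (metis antisym diff_eq_0_iff_ennreal not_less)
  qed
qed

theorem moment_representation:
  "\<exists>\<mu>. prob_space \<mu> \<and> sets \<mu> = sets G \<and> (\<forall>m. set_mset m \<subseteq> X \<longrightarrow> moments \<mu> m = u m)"
proof -
  obtain a\<^sub>0 where a\<^sub>0: "a\<^sub>0 \<in> X" using X_nonempty by blast
  let ?total = "\<lambda>\<omega>. (\<integral>\<^sup>+a. ennreal (limit_freq \<omega> a) \<partial>count_space X) = 1"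
  \<comment> \<open>On the null event where the limiting frequencies do not sum to 1 a Dirac measure
    is substituted, so that \<open>h\<close> lies in \<open>G\<close> everywhere. The representing
    measure is the law of \<open>h\<close>.\<close>
  define h where "h \<omega> = (if ?total \<omega> then density (count_space X) (\<lambda>a. ennreal (limit_freq \<omega> a))
    else return (count_space X) a\<^sub>0)" for \<omega>
  have h_space: "h \<omega> \<in> space G" for \<omega>
    using a\<^sub>0 by (auto simp: h_def space_prob_algebra emeasure_density prob_space_return
        intro!: prob_spaceI cong: nn_integral_cong_simp)
  have h_density: "density_vector (h \<omega>) a = (if ?total \<omega> then limit_freq \<omega> a else indicator {a} a\<^sub>0)"
    if "a \<in> X" for \<omega> a
  proof -
    have "(\<integral>\<^sup>+b. ennreal (limit_freq \<omega> b) * indicator {a} b \<partial>count_space X) = ennreal (limit_freq \<omega> a)"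
      using that by (subst nn_integral_indicator_singleton) auto
    then show ?thesis
      using that limit_freq_bounds
      by (auto simp: density_vector_def h_def measure_def emeasure_density indicator_def)
  qed
  have total_measurable: "Measurable.pred \<Omega> ?total"
  proof -
    have "(\<lambda>\<omega>. \<integral>\<^sup>+a. ennreal (limit_freq \<omega> a) \<partial>count_space X) \<in> borel_measurable \<Omega>"
      using countable by (intro measurable_nn_integral_count) simp_all
    then show ?thesis by simp
  qed
  have h: "h \<in> \<Omega> \<rightarrow>\<^sub>M G"
  proof (rule measurable_into_G)
    fix a assume "a \<in> X"
    with total_measurable show "(\<lambda>\<omega>. density_vector (h \<omega>) a) \<in> borel_measurable \<Omega>"
      by (simp add: h_density)
  qed (rule h_space)
  have "prob_space (distr \<Omega> G h)" by (rule \<Omega>.prob_space_distr[OF h])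
  moreover have "moments (distr \<Omega> G h) m = u m" if m: "set_mset m \<subseteq> X" for m
  proof -
    have "moments (distr \<Omega> G h) m = \<Omega>.expectation (\<lambda>\<omega>. promotion (density_vector (h \<omega>)) m)"
      unfolding moments_def by (rule integral_distr[OF h measurable_promotion])
    also have "\<dots> = \<Omega>.expectation (\<lambda>\<omega>. promotion (limit_freq \<omega>) m)"
    proof (rule integral_cong_AE)
      show "(\<lambda>\<omega>. promotion (density_vector (h \<omega>)) m) \<in> borel_measurable \<Omega>"
        by (rule measurable_compose[OF h measurable_promotion])
      show "AE \<omega> in \<Omega>. promotion (density_vector (h \<omega>)) m = promotion (limit_freq \<omega>) m"
        using limit_freq_total
      proof eventually_elim
        case (elim \<omega>)
        then have "density_vector (h \<omega>) a = limit_freq \<omega> a" if "a \<in> X" for a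
          by (simp add: h_density[OF that])
        with m show ?case
          unfolding promotion_def by (metis (no_types, lifting) image_mset_cong subsetD)
      qed
    qed simp
    also have "\<dots> = u m" by (rule expectation_limit_freq[OF m])
    finally show ?thesis .
  qed
  ultimately show ?thesis by (intro exI[of _ "distr \<Omega> G h"]) simp
qed

end

section \<open>Total elements of the exponential\<close>

lemma pairing_commute: "pairing W x y = pairing W y x"
  by (simp add: pairing_def mult.commute)

lemma subset_double_orthogonal:
  assumes "\<And>x. x \<in> U \<Longrightarrow> (\<forall>i. 0 \<le> x i) \<and> (\<forall>i. i \<notin> W \<longrightarrow> x i = 0)"
  shows "U \<subseteq> orthogonal_set W (orthogonal_set W U)"
  using assms by (auto simp: orthogonal_set_def pairing_commute)

lemma orthogonal_antimono: "U \<subseteq> V \<Longrightarrow> orthogonal_set W V \<subseteq> orthogonal_set W U"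
  by (auto simp: orthogonal_set_def)

lemma triple_orthogonal:
  assumes "\<And>x. x \<in> U \<Longrightarrow> (\<forall>i. 0 \<le> x i) \<and> (\<forall>i. i \<notin> W \<longrightarrow> x i = 0)"
  shows "orthogonal_set W (orthogonal_set W (orthogonal_set W U)) = orthogonal_set W U"
proof (rule antisym)
  show "orthogonal_set W (orthogonal_set W (orthogonal_set W U)) \<subseteq> orthogonal_set W U"
    using subset_double_orthogonal[OF assms] by (rule orthogonal_antimono)
  show "orthogonal_set W U \<subseteq> orthogonal_set W (orthogonal_set W (orthogonal_set W U))"
    by (rule subset_double_orthogonal) (simp add: orthogonal_set_def)
qed

definition unit_vector :: "'i \<Rightarrow> 'i \<Rightarrow> real" where
  "unit_vector m = (\<lambda>k. if k = m then 1 else 0)"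

context countable_discrete begin

definition W :: "'a multiset set" where "W = {m. set_mset m \<subseteq> X}"

abbreviation bangX :: "'a multiset pcs" where "bangX \<equiv> bang (discrete_pcs X)"

abbreviation totalX :: "('a multiset \<Rightarrow> real) set" where
  "totalX \<equiv> bang_total (discrete_pcs X) (discrete_total X)"

abbreviation total_cone :: "('a multiset \<Rightarrow> real) mcone_data" where
  "total_cone \<equiv> totality_cone bangX totalX"

abbreviation cotests :: "('a multiset \<Rightarrow> real) set" where
  "cotests \<equiv> elems (pcs_dual bangX)"

abbreviation strict_cotests :: "('a multiset \<Rightarrow> real) set" where
  "strict_cotests \<equiv> strict_orthogonal bangX (promotion ` discrete_total X)"

lemma countable_W: "countable W"
proof -
  have "W \<subseteq> mset ` lists X"
  proof
    fix m assume "m \<in> W"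
    obtain xs where "m = mset xs" using ex_mset by metis
    with \<open>m \<in> W\<close> show "m \<in> mset ` lists X" by (auto simp: W_def)
  qed
  then show ?thesis using countable by (meson countable_image countable_lists countable_subset)
qed

lemma empty_in_W [simp]: "{#} \<in> W" by (simp add: W_def)

lemma pairing_nn_integral: "pairing W x y = (\<integral>\<^sup>+m. ennreal (x m * y m) \<partial>count_space W)"
  unfolding pairing_def by (rule infsum_eq_nn_integral[OF countable_W])

lemma sum_nn_integral: "(\<Sum>\<^sub>\<infinity>a\<in>X. ennreal (z a)) = (\<integral>\<^sup>+a. ennreal (z a) \<partial>count_space X)"
  by (rule infsum_eq_nn_integral[OF countable])

lemma web_bangX: "web bangX = W" "web (pcs_dual bangX) = W"
  by (simp_all add: bang_def Let_def W_def discrete_pcs_def pcs_dual_def)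

lemma elems_bangX: "elems bangX = orthogonal_set W (orthogonal_set W (promotion ` elems (discrete_pcs X)))"
  by (simp add: bang_def Let_def W_def discrete_pcs_def)

lemma promotion_off_web:
  assumes "\<And>a. a \<notin> X \<Longrightarrow> z a = 0" "m \<notin> W"
  shows "promotion z m = 0"
proof -
  obtain a where "a \<in># m" "a \<notin> X" using assms(2) by (auto simp: W_def)
  then have "0 \<in># image_mset z m" using assms(1) by (auto intro: image_eqI[of _ _ a])
  then show ?thesis unfolding promotion_def by (simp only: prod_mset_zero_iff)
qed

lemma promotion_nonneg: "(\<And>a. 0 \<le> z a) \<Longrightarrow> 0 \<le> promotion z m"
  by (induction m) auto

lemma elems_discrete:
  "z \<in> elems (discrete_pcs X) \<longleftrightarrow> (\<forall>a. 0 \<le> z a) \<and> (\<forall>a. a \<notin> X \<longrightarrow> z a = 0) \<and>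
     (\<integral>\<^sup>+a. ennreal (z a) \<partial>count_space X) \<le> 1"
  by (simp add: discrete_pcs_def sum_nn_integral)

lemma total_discrete:
  "z \<in> discrete_total X \<longleftrightarrow> (\<forall>a. 0 \<le> z a) \<and> (\<forall>a. a \<notin> X \<longrightarrow> z a = 0) \<and>
     (\<integral>\<^sup>+a. ennreal (z a) \<partial>count_space X) = 1"
  by (simp add: discrete_total_def sum_nn_integral)

lemma total_subset_elems: "discrete_total X \<subseteq> elems (discrete_pcs X)"
  by (auto simp: elems_discrete total_discrete)

lemma promotions_vectors:
  assumes "x \<in> promotion ` elems (discrete_pcs X)"
  shows "(\<forall>m. 0 \<le> x m) \<and> (\<forall>m. m \<notin> W \<longrightarrow> x m = 0)"
proof -
  obtain z where z: "\<And>a. 0 \<le> z a" "\<And>a. a \<notin> X \<Longrightarrow> z a = 0" "x = promotion z"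
    using assms unfolding image_iff Bex_def elems_discrete by blast
  show ?thesis
    unfolding z(3) using promotion_nonneg[of z, OF z(1)] promotion_off_web[of z, OF z(2)] by blast
qed

text \<open>The dual of the exponential is a triple orthogonal, which collapses to a single one;
  tests therefore need to be checked on promotions only.\<close>

lemma cotests_eq: "cotests = orthogonal_set W (promotion ` elems (discrete_pcs X))"
  using triple_orthogonal[OF promotions_vectors] by (simp add: pcs_dual_def web_bangX elems_bangX)

lemma cotestsD:
  assumes "v \<in> cotests"
  shows "0 \<le> v m" "m \<notin> W \<Longrightarrow> v m = 0" "z \<in> elems (discrete_pcs X) \<Longrightarrow> pairing W (promotion z) v \<le> 1"
  using assms by (auto simp: cotests_eq orthogonal_set_def)

lemma cotestsI:
  assumes "\<And>m. 0 \<le> v m" "\<And>m. m \<notin> W \<Longrightarrow> v m = 0"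
    "\<And>z. z \<in> elems (discrete_pcs X) \<Longrightarrow> pairing W (promotion z) v \<le> 1"
  shows "v \<in> cotests"
  using assms by (auto simp: cotests_eq orthogonal_set_def)

lemma strict_cotests_iff:
  "v \<in> strict_cotests \<longleftrightarrow> v \<in> cotests \<and> (\<forall>z\<in>discrete_total X. pairing W (promotion z) v = 1)"
  by (auto simp: strict_orthogonal_def web_bangX)

lemma elems_bangX_iff:
  "u \<in> elems bangX \<longleftrightarrow> (\<forall>m. 0 \<le> u m) \<and> (\<forall>m. m \<notin> W \<longrightarrow> u m = 0) \<and> (\<forall>v\<in>cotests. pairing W u v \<le> 1)"
  unfolding cotests_eq elems_bangX orthogonal_set_def[of W "orthogonal_set W (promotion ` elems (discrete_pcs X))"]
  by (simp add: pairing_commute[of W u])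

text \<open>The exponential is its own bidual, so the outer strict orthogonal ranges over
  \<open>elems bangX\<close>.\<close>

lemma totalX_iff: "u \<in> totalX \<longleftrightarrow> u \<in> elems bangX \<and> (\<forall>v\<in>strict_cotests. pairing W u v = 1)"
proof -
  have "elems (pcs_dual (pcs_dual bangX)) = elems bangX"
    by (subst pcs_dual_def) (simp add: web_bangX cotests_eq elems_bangX)
  then show ?thesis
    unfolding bang_total_def strict_orthogonal_def[of "pcs_dual bangX"]
    by (auto simp: web_bangX pairing_commute[of W u])
qed

section \<open>Coefficient tests and the movement of weight between coefficients\<close>

lemma pairing_unit_vector:
  assumes "m \<in> W"
  shows "pairing W x (unit_vector m) = ennreal (x m)"
proof -
  have "pairing W x (unit_vector m) = (\<integral>\<^sup>+k. ennreal (x k) * indicator {m} k \<partial>count_space W)"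
    unfolding pairing_nn_integral
    by (intro nn_integral_cong) (simp add: unit_vector_def indicator_def)
  also have "\<dots> = ennreal (x m)"
    using assms by (subst nn_integral_indicator_singleton) auto
  finally show ?thesis .
qed

lemma elems_le_one:
  assumes "z \<in> elems (discrete_pcs X)"
  shows "z a \<le> 1"
proof (cases "a \<in> X")
  case True
  then have "ennreal (z a) \<le> (\<integral>\<^sup>+a. ennreal (z a) \<partial>count_space X)"
    by (rule nn_integral_ge_point)
  also have "\<dots> \<le> 1" using assms by (simp add: elems_discrete)
  finally show ?thesis by (simp add: ennreal_le_1)
qed (use assms in \<open>simp add: elems_discrete\<close>)

lemma unit_vector_cotest:
  assumes "m \<in> W"
  shows "unit_vector m \<in> cotests"
proof (rule cotestsI)
  fix z assume z: "z \<in> elems (discrete_pcs X)"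
  then have "promotion z m \<le> 1"
    using promotion_bounds[of z m] elems_le_one by (simp add: elems_discrete)
  then show "pairing W (promotion z) (unit_vector m) \<le> 1"
    by (simp add: pairing_unit_vector[OF assms] ennreal_le_1)
qed (use assms in \<open>auto simp: unit_vector_def\<close>)

lemma unit_vector_empty_strict: "unit_vector {#} \<in> strict_cotests"
  by (simp add: strict_cotests_iff unit_vector_cotest pairing_unit_vector)

text \<open>Read \<open>v\<close> as a power series in the coordinates: one copy of the monomial of
  \<open>m\<close> is replaced by its product with the sum of all variables.\<close>

definition shift :: "'a multiset \<Rightarrow> ('a multiset \<Rightarrow> real) \<Rightarrow> 'a multiset \<Rightarrow> real" where
  "shift m v = (\<lambda>k. v k - unit_vector m k + indicator ((\<lambda>a. add_mset a m) ` X) k)"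

text \<open>The removed term is written on the left because subtraction in \<open>ennreal\<close> is
  truncated. The hypothesis \<open>1 \<le> v m\<close> keeps the coefficients of the shifted vector
  nonnegative.\<close>

lemma pairing_shift:
  assumes m: "m \<in> W" and v: "\<And>k. 0 \<le> v k" "1 \<le> v m" and x: "\<And>k. 0 \<le> x k"
  shows "pairing W x (shift m v) + ennreal (x m) =
    pairing W x v + (\<integral>\<^sup>+a. ennreal (x (add_mset a m)) \<partial>count_space X)"
proof -
  let ?S = "(\<lambda>a. add_mset a m) ` X"
  have S: "?S \<subseteq> W" using m by (auto simp: W_def)
  have "pairing W x (shift m v) + ennreal (x m) = pairing W x (shift m v) + pairing W x (unit_vector m)"
    by (simp add: pairing_unit_vector[OF m])
  also have "\<dots> = (\<integral>\<^sup>+k. ennreal (x k * shift m v k) + ennreal (x k * unit_vector m k) \<partial>count_space W)"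
    unfolding pairing_nn_integral by (rule nn_integral_add[symmetric]) simp_all
  also have "\<dots> = (\<integral>\<^sup>+k. ennreal (x k * v k) + ennreal (x k) * indicator ?S k \<partial>count_space W)"
  proof (rule nn_integral_cong)
    fix k
    have "0 \<le> shift m v k" using v by (auto simp: shift_def unit_vector_def)
    then have "ennreal (x k * shift m v k) + ennreal (x k * unit_vector m k) =
        ennreal (x k * shift m v k + x k * unit_vector m k)"
      using x by (intro ennreal_plus[symmetric]) (simp_all add: unit_vector_def)
    also have "x k * shift m v k + x k * unit_vector m k = x k * v k + x k * indicator ?S k"
      by (simp add: shift_def algebra_simps)
    also have "ennreal \<dots> = ennreal (x k * v k) + ennreal (x k) * indicator ?S k"
      using x v by (auto simp: indicator_def)
    finally show "ennreal (x k * shift m v k) + ennreal (x k * unit_vector m k) =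
        ennreal (x k * v k) + ennreal (x k) * indicator ?S k" .
  qed
  also have "\<dots> = pairing W x v + (\<integral>\<^sup>+k. ennreal (x k) * indicator ?S k \<partial>count_space W)"
    unfolding pairing_nn_integral by (rule nn_integral_add) simp_all
  also have "(\<integral>\<^sup>+k. ennreal (x k) * indicator ?S k \<partial>count_space W) = (\<integral>\<^sup>+k. ennreal (x k) \<partial>count_space ?S)"
  proof -
    have "(\<integral>\<^sup>+k. ennreal (x k) * indicator ?S k \<partial>count_space W) =
        (\<integral>\<^sup>+k. ennreal (x k) * indicator ?S k * indicator W k \<partial>count_space UNIV)"
      by (simp add: nn_integral_restrict_space[symmetric] restrict_count_space)
    also have "\<dots> = (\<integral>\<^sup>+k. ennreal (x k) * indicator ?S k \<partial>count_space UNIV)"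
      using S by (intro nn_integral_cong) (auto simp: indicator_def)
    also have "\<dots> = (\<integral>\<^sup>+k. ennreal (x k) \<partial>count_space ?S)"
      by (simp add: nn_integral_restrict_space[symmetric] restrict_count_space)
    finally show ?thesis .
  qed
  also have "\<dots> = (\<integral>\<^sup>+a. ennreal (x (add_mset a m)) \<partial>count_space X)"
    by (rule nn_integral_bij_count_space[symmetric]) (auto simp: bij_betw_def inj_on_def)
  finally show ?thesis .
qed

lemma promotion_sum:
  assumes "z \<in> elems (discrete_pcs X)"
  shows "(\<integral>\<^sup>+a. ennreal (promotion z (add_mset a m)) \<partial>count_space X) =
    (\<integral>\<^sup>+a. ennreal (z a) \<partial>count_space X) * ennreal (promotion z m)"
proof -
  have z: "0 \<le> z a" for a using assms by (simp add: elems_discrete)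
  then have "(\<integral>\<^sup>+a. ennreal (promotion z (add_mset a m)) \<partial>count_space X) =
      (\<integral>\<^sup>+a. ennreal (z a) * ennreal (promotion z m) \<partial>count_space X)"
    by (intro nn_integral_cong) (simp add: ennreal_mult promotion_nonneg)
  then show ?thesis by (simp add: nn_integral_multc)
qed

text \<open>The sum of a probability vector is 1, so moving one unit of weight from the
  coefficient of \<open>m\<close> to the coefficients of all \<open>m + {a}\<close> does not change the value at its promotion.\<close>

lemma shift_strict_cotest:
  assumes m: "m \<in> W" and v: "v \<in> strict_cotests" "1 \<le> v m"
  shows "shift m v \<in> strict_cotests"
proof -
  have vc: "v \<in> cotests" using v by (simp add: strict_cotests_iff)
  have eq: "pairing W (promotion z) (shift m v) + ennreal (promotion z m) =
      pairing W (promotion z) v + (\<integral>\<^sup>+a. ennreal (z a) \<partial>count_space X) * ennreal (promotion z m)"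
    if "z \<in> elems (discrete_pcs X)" for z
  proof -
    have "\<And>k. 0 \<le> promotion z k" using that by (intro promotion_nonneg) (simp add: elems_discrete)
    from pairing_shift[where v=v and x="promotion z", OF m cotestsD(1)[OF vc] v(2) this]
    show ?thesis unfolding promotion_sum[OF that] .
  qed
  show ?thesis
    unfolding strict_cotests_iff
  proof (intro conjI ballI cotestsI)
    show "0 \<le> shift m v k" for k
      using cotestsD(1)[OF vc, of k] v(2) by (auto simp: shift_def unit_vector_def)
    show "shift m v k = 0" if "k \<notin> W" for k
      using that m cotestsD(2)[OF vc that] by (auto simp: shift_def unit_vector_def indicator_def W_def)
    fix z assume z: "z \<in> elems (discrete_pcs X)"
    have "pairing W (promotion z) (shift m v) + ennreal (promotion z m) \<le> 1 + 1 * ennreal (promotion z m)"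
      unfolding eq[OF z] using cotestsD(3)[OF vc z] z
      by (intro add_mono mult_right_mono) (auto simp: elems_discrete)
    then show "pairing W (promotion z) (shift m v) \<le> 1"
      by (simp add: add.commute[of _ "ennreal (promotion z m)"] ennreal_add_left_cancel_le)
  next
    fix z assume z: "z \<in> discrete_total X"
    then have "z \<in> elems (discrete_pcs X)" using total_subset_elems by blast
    from eq[OF this] z v(1) have
      "ennreal (promotion z m) + pairing W (promotion z) (shift m v) = ennreal (promotion z m) + 1"
      by (simp add: total_discrete strict_cotests_iff add.commute)
    then show "pairing W (promotion z) (shift m v) = 1"
      by (simp add: ennreal_add_left_cancel)
  qed
qed

text \<open>Shifting at \<open>m\<close> needs weight 1 there. The unit vector at the empty multiset
  has it, and each shift at \<open>m\<close> passes a unit on to every \<open>m + {a}\<close>, where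
  the old weight was nonnegative.\<close>

lemma strict_cotest_above_one:
  assumes "m \<in> W"
  shows "\<exists>v\<in>strict_cotests. 1 \<le> v m"
  using assms
proof (induction m)
  case empty
  then show ?case
    using unit_vector_empty_strict by (intro bexI[of _ "unit_vector {#}"]) (auto simp: unit_vector_def)
next
  case (add a m)
  then have m: "m \<in> W" and a: "a \<in> X" by (auto simp: W_def)
  with add.IH obtain v where v: "v \<in> strict_cotests" "1 \<le> v m" by blast
  then have "0 \<le> v (add_mset a m)" using cotestsD(1) by (simp add: strict_cotests_iff)
  then have "1 \<le> shift m v (add_mset a m)"
    using a by (simp add: shift_def unit_vector_def indicator_def)
  with shift_strict_cotest[OF m v] show ?case by blast
qed

text \<open>A total element pairs to 1 both with a strict test and with its shift at
  \<open>m\<close>; cancelling these two values in \<open>pairing_shift\<close> leaves the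
  consistency equation. The unit vector at the empty multiset gives the normalisation.\<close>

lemma totalX_consistent:
  assumes u: "u \<in> totalX"
  shows "exchangeable_moments X u"
proof
  have nonneg: "\<And>m. 0 \<le> u m" and pair: "\<And>v. v \<in> strict_cotests \<Longrightarrow> pairing W u v = 1"
    using u by (auto simp: totalX_iff elems_bangX_iff)
  show "0 \<le> u m" for m by (rule nonneg)
  show "u {#} = 1"
    using pair[OF unit_vector_empty_strict] by (simp add: pairing_unit_vector)
  fix m assume "set_mset m \<subseteq> X"
  then have m: "m \<in> W" by (simp add: W_def)
  then obtain v where v: "v \<in> strict_cotests" "1 \<le> v m" using strict_cotest_above_one by blast
  have "\<And>k. 0 \<le> v k" using v(1) cotestsD(1) by (simp add: strict_cotests_iff)
  from pairing_shift[where v=v and x=u, OF m this v(2) nonneg]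
  have "1 + ennreal (u m) = 1 + (\<integral>\<^sup>+a. ennreal (u (add_mset a m)) \<partial>count_space X)"
    by (simp add: pair v(1) shift_strict_cotest[OF m v])
  then show "(\<integral>\<^sup>+a. ennreal (u (add_mset a m)) \<partial>count_space X) = ennreal (u m)"
    by (simp add: ennreal_add_left_cancel)
qed

section \<open>Mixtures of promotions as total elements\<close>

lemma density_vector_total:
  assumes r: "r \<in> space G"
  shows "density_vector r \<in> discrete_total X"
proof -
  interpret prob_space r using r by (simp add: space_prob_algebra)
  have sets_r: "sets r = sets (count_space X)" using r by (simp add: space_prob_algebra)
  have "space r = X" using sets_eq_imp_space_eq[OF sets_r] by simp
  then have "(\<integral>\<^sup>+a. ennreal (density_vector r a) \<partial>count_space X) = 1"
    using emeasure_eq_density[OF r, of X] emeasure_space_1 by simp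
  moreover have "density_vector r a = 0" if "a \<notin> X" for a
    using that by (simp add: density_vector_def sets_r measure_notin_sets)
  ultimately show ?thesis
    using density_vector_bounds[OF r] by (simp add: total_discrete)
qed

lemma measurable_pairing_promotion:
  "(\<lambda>r. pairing W (promotion (density_vector r)) v) \<in> borel_measurable G"
  unfolding pairing_nn_integral using countable_W by (intro measurable_nn_integral_count) simp_all

lemma ennreal_moments:
  assumes "\<mu> \<in> points (measures_icone G)"
  shows "ennreal (moments \<mu> m) = (\<integral>\<^sup>+r. ennreal (promotion (density_vector r) m) \<partial>\<mu>)"
proof -
  interpret finite_measure \<mu> using assms by simp
  have sets: "sets \<mu> = sets G" using assms by simp
  note [simp] = sets_eq_imp_space_eq[OF sets] measurable_cong_sets[OF sets refl]
  have "integrable \<mu> (\<lambda>r. promotion (density_vector r) m)"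
    using promotion_density_bounds by (intro integrable_const_bound[where B=1]) auto
  then show ?thesis
    unfolding moments_def using promotion_density_bounds
    by (intro nn_integral_eq_integral[symmetric]) auto
qed

lemma moments_nonneg:
  assumes "\<mu> \<in> points (measures_icone G)"
  shows "0 \<le> moments \<mu> m"
  unfolding moments_def
proof (rule integral_nonneg_AE, rule AE_I2)
  fix r assume "r \<in> space \<mu>"
  then have "r \<in> space G" using assms sets_eq_imp_space_eq[of \<mu> G] by simp
  then show "0 \<le> promotion (density_vector r) m" by (rule promotion_density_bounds)
qed

text \<open>The countable sum over the web is exchanged with the integral against
  \<open>\<mu>\<close>, so a test of a mixture is the average of its values at the
  promotions.\<close>

lemma pairing_moments:
  assumes \<mu>: "\<mu> \<in> points (measures_icone G)" and v: "\<And>m. 0 \<le> v m"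
  shows "pairing W (moments \<mu>) v = (\<integral>\<^sup>+r. pairing W (promotion (density_vector r)) v \<partial>\<mu>)"
proof -
  interpret finite_measure \<mu> using \<mu> by simp
  have sets: "sets \<mu> = sets G" using \<mu> by simp
  note [simp] = sets_eq_imp_space_eq[OF sets] measurable_cong_sets[OF sets refl]
  have "ennreal (moments \<mu> m * v m) = (\<integral>\<^sup>+r. ennreal (promotion (density_vector r) m * v m) \<partial>\<mu>)" for m
  proof -
    have "ennreal (moments \<mu> m * v m) = (\<integral>\<^sup>+r. ennreal (promotion (density_vector r) m) * ennreal (v m) \<partial>\<mu>)"
      using v moments_nonneg[OF \<mu>] by (simp add: ennreal_mult ennreal_moments[OF \<mu>] nn_integral_multc)
    also have "\<dots> = (\<integral>\<^sup>+r. ennreal (promotion (density_vector r) m * v m) \<partial>\<mu>)"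
      using v promotion_density_bounds by (intro nn_integral_cong) (simp add: ennreal_mult)
    finally show ?thesis .
  qed
  then have "pairing W (moments \<mu>) v =
      (\<integral>\<^sup>+m. (\<integral>\<^sup>+r. ennreal (promotion (density_vector r) m * v m) \<partial>\<mu>) \<partial>count_space W)"
    by (simp add: pairing_nn_integral)
  also have "\<dots> = (\<integral>\<^sup>+r. pairing W (promotion (density_vector r)) v \<partial>\<mu>)"
    unfolding pairing_nn_integral using countable_W sigma_finite_measure_axioms
    by (intro nn_integral_count_swap[symmetric]) simp_all
  finally show ?thesis .
qed

lemma moments_off_web:
  assumes "\<mu> \<in> points (measures_icone G)" "m \<notin> W"
  shows "moments \<mu> m = 0"
proof -
  have "promotion (density_vector r) m = 0" if "r \<in> space \<mu>" for r
  proof (rule promotion_off_web[OF _ assms(2)])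
    have "r \<in> space G" using that assms(1) sets_eq_imp_space_eq[of \<mu> G] by simp
    then show "density_vector r a = 0" if "a \<notin> X" for a
      using density_vector_total that by (simp add: total_discrete)
  qed
  then have "moments \<mu> m = (\<integral>r. 0 \<partial>\<mu>)"
    unfolding moments_def by (rule Bochner_Integration.integral_cong[OF refl])
  then show ?thesis by simp
qed

lemma moments_empty:
  assumes "\<mu> \<in> points (measures_icone G)"
  shows "moments \<mu> {#} = measure \<mu> (space G)"
  using assms sets_eq_imp_space_eq[of \<mu> G] by (simp add: moments_def)

lemma pairing_moments_le:
  assumes \<mu>: "\<mu> \<in> points (measures_icone G)" and v: "v \<in> cotests"
  shows "pairing W (moments \<mu>) v \<le> ennreal (measure \<mu> (space G))"
proof -
  have sp: "space \<mu> = space G" using \<mu> sets_eq_imp_space_eq[of \<mu> G] by simp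
  have "pairing W (moments \<mu>) v \<le> (\<integral>\<^sup>+r. 1 \<partial>\<mu>)"
    unfolding pairing_moments[OF \<mu> cotestsD(1)[OF v]]
    using density_vector_total total_subset_elems cotestsD(3)[OF v] by (intro nn_integral_mono) (auto simp: sp)
  then show ?thesis using \<mu> by (simp add: sp finite_measure.emeasure_eq_measure)
qed

lemma moments_totalX:
  assumes "prob_space \<mu>" and sets: "sets \<mu> = sets G"
  shows "moments \<mu> \<in> totalX"
proof -
  interpret prob_space \<mu> by fact
  have pt: "\<mu> \<in> points (measures_icone G)" using sets finite_measure_axioms by simp
  have sp: "space \<mu> = space G" by (rule sets_eq_imp_space_eq[OF sets])
  have "measure \<mu> (space G) = 1" using prob_space sp by simp
  then have "pairing W (moments \<mu>) v \<le> 1" if "v \<in> cotests" for v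
    using pairing_moments_le[OF pt that] by simp
  moreover have "pairing W (moments \<mu>) v = 1" if v: "v \<in> strict_cotests" for v
  proof -
    have "pairing W (moments \<mu>) v = (\<integral>\<^sup>+r. pairing W (promotion (density_vector r)) v \<partial>\<mu>)"
      using v cotestsD(1) by (intro pairing_moments[OF pt]) (simp add: strict_cotests_iff)
    also have "\<dots> = (\<integral>\<^sup>+r. 1 \<partial>\<mu>)"
      using v density_vector_total by (intro nn_integral_cong) (simp add: sp strict_cotests_iff)
    finally show ?thesis by (simp add: emeasure_space_1)
  qed
  ultimately show ?thesis
    using moments_nonneg[OF pt] moments_off_web[OF pt] by (simp add: totalX_iff elems_bangX_iff)
qed

theorem totalX_eq_moments: "totalX = {moments \<mu> |\<mu>. prob_space \<mu> \<and> sets \<mu> = sets G}"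
proof (intro equalityI subsetI)
  fix u assume u: "u \<in> totalX"
  interpret exchangeable_moments X u by (rule totalX_consistent[OF u])
  obtain \<mu> where \<mu>: "prob_space \<mu>" "sets \<mu> = sets G" "\<And>m. set_mset m \<subseteq> X \<Longrightarrow> moments \<mu> m = u m"
    using moment_representation by blast
  interpret prob_space \<mu> by fact
  have "\<mu> \<in> points (measures_icone G)" using \<mu>(2) finite_measure_axioms by simp
  \<comment> \<open>The representation speaks of multisets over \<open>X\<close> only; at the others
    both vectors are 0.\<close>
  then have "moments \<mu> m = u m" for m
    using \<mu>(3) moments_off_web u by (cases "m \<in> W") (auto simp: W_def totalX_iff elems_bangX_iff)
  then have "u = moments \<mu>" by (simp add: fun_eq_iff)
  with \<mu>(1,2) show "u \<in> {moments \<mu> |\<mu>. prob_space \<mu> \<and> sets \<mu> = sets G}" by auto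
qed (auto intro: moments_totalX)

section \<open>The totality cone as the image of the finite measures\<close>

lemma total_cone_simps [simp]:
  "cplus total_cone = (\<lambda>x y m. x m + y m)"
  "czero total_cone = (\<lambda>m. 0)"
  "cscale total_cone = (\<lambda>r x m. r * x m)"
  "points total_cone = insert (\<lambda>m. 0) {(\<lambda>m. r * u m) |r u. 0 \<le> r \<and> u \<in> totalX}"
  "cnorm total_cone = (\<lambda>x. Inf {r. 0 < r \<and> (\<exists>u\<in>elems bangX. x = (\<lambda>m. r * u m))})"
  "tests total_cone = (\<lambda>Y. {(\<lambda>s x. enn2real (pairing W x v)) |v. v \<in> cotests})"
  by (simp_all add: totality_cone_def pcs_icone_def web_bangX)

lemma moments_add:
  assumes "\<mu> \<in> points (measures_icone G)" "\<nu> \<in> points (measures_icone G)"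
  shows "moments (add_measure \<mu> \<nu>) m = moments \<mu> m + moments \<nu> m"
proof -
  have "add_measure \<mu> \<nu> \<in> points (measures_icone G)"
    using assms by (simp add: finite_measure_add_measure)
  then have "ennreal (moments (add_measure \<mu> \<nu>) m) = ennreal (moments \<mu> m + moments \<nu> m)"
    using assms moments_nonneg[OF assms(1)] moments_nonneg[OF assms(2)]
    by (simp only: ennreal_moments ennreal_plus nn_integral_add_measure[OF assms] measurable_promotion
        measurable_compose[OF measurable_promotion measurable_ennreal])
  then show ?thesis
    by (rule ennreal_inj[THEN iffD1, rotated 2])
      (intro add_nonneg_nonneg moments_nonneg assms \<open>add_measure \<mu> \<nu> \<in> points (measures_icone G)\<close>)+
qed

lemma moments_scale:
  assumes \<mu>: "\<mu> \<in> points (measures_icone G)" and r: "0 \<le> r"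
  shows "moments (scale_measure (ennreal r) \<mu>) m = r * moments \<mu> m"
proof -
  have s: "scale_measure (ennreal r) \<mu> \<in> points (measures_icone G)"
    using \<mu> by (simp add: finite_measure_scale_measure)
  have sets: "sets \<mu> = sets G" using \<mu> by simp
  have "ennreal (moments (scale_measure (ennreal r) \<mu>) m) = ennreal (r * moments \<mu> m)"
    unfolding ennreal_moments[OF s]
    using r moments_nonneg[OF \<mu>] by (subst nn_integral_scale_measure)
      (simp_all add: measurable_cong_sets[OF sets refl] ennreal_mult ennreal_moments[OF \<mu>])
  then show ?thesis
    using r moments_nonneg[OF \<mu>, of m] moments_nonneg[OF s, of m] by simp
qed

lemma moments_null: "moments (null_measure G) m = 0"
proof -
  have "null_measure G \<in> points (measures_icone G)" by (simp add: finite_measure_null_measure)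
  from ennreal_moments[OF this, of m] moments_nonneg[OF this, of m] show ?thesis
    by (simp add: nn_integral_null_measure)
qed

text \<open>The norm is the gauge of all elements of the exponential, not only of the total ones.
  Tests of \<open>moments \<mu>\<close> are bounded by the mass, so every larger \<open>r\<close> is
  admissible; the test at the empty multiset reads off exactly the mass, so no smaller
  \<open>r\<close> is.\<close>

lemma norm_moments:
  assumes \<mu>: "\<mu> \<in> points (measures_icone G)"
  shows "cnorm total_cone (moments \<mu>) = measure \<mu> (space G)"
proof -
  let ?l = "measure \<mu> (space G)"
  let ?R = "{r. 0 < r \<and> (\<exists>u\<in>elems bangX. moments \<mu> = (\<lambda>m. r * u m))}"
  \<comment> \<open>The inequality is strict because the mass may be 0 and the gauge admits only
    positive factors.\<close>
  have above: "r \<in> ?R" if r: "?l < r" for r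
  proof -
    have r0: "0 < r" using r measure_nonneg[of \<mu> "space G"] by linarith
    have "(\<lambda>m. moments \<mu> m / r) \<in> elems bangX"
      unfolding elems_bangX_iff
    proof (intro conjI allI impI ballI)
      fix v assume v: "v \<in> cotests"
      have "ennreal (moments \<mu> m / r * v m) = ennreal (moments \<mu> m * v m) * ennreal (1 / r)" for m
        using r0 moments_nonneg[OF \<mu>, of m] cotestsD(1)[OF v, of m] by (simp flip: ennreal_mult)
      then have "pairing W (\<lambda>m. moments \<mu> m / r) v = pairing W (moments \<mu>) v * ennreal (1 / r)"
        by (simp add: pairing_nn_integral nn_integral_multc)
      also have "\<dots> \<le> ennreal ?l * ennreal (1 / r)"
        by (intro mult_right_mono pairing_moments_le[OF \<mu> v]) simp
      also have "\<dots> = ennreal (?l / r)" using r0 by (simp flip: ennreal_mult)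
      also have "\<dots> \<le> 1" using r r0 by (simp add: ennreal_le_1)
      finally show "pairing W (\<lambda>m. moments \<mu> m / r) v \<le> 1" .
    qed (use r0 moments_nonneg[OF \<mu>] moments_off_web[OF \<mu>] in simp_all)
    then show ?thesis using r0 by (auto intro!: bexI[of _ "\<lambda>m. moments \<mu> m / r"])
  qed
  have below: "?l \<le> r" if r: "r \<in> ?R" for r
  proof -
    obtain u where "0 < r" and u: "u \<in> elems bangX" and eq: "moments \<mu> = (\<lambda>m. r * u m)" using r by blast
    have "pairing W u (unit_vector {#}) \<le> 1"
      using u unit_vector_cotest[of "{#}"] by (simp add: elems_bangX_iff)
    then have "u {#} \<le> 1" by (simp add: pairing_unit_vector ennreal_le_1)
    then have "r * u {#} \<le> r * 1" using less_imp_le[OF \<open>0 < r\<close>] by (rule mult_left_mono)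
    moreover have "r * u {#} = ?l" using moments_empty[OF \<mu>] unfolding eq .
    ultimately show ?thesis by linarith
  qed
  have "Inf ?R = ?l"
  proof (rule antisym)
    show "Inf ?R \<le> ?l"
    proof (rule dense_ge)
      fix r assume "?l < r"
      show "Inf ?R \<le> r" by (rule cInf_lower[OF above[OF \<open>?l < r\<close>] bdd_belowI[OF below]])
    qed
    have "?l + 1 \<in> ?R" by (rule above) simp
    then show "?l \<le> Inf ?R" by (intro cInf_greatest[OF _ below]) blast
  qed
  then show ?thesis by simp
qed

text \<open>A nonzero measure is its mass times a probability measure. The zero measure cannot be
  normalised, but its moments are the zero vector.\<close>

lemma moments_in_total_cone:
  assumes \<mu>: "\<mu> \<in> points (measures_icone G)"
  shows "moments \<mu> \<in> points total_cone"
proof (cases "measure \<mu> (space G) = 0")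
  case True
  have sp: "space \<mu> = space G" using \<mu> sets_eq_imp_space_eq[of \<mu> G] by simp
  interpret C: cone "measures_icone G" by (rule cone_measures)
  have "\<mu> = czero (measures_icone G)" using True by (intro C.norm_eq_zero \<mu>) simp
  then have "moments \<mu> = (\<lambda>m. 0)" by (simp add: moments_null fun_eq_iff)
  then show ?thesis by simp
next
  case False
  define c where "c = measure \<mu> (space G)"
  have c: "0 < c" using False measure_nonneg[of \<mu> "space G"] unfolding c_def by linarith
  let ?\<nu> = "scale_measure (ennreal (1 / c)) \<mu>"
  interpret finite_measure \<mu> using \<mu> by simp
  have sp: "space \<mu> = space G" using \<mu> sets_eq_imp_space_eq[of \<mu> G] by simp
  have "prob_space ?\<nu>"
    using c by (intro prob_spaceI)
      (simp add: space_scale_measure sp emeasure_eq_measure c_def[symmetric] flip: ennreal_mult)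
  then have total: "moments ?\<nu> \<in> totalX" using \<mu> by (intro moments_totalX) simp_all
  have eq: "moments \<mu> = (\<lambda>m. c * moments ?\<nu> m)"
    using c by (simp add: moments_scale[OF \<mu>])
  have "moments \<mu> \<in> {(\<lambda>m. r * u m) |r u. 0 \<le> r \<and> u \<in> totalX}"
    by (intro CollectI exI[of _ c] exI[of _ "moments ?\<nu>"] conjI eq total less_imp_le[OF c])
  then show ?thesis by simp
qed

lemma moments_bij: "bij_betw moments (points (measures_icone G)) (points total_cone)"
  unfolding bij_betw_def
proof
  show "inj_on moments (points (measures_icone G))"
    by (rule inj_onI) (auto intro: moments_inject)
  show "moments ` points (measures_icone G) = points total_cone"
  proof (intro equalityI subsetI)
    fix x assume "x \<in> points total_cone"
    then consider "x = (\<lambda>m. 0)" | r u where "0 \<le> r" "u \<in> totalX" "x = (\<lambda>m. r * u m)" by auto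
    then show "x \<in> moments ` points (measures_icone G)"
    proof cases
      case 1
      then have "x = moments (null_measure G)" by (simp add: moments_null fun_eq_iff)
      then show ?thesis by (auto intro!: imageI simp: finite_measure_null_measure)
    next
      case 2
      then obtain \<mu> where \<mu>: "prob_space \<mu>" "sets \<mu> = sets G" "u = moments \<mu>"
        by (auto simp: totalX_eq_moments)
      then have pt: "\<mu> \<in> points (measures_icone G)" by (simp add: prob_space_def)
      then have "x = moments (scale_measure (ennreal r) \<mu>)"
        using 2 \<mu> by (simp add: moments_scale[OF pt] fun_eq_iff)
      then show ?thesis using pt by (auto intro!: imageI simp: finite_measure_scale_measure)
    qed
  qed (auto intro: moments_in_total_cone simp del: total_cone_simps)
qed

sublocale moments: cone_bijection "measures_icone G" total_cone moments
proof (intro cone_bijection.intro cone_measures cone_bijection_axioms.intro moments_bij)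
  show "moments (czero (measures_icone G)) = czero total_cone"
    by (simp add: moments_null fun_eq_iff)
  show "moments (cplus (measures_icone G) \<mu> \<nu>) = cplus total_cone (moments \<mu>) (moments \<nu>)"
    if "\<mu> \<in> points (measures_icone G)" "\<nu> \<in> points (measures_icone G)" for \<mu> \<nu>
    using moments_add[OF that] by (simp add: fun_eq_iff)
  show "moments (cscale (measures_icone G) r \<mu>) = cscale total_cone r (moments \<mu>)"
    if "0 \<le> r" "\<mu> \<in> points (measures_icone G)" for r \<mu>
    using moments_scale[OF that(2,1)] by (simp add: fun_eq_iff)
  show "cnorm total_cone (moments \<mu>) = cnorm (measures_icone G) \<mu>"
    if "\<mu> \<in> points (measures_icone G)" for \<mu>
    using norm_moments[OF that] by (simp only: measures_icone_simps)
qed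

end

section \<open>The isomorphism\<close>

context countable_discrete begin

abbreviation pairing_functional :: "('a multiset \<Rightarrow> real) \<Rightarrow> ('a multiset \<Rightarrow> real) \<Rightarrow> real" where
  "pairing_functional v \<equiv> \<lambda>x. enn2real (pairing W x v)"

abbreviation finite_G :: "'a measure measure set" where
  "finite_G \<equiv> points (measures_icone G)"

lemma total_cone_pointE:
  assumes "x \<in> points total_cone"
  obtains \<mu> where "\<mu> \<in> finite_G" "x = moments \<mu>"
  using assms unfolding moments.points_Q by blast

lemma total_cone_nonneg: "x \<in> points total_cone \<Longrightarrow> 0 \<le> x m"
  by (erule total_cone_pointE) (simp only: moments_nonneg)

lemma pairing_le_norm:
  assumes "x \<in> points total_cone" "v \<in> cotests"
  shows "pairing W x v \<le> ennreal (cnorm total_cone x)"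
  using assms(1) by (rule total_cone_pointE) (simp only: norm_moments pairing_moments_le assms(2))

text \<open>The bound by the norm makes the pairing finite, so \<open>enn2real\<close> does not turn
  an infinite value into 0 and identities can be verified in \<open>ennreal\<close>.\<close>

lemma ennreal_pairing_functional:
  assumes "x \<in> points total_cone" "v \<in> cotests"
  shows "ennreal (pairing_functional v x) = pairing W x v"
  using pairing_le_norm[OF assms] by (intro ennreal_enn2real) (auto simp: less_top[symmetric] top_unique)

lemma pairing_functional_unit_vector:
  assumes "m \<in> W" "0 \<le> x m"
  shows "pairing_functional (unit_vector m) x = x m"
  using assms by (simp add: pairing_unit_vector)

lemma total_cone_off_web:
  assumes "x \<in> points total_cone" "m \<notin> W"
  shows "x m = 0"
  using assms(1) by (rule total_cone_pointE) (simp only: moments_off_web[OF _ assms(2)])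

lemma norm_total_cone: "x \<in> points total_cone \<Longrightarrow> cnorm total_cone x = x {#}"
  by (erule total_cone_pointE) (simp only: norm_moments moments_empty)

lemma pairing_add:
  assumes "\<And>m. 0 \<le> x m" "\<And>m. 0 \<le> y m" "\<And>m. 0 \<le> v m"
  shows "pairing W (\<lambda>m. x m + y m) v = pairing W x v + pairing W y v"
  using assms unfolding pairing_nn_integral
  by (subst nn_integral_add[symmetric]) (simp_all add: distrib_right)

lemma pairing_scale:
  assumes "0 \<le> r" "\<And>m. 0 \<le> x m" "\<And>m. 0 \<le> v m"
  shows "pairing W (\<lambda>m. r * x m) v = ennreal r * pairing W x v"
  using assms unfolding pairing_nn_integral
  by (subst nn_integral_cmult[symmetric]) (simp_all add: mult.assoc ennreal_mult)

text \<open>The norm is the coefficient at the empty multiset, hence additive, and it is the pairing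
  with a unit vector, hence a test. Unit vectors at the other multisets separate points.\<close>

lemma additive_cone_total: "additive_cone total_cone (pairing_functional ` cotests)"
proof -
  interpret T: cone total_cone by (rule moments.cone_image)
  interpret M: additive_cone "measures_icone G" "measure_functionals G" by (rule additive_cone_measures)
  show ?thesis
  proof (intro additive_cone.intro additive_cone_axioms.intro T.cone_axioms, goal_cases)
    case (1 x y)
    from T.plus_closed[OF 1] 1 show ?case by (simp only: norm_total_cone) simp
  next
    case (2 S x)
    \<comment> \<open>Continuity of the norm along chains is pulled back to the finite measures,
      where it is convergence of total masses.\<close>
    let ?S = "\<lambda>n. moments.inv_map (S n)"
    have pts: "S n \<in> points total_cone" "x \<in> points total_cone" for n
      using 2 by (auto simp only: cone_chain_def cone_lub_def)
    have g: "?S n \<in> finite_G" "moments.inv_map x \<in> finite_G" for n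
      by (intro moments.inverse_in pts)+
    have eqs: "(\<lambda>n. moments (?S n)) = S" "moments (moments.inv_map x) = x"
      by (simp_all only: moments.map_inverse pts)
    have "cone_chain (measures_icone G) ?S"
      using 2(1) moments.map_chain[of ?S] g by (simp only: eqs)
    moreover have "cone_lub (measures_icone G) ?S (moments.inv_map x)"
      using 2(2) moments.map_lub[of ?S "moments.inv_map x"] g by (simp only: eqs)
    ultimately have "(\<lambda>n. cnorm (measures_icone G) (?S n)) \<longlonglongrightarrow> cnorm (measures_icone G) (moments.inv_map x)"
      by (rule M.norm_lub)
    moreover have "cnorm total_cone y = cnorm (measures_icone G) (moments.inv_map y)" if "y \<in> points total_cone" for y
      using moments.map_norm[OF moments.inverse_in[OF that]] by (simp only: moments.map_inverse[OF that])
    ultimately show ?case by (simp only: pts)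
  next
    case 3
    show ?case by (simp add: image_image Setcompr_eq_image)
  next
    case (4 l)
    then show ?case by (auto simp: pairing_nn_integral)
  next
    case (5 l x y)
    then obtain v where v: "v \<in> cotests" "l = pairing_functional v" by blast
    have "ennreal (l (cplus total_cone x y)) = ennreal (l x) + ennreal (l y)"
      using 5(2,3) T.plus_closed[OF 5(2,3)] v(1) unfolding v(2)
      by (simp only: ennreal_pairing_functional)
        (simp add: pairing_add total_cone_nonneg cotestsD(1) del: total_cone_simps(4,5))
    also have "\<dots> = ennreal (l x + l y)" by (simp add: v(2))
    finally show ?case by (simp add: v(2) del: ennreal_plus)
  next
    case (6 l r x)
    then obtain v where v: "v \<in> cotests" "l = pairing_functional v" by blast
    have "ennreal (l (cscale total_cone r x)) = ennreal r * ennreal (l x)"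
      using 6(2,3) T.scale_closed[OF 6(2,3)] v(1) unfolding v(2)
      by (simp only: ennreal_pairing_functional)
        (simp add: pairing_scale total_cone_nonneg cotestsD(1) del: total_cone_simps(4,5))
    also have "\<dots> = ennreal (r * l x)" using 6(2) by (simp add: v(2) ennreal_mult)
    finally show ?case using 6(2) by (simp add: v(2))
  next
    case (7 l x)
    then show ?case by auto
  next
    case (8 l x)
    then obtain v where v: "v \<in> cotests" "l = pairing_functional v" by blast
    have "pairing_functional v x \<le> cnorm total_cone x"
      by (rule enn2real_leI[OF T.norm_nonneg[OF 8(2)] pairing_le_norm[OF 8(2) v(1)]])
    then show ?case by (simp only: v(2))
  next
    case (9 x y)
    show ?case
    proof
      fix m
      show "x m = y m"
      proof (cases "m \<in> W")
        case True
        have "pairing_functional (unit_vector m) x = pairing_functional (unit_vector m) y"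
          by (intro 9(3) imageI unit_vector_cotest True)
        then show ?thesis
          by (simp only: pairing_functional_unit_vector[OF True] total_cone_nonneg[OF 9(1)]
              total_cone_nonneg[OF 9(2)])
      next
        case False
        then show ?thesis by (simp only: total_cone_off_web[OF 9(1)] total_cone_off_web[OF 9(2)] not_False_eq_True)
      qed
    qed
  next
    case 10
    show ?case
    proof (intro bexI[of _ "pairing_functional (unit_vector {#})"] ballI)
      fix x assume "x \<in> points total_cone"
      then show "pairing_functional (unit_vector {#}) x = cnorm total_cone x"
        by (simp only: pairing_functional_unit_vector empty_in_W total_cone_nonneg norm_total_cone)
    qed (intro imageI unit_vector_cotest empty_in_W)
  qed
qed

section \<open>Measurable paths and integrals under the isomorphism\<close>

lemma moments_path:
  assumes path: "measurable_path M (measures_icone G) \<kappa>"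
  shows "measurable_path M total_cone (\<lambda>r. moments (\<kappa> r))"
proof -
  obtain B where "finite_kernel G M \<kappa>" and B: "\<forall>r\<in>space M. measure (\<kappa> r) (space G) \<le> B"
    using path unfolding measures_path_iff by blast
  then interpret finite_kernel G M \<kappa> by simp
  have pt: "\<kappa> r \<in> finite_G" if "r \<in> space M" for r
    using that by (simp add: sets_kernel finite_kernel)
  show ?thesis
    unfolding additive_cone.measurable_path_iff[OF additive_cone_total]
  proof (intro conjI ballI)
    show "(\<lambda>r. moments (\<kappa> r)) \<in> space M \<rightarrow> points total_cone"
      by (intro Pi_I moments_in_total_cone pt)
    show "\<exists>B. \<forall>r\<in>space M. cnorm total_cone (moments (\<kappa> r)) \<le> B"
    proof (intro exI ballI)
      fix r assume "r \<in> space M"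
      with B show "cnorm total_cone (moments (\<kappa> r)) \<le> B" by (simp only: norm_moments[OF pt])
    qed
    fix l assume "l \<in> pairing_functional ` cotests"
    then obtain v where v: "v \<in> cotests" "l = pairing_functional v" by blast
    \<comment> \<open>A test applied to \<open>moments (\<kappa> r)\<close> is the integral of one
      fixed function against the kernel, so it is measurable in \<open>r\<close>.\<close>
    have "(\<lambda>r. enn2real (\<integral>\<^sup>+s. pairing W (promotion (density_vector s)) v \<partial>\<kappa> r)) \<in> borel_measurable M"
      by (rule borel_measurable_enn2real[OF nn_integral_kernel[OF measurable_pairing_promotion, THEN conjunct1]])
    then show "(\<lambda>r. l (moments (\<kappa> r))) \<in> borel_measurable M"
      by (subst measurable_cong[where g="\<lambda>r. enn2real (\<integral>\<^sup>+s. pairing W (promotion (density_vector s)) v \<partial>\<kappa> r)"])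
        (simp_all only: v(2) pairing_moments[OF pt cotestsD(1)[OF v(1)]])
  qed
qed

text \<open>A test of moments is an integral over \<open>G\<close>, and integrating against a
  mixture is iterated integration.\<close>

lemma moments_mixture_integral:
  assumes M: "finite_measure M" and path: "measurable_path M (measures_icone G) \<kappa>"
  shows "has_cone_integral total_cone M (\<lambda>r. moments (\<kappa> r)) (moments (mixture G M \<kappa>))"
proof -
  have "finite_kernel G M \<kappa>" using path unfolding measures_path_iff by blast
  then interpret finite_kernel G M \<kappa> .
  have pt: "\<kappa> r \<in> finite_G" if "r \<in> space M" for r
    using that by (simp add: sets_kernel finite_kernel)
  have mix: "mixture G M \<kappa> \<in> finite_G"
    using measures_has_cone_integral_mixture[OF M path] by (simp only: has_cone_integral_def)
  show ?thesis
    unfolding has_cone_integral_def additive_cone.point_tests_eq[OF additive_cone_total]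
  proof (intro conjI ballI moments_in_total_cone mix)
    fix l assume "l \<in> pairing_functional ` cotests"
    then obtain v where v: "v \<in> cotests" "l = pairing_functional v" by blast
    let ?h = "\<lambda>s. pairing W (promotion (density_vector s)) v"
    have "ennreal (l (moments (mixture G M \<kappa>))) = (\<integral>\<^sup>+s. ?h s \<partial>mixture G M \<kappa>)"
      unfolding v(2) ennreal_pairing_functional[OF moments_in_total_cone[OF mix] v(1)]
      by (rule pairing_moments[OF mix cotestsD(1)[OF v(1)]])
    also have "\<dots> = (\<integral>\<^sup>+r. (\<integral>\<^sup>+s. ?h s \<partial>\<kappa> r) \<partial>M)"
      by (rule nn_integral_kernel[OF measurable_pairing_promotion, THEN conjunct2])
    also have "\<dots> = (\<integral>\<^sup>+r. ennreal (l (moments (\<kappa> r))) \<partial>M)"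
    proof (rule nn_integral_cong)
      fix r assume r: "r \<in> space M"
      show "(\<integral>\<^sup>+s. ?h s \<partial>\<kappa> r) = ennreal (l (moments (\<kappa> r)))"
        unfolding v(2) ennreal_pairing_functional[OF moments_in_total_cone[OF pt[OF r]] v(1)]
        by (rule pairing_moments[OF pt[OF r] cotestsD(1)[OF v(1)], symmetric])
    qed
    finally show "ennreal (l (moments (mixture G M \<kappa>))) = (\<integral>\<^sup>+r. ennreal (l (moments (\<kappa> r))) \<partial>M)" .
  qed
qed

text \<open>Unit vectors are tests, so every coefficient of the path, that is every moment of the
  inverse path, is measurable; \<open>finite_kernel_of_moments\<close> upgrades this to a kernel.
  The bound carries over because norms agree.\<close>

lemma inverse_moments_path:
  assumes path: "measurable_path M total_cone \<gamma>"
  shows "measurable_path M (measures_icone G) (\<lambda>r. moments.inv_map (\<gamma> r))"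
proof -
  let ?\<kappa> = "\<lambda>r. moments.inv_map (\<gamma> r)"
  have \<gamma>: "\<gamma> r \<in> points total_cone" if "r \<in> space M" for r
    using path that unfolding measurable_path_def by blast
  have \<kappa>: "?\<kappa> r \<in> finite_G" "moments (?\<kappa> r) = \<gamma> r" if "r \<in> space M" for r
    using moments.inverse_in[OF \<gamma>[OF that]] moments.map_inverse[OF \<gamma>[OF that]] .
  have tests: "(\<lambda>r. l (\<gamma> r)) \<in> borel_measurable M" if "l \<in> pairing_functional ` cotests" for l
    using path[unfolded additive_cone.measurable_path_iff[OF additive_cone_total], THEN conjunct2, THEN conjunct2] that
    by (rule bspec)
  have "moment_measurable X M ?\<kappa>"
  proof (intro moment_measurable.intro countable_discrete_axioms moment_measurable_axioms.intro)
    fix m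
    have "(\<lambda>r. \<gamma> r m) \<in> borel_measurable M"
    proof (cases "m \<in> W")
      case True
      have "(\<lambda>r. pairing_functional (unit_vector m) (\<gamma> r)) \<in> borel_measurable M"
        by (intro tests imageI unit_vector_cotest True)
      then show ?thesis
        by (subst measurable_cong[where g="\<lambda>r. pairing_functional (unit_vector m) (\<gamma> r)"])
          (simp_all only: pairing_functional_unit_vector[OF True total_cone_nonneg[OF \<gamma>]])
    next
      case False
      have "\<gamma> r m = 0" if "r \<in> space M" for r by (rule total_cone_off_web[OF \<gamma>[OF that] False])
      then show ?thesis
        by (subst measurable_cong[where g="\<lambda>r. 0"]) (simp_all only: borel_measurable_const)
    qed
    then show "(\<lambda>r. moments (?\<kappa> r) m) \<in> borel_measurable M"
      by (subst measurable_cong[where g="\<lambda>r. \<gamma> r m"]) (simp_all only: \<kappa>(2))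
  qed (use \<kappa>(1) in simp_all)
  then interpret moment_measurable X M ?\<kappa> .
  obtain B where B: "\<And>r. r \<in> space M \<Longrightarrow> cnorm total_cone (\<gamma> r) \<le> B"
    using path unfolding measurable_path_def by blast
  have "measure (?\<kappa> r) (space G) \<le> B" if "r \<in> space M" for r
    using B[OF that] norm_moments[OF \<kappa>(1)[OF that]] by (simp only: \<kappa>(2)[OF that])
  then show ?thesis
    unfolding measures_path_iff using finite_kernel_of_moments by blast
qed

text \<open>Integrability in the totality cone comes from the measures: pull the path back, form the
  mixture and take its moments.\<close>

lemma total_cone_integral:
  assumes M: "finite_measure M" and path: "measurable_path M total_cone \<gamma>"
  shows "has_cone_integral total_cone M \<gamma> (moments (mixture G M (\<lambda>r. moments.inv_map (\<gamma> r))))"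
proof -
  let ?x = "moments (mixture G M (\<lambda>r. moments.inv_map (\<gamma> r)))"
  have "moments (moments.inv_map (\<gamma> r)) = \<gamma> r" if "r \<in> space M" for r
    using path that unfolding measurable_path_def by (intro moments.map_inverse) blast
  then have "(\<integral>\<^sup>+r. ennreal (l (moments (moments.inv_map (\<gamma> r)))) \<partial>M) = (\<integral>\<^sup>+r. ennreal (l (\<gamma> r)) \<partial>M)" for l
    by (intro nn_integral_cong) (simp only:)
  from moments_mixture_integral[OF M inverse_moments_path[OF path], unfolded has_cone_integral_def this]
  show ?thesis unfolding has_cone_integral_def .
qed

lemma integrable_cone_total: "integrable_cone total_cone"
  unfolding integrable_cone_def integrable_cone_axioms_def
  using additive_cone.measurable_cone[OF additive_cone_total] total_cone_integral by blast

lemma icones_hom_moments: "icones_hom (measures_icone G) total_cone moments"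
  unfolding icones_hom_def
proof (intro conjI ballI allI impI moments.map_linear_continuous moments.map_op_norm moments_path)
  fix M :: "real measure" and \<kappa>
  assume "finite_measure M \<and> measurable_path M (measures_icone G) \<kappa>"
  then have M: "finite_measure M" and path: "measurable_path M (measures_icone G) \<kappa>" by simp_all
  show "moments (cone_integral (measures_icone G) M \<kappa>) = cone_integral total_cone M (\<lambda>r. moments (\<kappa> r))"
    by (simp only: additive_cone.cone_integral_eqI[OF additive_cone_measures measures_has_cone_integral_mixture[OF M path]]
        additive_cone.cone_integral_eqI[OF additive_cone_total moments_mixture_integral[OF M path]])
qed

text \<open>The integral in the totality cone was computed as the moments of the mixture of the
  inverse path, so the inverse map returns this mixture.\<close>

lemma icones_hom_inverse_moments: "icones_hom total_cone (measures_icone G) moments.inv_map"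
  unfolding icones_hom_def
proof (intro conjI ballI allI impI moments.inverse_linear_continuous moments.inverse_op_norm inverse_moments_path)
  fix M :: "real measure" and \<gamma>
  assume "finite_measure M \<and> measurable_path M total_cone \<gamma>"
  then have M: "finite_measure M" and path: "measurable_path M total_cone \<gamma>" by simp_all
  note mix = measures_has_cone_integral_mixture[OF M inverse_moments_path[OF path]]
  have "mixture G M (\<lambda>r. moments.inv_map (\<gamma> r)) \<in> finite_G"
    using mix by (simp only: has_cone_integral_def)
  then show "moments.inv_map (cone_integral total_cone M \<gamma>) = cone_integral (measures_icone G) M (\<lambda>r. moments.inv_map (\<gamma> r))"
    by (simp only: additive_cone.cone_integral_eqI[OF additive_cone_total total_cone_integral[OF M path]]
        additive_cone.cone_integral_eqI[OF additive_cone_measures mix] moments.inverse_map)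
qed

lemma total_cone_isomorphic: "icones_isomorphic total_cone (measures_icone G)"
  unfolding icones_isomorphic_def
  using integrable_cone_total integrable_cone_measures icones_hom_moments icones_hom_inverse_moments
    moments.map_inverse moments.inverse_map by blast

section \<open>Mixtures of promotions as integrals in the ambient cone\<close>

lemma point_tests_bangX: "point_tests (pcs_icone bangX) = pairing_functional ` cotests"
  by (auto simp: point_tests_def pcs_icone_def web_bangX)

lemma pcs_icone_pointD:
  assumes "x \<in> points (pcs_icone bangX)"
  shows "0 \<le> x m" "m \<notin> W \<Longrightarrow> x m = 0"
  using assms by (auto simp: pcs_icone_def elems_bangX_iff)

text \<open>This integral is taken in the whole cone of the exponential, so a competing value need
  not come from a measure. Uniqueness is checked by hand: unit vectors fix the coefficients on the
  web, and all points vanish off it.\<close>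

lemma cone_integral_promotion:
  assumes "prob_space \<mu>" and sets: "sets \<mu> = sets G"
  shows "cone_integral (pcs_icone bangX) \<mu> (\<lambda>r. promotion (density_vector r)) = moments \<mu>"
  unfolding cone_integral_def
proof (rule the_equality)
  interpret prob_space \<mu> by fact
  have pt: "\<mu> \<in> finite_G" using sets finite_measure_axioms by simp
  have sp: "space \<mu> = space G" by (rule sets_eq_imp_space_eq[OF sets])
  have int: "(\<integral>\<^sup>+r. ennreal (pairing_functional v (promotion (density_vector r))) \<partial>\<mu>) = pairing W (moments \<mu>) v"
    if v: "v \<in> cotests" for v
  proof -
    have "ennreal (pairing_functional v (promotion (density_vector r))) = pairing W (promotion (density_vector r)) v"
      if "r \<in> space \<mu>" for r
    proof (rule ennreal_enn2real)
      have "pairing W (promotion (density_vector r)) v \<le> 1"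
        using that density_vector_total total_subset_elems by (intro cotestsD(3)[OF v]) (auto simp: sp)
      then show "pairing W (promotion (density_vector r)) v < \<top>"
        by (rule le_less_trans) simp
    qed
    then show ?thesis
      unfolding pairing_moments[OF pt cotestsD(1)[OF v]] by (intro nn_integral_cong)
  qed
  show "has_cone_integral (pcs_icone bangX) \<mu> (\<lambda>r. promotion (density_vector r)) (moments \<mu>)"
    unfolding has_cone_integral_def point_tests_bangX
  proof (intro conjI ballI)
    have "moments \<mu> \<in> elems bangX" using moments_totalX[OF assms] by (simp add: totalX_iff)
    then show "moments \<mu> \<in> points (pcs_icone bangX)"
      by (auto simp: pcs_icone_def intro!: exI[of _ 1] exI[of _ "moments \<mu>"])
    fix l assume "l \<in> pairing_functional ` cotests"
    then obtain v where v: "v \<in> cotests" "l = pairing_functional v" by blast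
    show "ennreal (l (moments \<mu>)) = (\<integral>\<^sup>+r. ennreal (l (promotion (density_vector r))) \<partial>\<mu>)"
      by (simp only: v(2) int[OF v(1)] ennreal_pairing_functional[OF moments_in_total_cone[OF pt] v(1)])
  qed
  fix y assume y: "has_cone_integral (pcs_icone bangX) \<mu> (\<lambda>r. promotion (density_vector r)) y"
  then have yp: "y \<in> points (pcs_icone bangX)" by (simp only: has_cone_integral_def)
  show "y = moments \<mu>"
  proof
    fix m
    show "y m = moments \<mu> m"
    proof (cases "m \<in> W")
      case True
      have "pairing_functional (unit_vector m) \<in> pairing_functional ` cotests"
        by (intro imageI unit_vector_cotest True)
      with y[unfolded has_cone_integral_def point_tests_bangX, THEN conjunct2]
      have "ennreal (pairing_functional (unit_vector m) y) =
          (\<integral>\<^sup>+r. ennreal (pairing_functional (unit_vector m) (promotion (density_vector r))) \<partial>\<mu>)"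
        by (rule bspec)
      then have "ennreal (y m) = ennreal (moments \<mu> m)"
        by (simp only: int[OF unit_vector_cotest[OF True]])
          (simp add: pairing_unit_vector[OF True] pcs_icone_pointD(1)[OF yp])
      then show ?thesis
        using pcs_icone_pointD(1)[OF yp] moments_nonneg[OF pt] by simp
    next
      case False
      then show ?thesis by (simp only: pcs_icone_pointD(2)[OF yp] moments_off_web[OF pt] not_False_eq_True)
    qed
  qed
qed

lemma totalX_eq_integrals:
  "totalX = {cone_integral (pcs_icone bangX) \<mu> (\<lambda>r. promotion (density_vector r)) |\<mu>.
     prob_space \<mu> \<and> sets \<mu> = sets G}"
  unfolding totalX_eq_moments using cone_integral_promotion by (intro Collect_cong) metis

end

theorem theorem6p15:
  fixes X :: "'a set"
  assumes "countable X"
  shows "icones_isomorphic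
           (totality_cone (bang (discrete_pcs X)) (bang_total (discrete_pcs X) (discrete_total X)))
           (measures_icone (prob_algebra (count_space X))) \<and>
         bang_total (discrete_pcs X) (discrete_total X) =
           {cone_integral (pcs_icone (bang (discrete_pcs X))) \<mu> (\<lambda>r. promotion (density_vector r)) |\<mu>.
              prob_space \<mu> \<and> sets \<mu> = sets (prob_algebra (count_space X))}"
proof -
  interpret countable_discrete X by (rule countable_discrete.intro[OF assms])
  show ?thesis using total_cone_isomorphic totalX_eq_integrals by (rule conjI)
qed

end
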